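(* Let $n\ge1$ and let $(\mathscr{C},\mathbb{E},\mathfrak{s})$ be an $n$-exangulated category. Then the following statements are equivalent. (1) There exist a fully faithful additive endofunctor $\Sigma\colon\mathscr{C}\to\mathscr{C}$ and an isomorphism of bifunctors $\mathbb{E}(-,-)\cong\mathscr{C}(-,\Sigma-)$ such that for any morphism $u\colon U\to\Sigma V$ there exists a distinguished $n$-exangle $V\to U_1\to U_2\to\cdots\to U_n\to U\dashrightarrow$ whose extension in $\mathbb{E}(U,V)$ corresponds to $u$. (2) For any object $C\in\mathscr{C}$, the morphism $C\to0$ is a trivial inflation. (3) There is a right $(n+2)$-angulated structure $(\Sigma,\Theta)$ on $\mathscr{C}$ which induces the $n$-exangulated structure $(\mathscr{C},\mathbb{E},\mathfrak{s})$.
   Context: **$n$-exangulated categories.** Let $\mathscr{C}$ be an additive category and $\mathbb{E}\colon\mathscr{C}^{\mathrm{op}}\times\mathscr{C}\to\mathsf{Ab}$ an additive bifunctor. Elements $\delta\in\mathbb{E}(C,A)$ are called extensions. For $a\in\mathscr{C}(A,A')$, $c\in\mathscr{C}(C',C)$ write $a_*\delta=\mathbb{E}(C,a)(\delta)$ and $c^*\delta=\mathbb{E}(c,A)(\delta)$. A morphism of extensions $(a,c)\colon\delta\to\rho$, with $\delta\in\mathbb{E}(C,A)$, $\rho\in\mathbb{E}(C',A')$, is a pair $a\in\mathscr{C}(A,A')$, $c\in\mathscr{C}(C,C')$ with $a_*\delta=c^*\rho$. Consider complexes $X^\bullet\colon X_0\xrightarrow{d_0^X}X_1\to\cdots\to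 X_n\xrightarrow{d_n^X}X_{n+1}$ concentrated in degrees $0,\dots,n+1$. For fixed $A,C$, complexes with $X_0=A$, $X_{n+1}=C$ form a category with morphisms $f^\bullet$ satisfying $f_0=1_A$, $f_{n+1}=1_C$. Two such morphisms $f,g\colon X^\bullet\to Y^\bullet$ are homotopic if there are $\varphi_i\colon X_i\to Y_{i-1}$ ($1\le i\le n+1$) with $\varphi_1d_0^X=0$, $g_i-f_i=d_{i-1}^Y\varphi_i+\varphi_{i+1}d_i^X$ ($1\le i\le n$), $d_n^Y\varphi_{n+1}=0$. Let $[X^\bullet]$ be the homotopy equivalence class in this sense. An $n$-exangle is a pair $\langle X^\bullet,\delta\rangle$ with $\delta\in\mathbb{E}(X_{n+1},X_0)$, $(d_0^X)_*\delta=0$, $(d_n^X)^*\delta=0$, such that the sequences of functors $\mathscr{C}(-,X_0)\to\mathscr{C}(-,X_1)\to\cdots\to\mathscr{C}(-,X_{n+1})\xrightarrow{f\mapsto f^*\delta}\mathbb{E}(-,X_0)$ and $\mathscr{C}(X_{n+1},-)\to\mathscr{C}(X_n,-)\to\cdots\to\mathscr{C}(X_0,-)\xrightarrow{g\mapsto g_*\delta}\mathbb{E}(X_{n+1},-)$ are exact. An exact realization $\mathfrak{s}$ assigns to each $\delta\in\mathbb{E}(C,A)$ a class $\mathfrak{s}(\delta)=[X^\bullet]$ with $X_0=A$, $X_{n+1}=C$ such that: - (R0) if $\mathfrak{s}(\delta)=[X^\bullet]$, $\mathfrak{s}(\rho)=[Y^\bullet]$, every morphism of extensions $(a,c)\colon\delta\to\rho$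 has a lift, i.e. a morphism of complexes $f^\bullet=(a,f_1,\dots,f_n,c)\colon X^\bullet\to Y^\bullet$; - (R1) if $\mathfrak{s}(\delta)=[X^\bullet]$ then $\langle X^\bullet,\delta\rangle$ is an $n$-exangle; - (R2) for all $A$, $0\in\mathbb{E}(0,A)$ is realized by $A\xrightarrow{1}A\to0\to\cdots\to0$ and $0\in\mathbb{E}(A,0)$ is realized by $0\to\cdots\to0\to A\xrightarrow{1}A$. If $\mathfrak{s}(\delta)=[X^\bullet]$, $\langle X^\bullet,\delta\rangle$ is a distinguished $n$-exangle, also written $X_0\to X_1\to\cdots\to X_{n+1}\overset{\delta}{\dashrightarrow}$; its $d_0^X$ is called an inflation and its $d_n^X$ a deflation. $(\mathscr{C},\mathbb{E},\mathfrak{s})$ is an $n$-exangulated category if $\mathfrak{s}$ is an exact realization of $\mathbb{E}$ and: - (EA1) inflations are closed under composition, and so are deflations; - (EA2) for $\rho\in\mathbb{E}(D,A)$, $c\in\mathscr{C}(C,D)$ and distinguished $\langle X^\bullet,c^*\rho\rangle$, $\langle Y^\bullet,\rho\rangle$, the pair $(1_A,c)$ has a lift $f^\bullet$ such that $\langle M_f^\bullet,(d_0^X)_*\rho\rangle$ is distinguished, where $M_f^\bullet$ is $X_1\to X_2\oplus Y_1\to\cdots\to X_{n+1}\oplus Y_n\to Y_{n+1}$ with differentials $\begin{bmatrix}-d_1^X\\ f_1\end{bmatrix}$, $\begin{bmatrix}-d_{i+1}^X&0\\ f_{i+1}&d_i^Y\end{bmatrix}$ ($1\le i\le n-1$), $\begin{bmatrix}f_{n+1}&d_n^Y\end{bmatrix}$;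 - (EA2$^{\mathrm{op}}$) the dual of (EA2). **Trivial inflation.** The morphism $X\to0$ is a trivial inflation if there is a distinguished $n$-exangle $X\to0\to0\to\cdots\to0\to Y\dashrightarrow$ for some object $Y$ (all $n$ middle terms zero). **Right $(n+2)$-angulated categories.** Let $\mathcal{A}$ be an additive category with an (additive) endofunctor $\Sigma$. An $(n+2)$-$\Sigma$-sequence is a sequence $A_0\xrightarrow{f_0}A_1\xrightarrow{f_1}\cdots\xrightarrow{f_n}A_{n+1}\xrightarrow{f_{n+1}}\Sigma A_0$; its left rotation is $A_1\xrightarrow{f_1}A_2\to\cdots\to A_{n+1}\xrightarrow{f_{n+1}}\Sigma A_0\xrightarrow{(-1)^n\Sigma f_0}\Sigma A_1$. A morphism of such sequences is $(\varphi_0,\dots,\varphi_{n+1})$ making all squares commute, the last one with $\Sigma\varphi_0$ on the right; it is an isomorphism if all $\varphi_i$ are. A right $(n+2)$-angulated category is a triple $(\mathcal{A},\Sigma,\Theta)$ with $\Theta$ a class of $(n+2)$-$\Sigma$-sequences (right $(n+2)$-angles) such that: - (RN1) (a) $\Theta$ is closed under isomorphisms, direct sums and direct summands; (b) for each $A$, $0\to A\xrightarrow{1}A\to0\to\cdots\to0$ is in $\Theta$; (c) each morphism $f_0\colon A_0\to A_1$ is the first morphism of some sequence in $\Theta$. - (RN2) $\Theta$ is closed under left rotation. - (RN3) Given two sequences in $\Theta$ with morphisms $f_i$ and $g_i$, and $\varphi_0,\varphi_1$ with $\varphi_1f_0=g_0\varphi_0$, the pair extends to a morphism $(\varphi_0,\dots,\varphi_{n+1})$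 of $(n+2)$-$\Sigma$-sequences. - (RN4) Given sequences in $\Theta$: $A_0\xrightarrow{f_0}A_1\xrightarrow{f_1}\cdots\xrightarrow{f_n}A_{n+1}\xrightarrow{f_{n+1}}\Sigma A_0$, $A_0\xrightarrow{g_0}B_1\xrightarrow{g_1}\cdots\xrightarrow{g_n}B_{n+1}\xrightarrow{g_{n+1}}\Sigma A_0$ and $A_1\xrightarrow{\varphi_1}B_1\xrightarrow{h_1}C_2\xrightarrow{h_2}\cdots\xrightarrow{h_n}C_{n+1}\xrightarrow{h_{n+1}}\Sigma A_1$ with $g_0=\varphi_1f_0$, there exist $\varphi_i\colon A_i\to B_i$ ($2\le i\le n+1$), $\psi_j\colon B_j\to C_j$ ($2\le j\le n+1$), $\phi_k\colon A_k\to C_{k-1}$ ($3\le k\le n+1$) such that $(1_{A_0},\varphi_1,\dots,\varphi_{n+1})$ is a morphism of $(n+2)$-$\Sigma$-sequences, $h_{n+1}\psi_{n+1}=\Sigma f_0\circ g_{n+1}$, and the following sequence is in $\Theta$: $A_2\to A_3\oplus B_2\to A_4\oplus B_3\oplus C_2\to\cdots\to A_{n+1}\oplus B_n\oplus C_{n-1}\to B_{n+1}\oplus C_n\to C_{n+1}\to\Sigma A_2$, where the first map is $\binom{f_2}{\varphi_2}$; the map $A_i\oplus B_{i-1}\oplus C_{i-2}\to A_{i+1}\oplus B_i\oplus C_{i-1}$ ($3\le i\le n$) is $\left(\begin{smallmatrix}-f_i&0&0\\ (-1)^{i+1}\varphi_i&-g_{i-1}&0\\ \phi_i&\psi_{i-1}&h_{i-2}\end{smallmatrix}\right)$;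 the map into $B_{n+1}\oplus C_n$ is $\left(\begin{smallmatrix}(-1)^n\varphi_{n+1}&-g_n&0\\ \phi_{n+1}&\psi_n&h_{n-1}\end{smallmatrix}\right)$; then $(\psi_{n+1},h_n)$; and the last map is $\Sigma f_1\circ h_{n+1}$. (Terms $A_i$ with $i>n+1$ and $C_i$ with $i<2$ are omitted; e.g. for $n=1$ the sequence is $A_2\xrightarrow{\varphi_2}B_2\xrightarrow{\psi_2}C_2\to\Sigma A_2$.) **Induced structure.** An $n$-exangulated structure $(\mathscr{C},\mathbb{E},\mathfrak{s})$ is induced by a right $(n+2)$-angulated structure $(\Sigma,\Theta)$ on $\mathscr{C}$ if there is an isomorphism of bifunctors $\Phi\colon\mathbb{E}(-,-)\cong\mathscr{C}(-,\Sigma-)$ such that (i) for every $\delta\in\mathbb{E}(C,A)$ there is a right $(n+2)$-angle $A\to X_1\to\cdots\to X_n\to C\xrightarrow{\Phi(\delta)}\Sigma A$ in $\Theta$, and (ii) for every such right $(n+2)$-angle, $\mathfrak{s}(\delta)$ is the class of the complex $A\to X_1\to\cdots\to X_n\to C$. *)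

theory Defs
  imports "HOL-Algebra.FiniteProduct"
begin

section \<open>Additive categories\<close>

text \<open>The hom-sets are abelian groups of HOL-Algebra. These are written multiplicatively there, so
  the group operation, unit and inverse of \<open>Hom \<C> A B\<close> are the sum, zero and negative of morphisms;
  the abbreviations below restore additive notation. Composition \<open>g \<cdot> f\<close> is in applicative order.\<close>

record ('o, 'm) category =
  Obj :: "'o set"
  Hom :: "'o \<Rightarrow> 'o \<Rightarrow> 'm monoid"
  IdM :: "'o \<Rightarrow> 'm"
  Comp :: "'m \<Rightarrow> 'm \<Rightarrow> 'm"  (infixr "\<cdot>\<index>" 75)

abbreviation Mor :: "('o, 'm) category \<Rightarrow> 'o \<Rightarrow> 'o \<Rightarrow> 'm set"
  where "Mor \<C> A B \<equiv> carrier (Hom \<C> A B)"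

abbreviation zero_mor :: "('o, 'm) category \<Rightarrow> 'o \<Rightarrow> 'o \<Rightarrow> 'm"
  where "zero_mor \<C> A B \<equiv> one (Hom \<C> A B)"

abbreviation add_mor :: "('o, 'm) category \<Rightarrow> 'o \<Rightarrow> 'o \<Rightarrow> 'm \<Rightarrow> 'm \<Rightarrow> 'm"
  where "add_mor \<C> A B f g \<equiv> mult (Hom \<C> A B) f g"

abbreviation neg_mor :: "('o, 'm) category \<Rightarrow> 'o \<Rightarrow> 'o \<Rightarrow> 'm \<Rightarrow> 'm"
  where "neg_mor \<C> A B f \<equiv> m_inv (Hom \<C> A B) f"

text \<open>\<open>sgn_mor \<C> A B k f\<close> is \<open>(-1)^k f\<close> for \<open>f : A \<rightarrow> B\<close>.\<close>

definition sgn_mor :: "('o, 'm) category \<Rightarrow> 'o \<Rightarrow> 'o \<Rightarrow> nat \<Rightarrow> 'm \<Rightarrow> 'm"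
  where "sgn_mor \<C> A B k f = (if even k then f else neg_mor \<C> A B f)"

definition zero_object :: "('o, 'm) category \<Rightarrow> 'o \<Rightarrow> bool"
  where "zero_object \<C> Z \<longleftrightarrow>
    Z \<in> Obj \<C> \<and> (\<forall>A\<in>Obj \<C>. (\<exists>!f. f \<in> Mor \<C> A Z) \<and> (\<exists>!f. f \<in> Mor \<C> Z A))"

definition iso_mor :: "('o, 'm) category \<Rightarrow> 'o \<Rightarrow> 'o \<Rightarrow> 'm \<Rightarrow> bool"
  where "iso_mor \<C> A B f \<longleftrightarrow>
    f \<in> Mor \<C> A B \<and> (\<exists>g\<in>Mor \<C> B A. g \<cdot>\<^bsub>\<C>\<^esub> f = IdM \<C> A \<and> f \<cdot>\<^bsub>\<C>\<^esub> g = IdM \<C> B)"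

text \<open>\<open>S\<close> is a biproduct of the finite family \<open>(F i)\<close>, \<open>i \<in> I\<close>, with the given injections and
  projections; the \<open>finprod\<close> is the sum of the idempotents \<open>inc i \<cdot> prj i\<close>.\<close>

definition biproduct ::
  "('o, 'm) category \<Rightarrow> 'i set \<Rightarrow> ('i \<Rightarrow> 'o) \<Rightarrow> 'o \<Rightarrow> ('i \<Rightarrow> 'm) \<Rightarrow> ('i \<Rightarrow> 'm) \<Rightarrow> bool"
  where "biproduct \<C> I F S inc prj \<longleftrightarrow>
    finite I \<and> S \<in> Obj \<C> \<and>
    (\<forall>i\<in>I. F i \<in> Obj \<C> \<and> inc i \<in> Mor \<C> (F i) S \<and> prj i \<in> Mor \<C> S (F i)) \<and>
    (\<forall>i\<in>I. \<forall>j\<in>I. prj j \<cdot>\<^bsub>\<C>\<^esub> inc i = (if i = j then IdM \<C> (F i) else zero_mor \<C> (F i) (F j))) \<and>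
    finprod (Hom \<C> S S) (\<lambda>i. inc i \<cdot>\<^bsub>\<C>\<^esub> prj i) I = IdM \<C> S"

datatype summand = Fst | Snd | Trd

text \<open>Hom-sets of distinct pairs of objects are disjoint, and a hom-set with an end outside \<open>Obj \<C>\<close> is
  empty, so a morphism determines its domain and codomain.\<close>

locale additive_category =
  fixes \<C> :: "('o, 'm) category" (structure)
  assumes mor_objects: "f \<in> Mor \<C> A B \<Longrightarrow> A \<in> Obj \<C> \<and> B \<in> Obj \<C>"
    and mor_disjoint: "f \<in> Mor \<C> A B \<Longrightarrow> f \<in> Mor \<C> A' B' \<Longrightarrow> A = A' \<and> B = B'"
    and id_mor: "A \<in> Obj \<C> \<Longrightarrow> IdM \<C> A \<in> Mor \<C> A A"
    and comp_mor: "f \<in> Mor \<C> A B \<Longrightarrow> g \<in> Mor \<C> B D \<Longrightarrow> g \<cdot> f \<in> Mor \<C> A D"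
    and comp_assoc: "f \<in> Mor \<C> A B \<Longrightarrow> g \<in> Mor \<C> B D \<Longrightarrow> h \<in> Mor \<C> D G \<Longrightarrow>
      (h \<cdot> g) \<cdot> f = h \<cdot> (g \<cdot> f)"
    and comp_id: "f \<in> Mor \<C> A B \<Longrightarrow> f \<cdot> IdM \<C> A = f \<and> IdM \<C> B \<cdot> f = f"
    and hom_group: "A \<in> Obj \<C> \<Longrightarrow> B \<in> Obj \<C> \<Longrightarrow> comm_group (Hom \<C> A B)"
    and comp_add_right: "f \<in> Mor \<C> A B \<Longrightarrow> f' \<in> Mor \<C> A B \<Longrightarrow> g \<in> Mor \<C> B D \<Longrightarrow>
      g \<cdot> add_mor \<C> A B f f' = add_mor \<C> A D (g \<cdot> f) (g \<cdot> f')"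
    and comp_add_left: "f \<in> Mor \<C> A B \<Longrightarrow> g \<in> Mor \<C> B D \<Longrightarrow> g' \<in> Mor \<C> B D \<Longrightarrow>
      add_mor \<C> B D g g' \<cdot> f = add_mor \<C> A D (g \<cdot> f) (g' \<cdot> f)"
    and has_zero_object: "\<exists>Z. zero_object \<C> Z"
    and has_biproducts: "A \<in> Obj \<C> \<Longrightarrow> B \<in> Obj \<C> \<Longrightarrow>
      \<exists>S inc prj. biproduct \<C> {Fst, Snd} (\<lambda>i. if i = Fst then A else B) S inc prj"


section \<open>Additive bifunctors\<close>

text \<open>\<open>Ext E C A\<close> is the abelian group \<open>E(C, A)\<close> (again in multiplicative notation), contravariant in
  \<open>C\<close>. \<open>EMap E c a : E(C, A) \<rightarrow> E(C', A')\<close> is its action on \<open>c : C' \<rightarrow> C\<close> and \<open>a : A \<rightarrow> A'\<close>.\<close>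

record ('o, 'm, 'e) bifunctor =
  Ext :: "'o \<Rightarrow> 'o \<Rightarrow> 'e monoid"
  EMap :: "'m \<Rightarrow> 'm \<Rightarrow> 'e \<Rightarrow> 'e"

text \<open>For \<open>\<delta> \<in> E(C, A)\<close>: \<open>push \<C> E C a \<delta>\<close> is \<open>a\<^sub>*\<delta>\<close>, and \<open>pull \<C> E A c \<delta>\<close> is \<open>c\<^sup>*\<delta>\<close>.\<close>

definition push :: "('o, 'm) category \<Rightarrow> ('o, 'm, 'e) bifunctor \<Rightarrow> 'o \<Rightarrow> 'm \<Rightarrow> 'e \<Rightarrow> 'e"
  where "push \<C> E C a \<delta> = EMap E (IdM \<C> C) a \<delta>"

definition pull :: "('o, 'm) category \<Rightarrow> ('o, 'm, 'e) bifunctor \<Rightarrow> 'o \<Rightarrow> 'm \<Rightarrow> 'e \<Rightarrow> 'e"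
  where "pull \<C> E A c \<delta> = EMap E c (IdM \<C> A) \<delta>"

locale additive_bifunctor = additive_category \<C>
  for \<C> :: "('o, 'm) category" (structure) +
  fixes E :: "('o, 'm, 'e) bifunctor"
  assumes ext_group: "C \<in> Obj \<C> \<Longrightarrow> A \<in> Obj \<C> \<Longrightarrow> comm_group (Ext E C A)"
    and emap_hom: "c \<in> Mor \<C> C' C \<Longrightarrow> a \<in> Mor \<C> A A' \<Longrightarrow> EMap E c a \<in> hom (Ext E C A) (Ext E C' A')"
    and emap_id: "C \<in> Obj \<C> \<Longrightarrow> A \<in> Obj \<C> \<Longrightarrow> \<delta> \<in> carrier (Ext E C A) \<Longrightarrow>
      EMap E (IdM \<C> C) (IdM \<C> A) \<delta> = \<delta>"
    and emap_comp: "c \<in> Mor \<C> C' C \<Longrightarrow> c' \<in> Mor \<C> C'' C' \<Longrightarrow> a \<in> Mor \<C> A A' \<Longrightarrow> a' \<in> Mor \<C> A' A'' \<Longrightarrow>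
      \<delta> \<in> carrier (Ext E C A) \<Longrightarrow> EMap E (c \<cdot> c') (a' \<cdot> a) \<delta> = EMap E c' a' (EMap E c a \<delta>)"
    and push_add: "C \<in> Obj \<C> \<Longrightarrow> a \<in> Mor \<C> A A' \<Longrightarrow> a' \<in> Mor \<C> A A' \<Longrightarrow> \<delta> \<in> carrier (Ext E C A) \<Longrightarrow>
      push \<C> E C (add_mor \<C> A A' a a') \<delta> = push \<C> E C a \<delta> \<otimes>\<^bsub>Ext E C A'\<^esub> push \<C> E C a' \<delta>"
    and pull_add: "A \<in> Obj \<C> \<Longrightarrow> c \<in> Mor \<C> C' C \<Longrightarrow> c' \<in> Mor \<C> C' C \<Longrightarrow> \<delta> \<in> carrier (Ext E C A) \<Longrightarrow>
      pull \<C> E A (add_mor \<C> C' C c c') \<delta> = pull \<C> E A c \<delta> \<otimes>\<^bsub>Ext E C' A\<^esub> pull \<C> E A c' \<delta>"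


section \<open>Complexes and homotopy\<close>

text \<open>A finite chain of morphisms, used both for complexes \<open>X\<^sub>0 \<rightarrow> \<dots> \<rightarrow> X\<^sub>n\<^sub>+\<^sub>1\<close> (objects with index
  \<open>\<le> n + 1\<close>, differentials with index \<open>\<le> n\<close>) and for \<open>(n+2)\<close>-\<open>\<Sigma>\<close>-sequences, where \<open>Dif X (n + 1)\<close> is the
  last map \<open>X\<^sub>n\<^sub>+\<^sub>1 \<rightarrow> \<Sigma> X\<^sub>0\<close>. Entries outside these ranges are irrelevant.\<close>

record ('o, 'm) chain =
  Vx :: "nat \<Rightarrow> 'o"
  Dif :: "nat \<Rightarrow> 'm"

definition is_complex :: "nat \<Rightarrow> ('o, 'm) category \<Rightarrow> ('o, 'm) chain \<Rightarrow> bool"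
  where "is_complex n \<C> X \<longleftrightarrow>
    (\<forall>i\<le>n + 1. Vx X i \<in> Obj \<C>) \<and>
    (\<forall>i\<le>n. Dif X i \<in> Mor \<C> (Vx X i) (Vx X (i + 1))) \<and>
    (\<forall>i<n. Dif X (i + 1) \<cdot>\<^bsub>\<C>\<^esub> Dif X i = zero_mor \<C> (Vx X i) (Vx X (i + 2)))"

definition complex_mor ::
  "nat \<Rightarrow> ('o, 'm) category \<Rightarrow> ('o, 'm) chain \<Rightarrow> ('o, 'm) chain \<Rightarrow> (nat \<Rightarrow> 'm) \<Rightarrow> bool"
  where "complex_mor n \<C> X Y f \<longleftrightarrow>
    (\<forall>i\<le>n + 1. f i \<in> Mor \<C> (Vx X i) (Vx Y i)) \<and>
    (\<forall>i\<le>n. f (i + 1) \<cdot>\<^bsub>\<C>\<^esub> Dif X i = Dif Y i \<cdot>\<^bsub>\<C>\<^esub> f i)"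

definition fixed_ends_mor ::
  "nat \<Rightarrow> ('o, 'm) category \<Rightarrow> ('o, 'm) chain \<Rightarrow> ('o, 'm) chain \<Rightarrow> (nat \<Rightarrow> 'm) \<Rightarrow> bool"
  where "fixed_ends_mor n \<C> X Y f \<longleftrightarrow>
    Vx X 0 = Vx Y 0 \<and> Vx X (n + 1) = Vx Y (n + 1) \<and> complex_mor n \<C> X Y f \<and>
    f 0 = IdM \<C> (Vx X 0) \<and> f (n + 1) = IdM \<C> (Vx X (n + 1))"

definition homotopic ::
  "nat \<Rightarrow> ('o, 'm) category \<Rightarrow> ('o, 'm) chain \<Rightarrow> ('o, 'm) chain \<Rightarrow> (nat \<Rightarrow> 'm) \<Rightarrow> (nat \<Rightarrow> 'm) \<Rightarrow> bool"
  where "homotopic n \<C> X Y f g \<longleftrightarrow>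
    (\<exists>\<phi>. (\<forall>i\<in>{1..n + 1}. \<phi> i \<in> Mor \<C> (Vx X i) (Vx Y (i - 1))) \<and>
      \<phi> 1 \<cdot>\<^bsub>\<C>\<^esub> Dif X 0 = zero_mor \<C> (Vx X 0) (Vx Y 0) \<and>
      (\<forall>i\<in>{1..n}.
        add_mor \<C> (Vx X i) (Vx Y i) (g i) (neg_mor \<C> (Vx X i) (Vx Y i) (f i)) =
        add_mor \<C> (Vx X i) (Vx Y i) (Dif Y (i - 1) \<cdot>\<^bsub>\<C>\<^esub> \<phi> i) (\<phi> (i + 1) \<cdot>\<^bsub>\<C>\<^esub> Dif X i)) \<and>
      Dif Y n \<cdot>\<^bsub>\<C>\<^esub> \<phi> (n + 1) = zero_mor \<C> (Vx X (n + 1)) (Vx Y (n + 1)))"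

definition homotopy_equivalent ::
  "nat \<Rightarrow> ('o, 'm) category \<Rightarrow> ('o, 'm) chain \<Rightarrow> ('o, 'm) chain \<Rightarrow> bool"
  where "homotopy_equivalent n \<C> X Y \<longleftrightarrow>
    (\<exists>f g. fixed_ends_mor n \<C> X Y f \<and> fixed_ends_mor n \<C> Y X g \<and>
      homotopic n \<C> X X (\<lambda>i. g i \<cdot>\<^bsub>\<C>\<^esub> f i) (\<lambda>i. IdM \<C> (Vx X i)) \<and>
      homotopic n \<C> Y Y (\<lambda>i. f i \<cdot>\<^bsub>\<C>\<^esub> g i) (\<lambda>i. IdM \<C> (Vx Y i)))"

definition homotopy_class :: "nat \<Rightarrow> ('o, 'm) category \<Rightarrow> ('o, 'm) chain \<Rightarrow> ('o, 'm) chain set"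
  where "homotopy_class n \<C> X = {Y. is_complex n \<C> Y \<and> homotopy_equivalent n \<C> X Y}"

text \<open>\<open>id_chain \<C> Z A p\<close> has the identity of \<open>A\<close> from degree \<open>p\<close> to degree \<open>p + 1\<close>, and \<open>Z\<close> in all
  other degrees.\<close>

definition id_chain :: "('o, 'm) category \<Rightarrow> 'o \<Rightarrow> 'o \<Rightarrow> nat \<Rightarrow> ('o, 'm) chain"
  where "id_chain \<C> Z A p =
    (let V = (\<lambda>i. if i = p \<or> i = p + 1 then A else Z)
     in \<lparr>Vx = V, Dif = (\<lambda>i. if i = p then IdM \<C> A else zero_mor \<C> (V i) (V (i + 1)))\<rparr>)"

text \<open>\<open>block_chain n \<C> I F D M\<close>: for \<open>k \<le> n + 1\<close> the object \<open>Vx M k\<close> is the biproduct of the \<open>F k i\<close>,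
  \<open>i \<in> I k\<close>, and for \<open>k \<le> n\<close> the differential \<open>Dif M k\<close> is the block matrix with entry
  \<open>D k r c : F k c \<rightarrow> F (k + 1) r\<close> in row \<open>r\<close> and column \<open>c\<close>. In the two end degrees, where \<open>I k\<close> will be a
  singleton, \<open>Vx M k\<close> is that single summand itself and not just an object isomorphic to it. In the
  middle degrees the choice of biproducts is immaterial: it changes \<open>M\<close> by an isomorphism that is the
  identity at both ends.\<close>

definition block_chain ::
  "nat \<Rightarrow> ('o, 'm) category \<Rightarrow> (nat \<Rightarrow> 'i set) \<Rightarrow> (nat \<Rightarrow> 'i \<Rightarrow> 'o) \<Rightarrow> (nat \<Rightarrow> 'i \<Rightarrow> 'i \<Rightarrow> 'm) \<Rightarrow>
    ('o, 'm) chain \<Rightarrow> bool"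
  where "block_chain n \<C> I F D M \<longleftrightarrow>
    (\<exists>inc prj.
      (\<forall>k\<le>n + 1. biproduct \<C> (I k) (F k) (Vx M k) (inc k) (prj k)) \<and>
      (\<forall>k\<in>{0, n + 1}. \<forall>i\<in>I k.
        Vx M k = F k i \<and> inc k i = IdM \<C> (F k i) \<and> prj k i = IdM \<C> (F k i)) \<and>
      (\<forall>k\<le>n. Dif M k \<in> Mor \<C> (Vx M k) (Vx M (k + 1)) \<and>
        (\<forall>c\<in>I k. \<forall>r\<in>I (k + 1). prj (k + 1) r \<cdot>\<^bsub>\<C>\<^esub> Dif M k \<cdot>\<^bsub>\<C>\<^esub> inc k c = D k r c)))"

text \<open>The mapping cone \<open>X\<^sub>1 \<rightarrow> X\<^sub>2 \<oplus> Y\<^sub>1 \<rightarrow> \<dots> \<rightarrow> X\<^sub>n\<^sub>+\<^sub>1 \<oplus> Y\<^sub>n \<rightarrow> Y\<^sub>n\<^sub>+\<^sub>1\<close>: in degree \<open>k\<close> the summands are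
  \<open>X\<^sub>k\<^sub>+\<^sub>1\<close> (if \<open>k \<le> n\<close>) and \<open>Y\<^sub>k\<close> (if \<open>1 \<le> k\<close>).\<close>

definition mapping_cone ::
  "nat \<Rightarrow> ('o, 'm) category \<Rightarrow> ('o, 'm) chain \<Rightarrow> ('o, 'm) chain \<Rightarrow> (nat \<Rightarrow> 'm) \<Rightarrow> ('o, 'm) chain \<Rightarrow> bool"
  where "mapping_cone n \<C> X Y f M \<longleftrightarrow>
    block_chain n \<C>
      (\<lambda>k. {i. i = Fst \<and> k \<le> n \<or> i = Snd \<and> 1 \<le> k})
      (\<lambda>k i. if i = Fst then Vx X (k + 1) else Vx Y k)
      (\<lambda>k r c. case (r, c) of
          (Fst, Fst) \<Rightarrow> neg_mor \<C> (Vx X (k + 1)) (Vx X (k + 2)) (Dif X (k + 1))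
        | (Snd, Fst) \<Rightarrow> f (k + 1)
        | (Snd, Snd) \<Rightarrow> Dif Y k
        | _ \<Rightarrow> zero_mor \<C> (Vx Y k) (Vx X (k + 2)))
      M"

text \<open>The mapping cocone \<open>X\<^sub>0 \<rightarrow> Y\<^sub>0 \<oplus> X\<^sub>1 \<rightarrow> \<dots> \<rightarrow> Y\<^sub>n\<^sub>-\<^sub>1 \<oplus> X\<^sub>n \<rightarrow> Y\<^sub>n\<close>, i.e. the mapping cone formed in the
  opposite category: in degree \<open>k\<close> the summands are \<open>Y\<^sub>k\<^sub>-\<^sub>1\<close> (if \<open>1 \<le> k\<close>) and \<open>X\<^sub>k\<close> (if \<open>k \<le> n\<close>).
  Under this dualization the signs fall on the differentials of the target \<open>Y\<close> of \<open>f\<close>.\<close>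

definition mapping_cocone ::
  "nat \<Rightarrow> ('o, 'm) category \<Rightarrow> ('o, 'm) chain \<Rightarrow> ('o, 'm) chain \<Rightarrow> (nat \<Rightarrow> 'm) \<Rightarrow> ('o, 'm) chain \<Rightarrow> bool"
  where "mapping_cocone n \<C> X Y f M \<longleftrightarrow>
    block_chain n \<C>
      (\<lambda>k. {i. i = Fst \<and> 1 \<le> k \<or> i = Snd \<and> k \<le> n})
      (\<lambda>k i. if i = Fst then Vx Y (k - 1) else Vx X k)
      (\<lambda>k r c. case (r, c) of
          (Fst, Fst) \<Rightarrow> neg_mor \<C> (Vx Y (k - 1)) (Vx Y k) (Dif Y (k - 1))
        | (Fst, Snd) \<Rightarrow> f k
        | (Snd, Snd) \<Rightarrow> Dif X k
        | _ \<Rightarrow> zero_mor \<C> (Vx Y (k - 1)) (Vx X (k + 1)))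
      M"


section \<open>n-exangulated categories\<close>

definition n_exangle ::
  "nat \<Rightarrow> ('o, 'm) category \<Rightarrow> ('o, 'm, 'e) bifunctor \<Rightarrow> ('o, 'm) chain \<Rightarrow> 'e \<Rightarrow> bool"
  where "n_exangle n \<C> E X \<delta> \<longleftrightarrow>
    is_complex n \<C> X \<and> \<delta> \<in> carrier (Ext E (Vx X (n + 1)) (Vx X 0)) \<and>
    push \<C> E (Vx X (n + 1)) (Dif X 0) \<delta> = \<one>\<^bsub>Ext E (Vx X (n + 1)) (Vx X 1)\<^esub> \<and>
    pull \<C> E (Vx X 0) (Dif X n) \<delta> = \<one>\<^bsub>Ext E (Vx X n) (Vx X 0)\<^esub> \<and>
    (\<forall>T\<in>Obj \<C>.
      (\<forall>i<n. {f \<in> Mor \<C> T (Vx X (i + 1)). Dif X (i + 1) \<cdot>\<^bsub>\<C>\<^esub> f = zero_mor \<C> T (Vx X (i + 2))}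
        = (\<lambda>g. Dif X i \<cdot>\<^bsub>\<C>\<^esub> g) ` Mor \<C> T (Vx X i)) \<and>
      {f \<in> Mor \<C> T (Vx X (n + 1)). pull \<C> E (Vx X 0) f \<delta> = \<one>\<^bsub>Ext E T (Vx X 0)\<^esub>}
        = (\<lambda>g. Dif X n \<cdot>\<^bsub>\<C>\<^esub> g) ` Mor \<C> T (Vx X n)) \<and>
    (\<forall>T\<in>Obj \<C>.
      (\<forall>i<n. {f \<in> Mor \<C> (Vx X (i + 1)) T. f \<cdot>\<^bsub>\<C>\<^esub> Dif X i = zero_mor \<C> (Vx X i) T}
        = (\<lambda>g. g \<cdot>\<^bsub>\<C>\<^esub> Dif X (i + 1)) ` Mor \<C> (Vx X (i + 2)) T) \<and>
      {f \<in> Mor \<C> (Vx X 0) T. push \<C> E (Vx X (n + 1)) f \<delta> = \<one>\<^bsub>Ext E (Vx X (n + 1)) T\<^esub>}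
        = (\<lambda>g. g \<cdot>\<^bsub>\<C>\<^esub> Dif X 0) ` Mor \<C> (Vx X 1) T)"

text \<open>A realization \<open>\<s>\<close> is applied as \<open>\<s> C A \<delta>\<close> for \<open>\<delta> \<in> E(C, A)\<close>.\<close>

type_synonym ('o, 'm, 'e) realization = "'o \<Rightarrow> 'o \<Rightarrow> 'e \<Rightarrow> ('o, 'm) chain set"

definition distinguished ::
  "nat \<Rightarrow> ('o, 'm) category \<Rightarrow> ('o, 'm, 'e) bifunctor \<Rightarrow> ('o, 'm, 'e) realization \<Rightarrow>
    ('o, 'm) chain \<Rightarrow> 'e \<Rightarrow> bool"
  where "distinguished n \<C> E \<s> X \<delta> \<longleftrightarrow>
    is_complex n \<C> X \<and> \<delta> \<in> carrier (Ext E (Vx X (n + 1)) (Vx X 0)) \<and>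
    \<s> (Vx X (n + 1)) (Vx X 0) \<delta> = homotopy_class n \<C> X"

definition inflation ::
  "nat \<Rightarrow> ('o, 'm) category \<Rightarrow> ('o, 'm, 'e) bifunctor \<Rightarrow> ('o, 'm, 'e) realization \<Rightarrow> 'm \<Rightarrow> bool"
  where "inflation n \<C> E \<s> f \<longleftrightarrow> (\<exists>X \<delta>. distinguished n \<C> E \<s> X \<delta> \<and> Dif X 0 = f)"

definition deflation ::
  "nat \<Rightarrow> ('o, 'm) category \<Rightarrow> ('o, 'm, 'e) bifunctor \<Rightarrow> ('o, 'm, 'e) realization \<Rightarrow> 'm \<Rightarrow> bool"
  where "deflation n \<C> E \<s> f \<longleftrightarrow> (\<exists>X \<delta>. distinguished n \<C> E \<s> X \<delta> \<and> Dif X n = f)"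

locale exact_realization = additive_bifunctor \<C> E
  for \<C> :: "('o, 'm) category" (structure) and E :: "('o, 'm, 'e) bifunctor" +
  fixes n :: nat and \<s> :: "('o, 'm, 'e) realization"
  assumes realized: "C \<in> Obj \<C> \<Longrightarrow> A \<in> Obj \<C> \<Longrightarrow> \<delta> \<in> carrier (Ext E C A) \<Longrightarrow>
      \<exists>X. Vx X 0 = A \<and> Vx X (n + 1) = C \<and> distinguished n \<C> E \<s> X \<delta>"
    and R0: "distinguished n \<C> E \<s> X \<delta> \<Longrightarrow> distinguished n \<C> E \<s> Y \<rho> \<Longrightarrow>
      a \<in> Mor \<C> (Vx X 0) (Vx Y 0) \<Longrightarrow> c \<in> Mor \<C> (Vx X (n + 1)) (Vx Y (n + 1)) \<Longrightarrow>
      push \<C> E (Vx X (n + 1)) a \<delta> = pull \<C> E (Vx Y 0) c \<rho> \<Longrightarrow>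
      \<exists>f. complex_mor n \<C> X Y f \<and> f 0 = a \<and> f (n + 1) = c"
    and R1: "distinguished n \<C> E \<s> X \<delta> \<Longrightarrow> n_exangle n \<C> E X \<delta>"
    and R2: "A \<in> Obj \<C> \<Longrightarrow> zero_object \<C> Z \<Longrightarrow>
      distinguished n \<C> E \<s> (id_chain \<C> Z A 0) \<one>\<^bsub>Ext E Z A\<^esub> \<and>
      distinguished n \<C> E \<s> (id_chain \<C> Z A n) \<one>\<^bsub>Ext E A Z\<^esub>"

locale n_exangulated_category = exact_realization \<C> E n \<s>
  for \<C> :: "('o, 'm) category" (structure) and E :: "('o, 'm, 'e) bifunctor"
    and n :: nat and \<s> :: "('o, 'm, 'e) realization" +
  assumes EA1: "f \<in> Mor \<C> A B \<Longrightarrow> g \<in> Mor \<C> B D \<Longrightarrow>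
      inflation n \<C> E \<s> f \<Longrightarrow> inflation n \<C> E \<s> g \<Longrightarrow> inflation n \<C> E \<s> (g \<cdot> f)"
    and EA1_op: "f \<in> Mor \<C> A B \<Longrightarrow> g \<in> Mor \<C> B D \<Longrightarrow>
      deflation n \<C> E \<s> f \<Longrightarrow> deflation n \<C> E \<s> g \<Longrightarrow> deflation n \<C> E \<s> (g \<cdot> f)"
    and EA2: "\<rho> \<in> carrier (Ext E D A) \<Longrightarrow> c \<in> Mor \<C> C D \<Longrightarrow>
      Vx X 0 = A \<Longrightarrow> Vx X (n + 1) = C \<Longrightarrow> distinguished n \<C> E \<s> X (pull \<C> E A c \<rho>) \<Longrightarrow>
      Vx Y 0 = A \<Longrightarrow> Vx Y (n + 1) = D \<Longrightarrow> distinguished n \<C> E \<s> Y \<rho> \<Longrightarrow>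
      \<exists>f M. complex_mor n \<C> X Y f \<and> f 0 = IdM \<C> A \<and> f (n + 1) = c \<and>
        mapping_cone n \<C> X Y f M \<and> distinguished n \<C> E \<s> M (push \<C> E D (Dif X 0) \<rho>)"
    and EA2_op: "\<rho> \<in> carrier (Ext E C A) \<Longrightarrow> a \<in> Mor \<C> A B \<Longrightarrow>
      Vx X 0 = A \<Longrightarrow> Vx X (n + 1) = C \<Longrightarrow> distinguished n \<C> E \<s> X \<rho> \<Longrightarrow>
      Vx Y 0 = B \<Longrightarrow> Vx Y (n + 1) = C \<Longrightarrow> distinguished n \<C> E \<s> Y (push \<C> E C a \<rho>) \<Longrightarrow>
      \<exists>f M. complex_mor n \<C> X Y f \<and> f 0 = a \<and> f (n + 1) = IdM \<C> C \<and>
        mapping_cocone n \<C> X Y f M \<and> distinguished n \<C> E \<s> M (pull \<C> E A (Dif Y n) \<rho>)"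

definition trivial_inflation ::
  "nat \<Rightarrow> ('o, 'm) category \<Rightarrow> ('o, 'm, 'e) bifunctor \<Rightarrow> ('o, 'm, 'e) realization \<Rightarrow> 'm \<Rightarrow> bool"
  where "trivial_inflation n \<C> E \<s> f \<longleftrightarrow>
    (\<exists>X \<delta>. distinguished n \<C> E \<s> X \<delta> \<and> Dif X 0 = f \<and> (\<forall>i\<in>{1..n}. zero_object \<C> (Vx X i)))"


section \<open>Endofunctors and right (n+2)-angulated categories\<close>

record ('o, 'm) endofunctor =
  FOb :: "'o \<Rightarrow> 'o"
  FMor :: "'m \<Rightarrow> 'm"

definition additive_endofunctor :: "('o, 'm) category \<Rightarrow> ('o, 'm) endofunctor \<Rightarrow> bool"
  where "additive_endofunctor \<C> \<Sigma> \<longleftrightarrow>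
    (\<forall>A\<in>Obj \<C>. FOb \<Sigma> A \<in> Obj \<C> \<and> FMor \<Sigma> (IdM \<C> A) = IdM \<C> (FOb \<Sigma> A)) \<and>
    (\<forall>A\<in>Obj \<C>. \<forall>B\<in>Obj \<C>. FMor \<Sigma> \<in> hom (Hom \<C> A B) (Hom \<C> (FOb \<Sigma> A) (FOb \<Sigma> B))) \<and>
    (\<forall>A B D. \<forall>f\<in>Mor \<C> A B. \<forall>g\<in>Mor \<C> B D. FMor \<Sigma> (g \<cdot>\<^bsub>\<C>\<^esub> f) = FMor \<Sigma> g \<cdot>\<^bsub>\<C>\<^esub> FMor \<Sigma> f)"

definition fully_faithful :: "('o, 'm) category \<Rightarrow> ('o, 'm) endofunctor \<Rightarrow> bool"
  where "fully_faithful \<C> \<Sigma> \<longleftrightarrow>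
    (\<forall>A\<in>Obj \<C>. \<forall>B\<in>Obj \<C>. bij_betw (FMor \<Sigma>) (Mor \<C> A B) (Mor \<C> (FOb \<Sigma> A) (FOb \<Sigma> B)))"

text \<open>\<open>\<Phi> C A : E(C, A) \<rightarrow> \<C>(C, \<Sigma> A)\<close> is an isomorphism of abelian groups natural in \<open>C\<close> and \<open>A\<close>.\<close>

definition bifunctor_iso ::
  "('o, 'm) category \<Rightarrow> ('o, 'm, 'e) bifunctor \<Rightarrow> ('o, 'm) endofunctor \<Rightarrow> ('o \<Rightarrow> 'o \<Rightarrow> 'e \<Rightarrow> 'm) \<Rightarrow> bool"
  where "bifunctor_iso \<C> E \<Sigma> \<Phi> \<longleftrightarrow>
    (\<forall>C\<in>Obj \<C>. \<forall>A\<in>Obj \<C>. \<Phi> C A \<in> iso (Ext E C A) (Hom \<C> C (FOb \<Sigma> A))) \<and>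
    (\<forall>C C' A A'. \<forall>c\<in>Mor \<C> C' C. \<forall>a\<in>Mor \<C> A A'. \<forall>\<delta>\<in>carrier (Ext E C A).
      \<Phi> C' A' (EMap E c a \<delta>) = FMor \<Sigma> a \<cdot>\<^bsub>\<C>\<^esub> \<Phi> C A \<delta> \<cdot>\<^bsub>\<C>\<^esub> c)"

definition is_sigma_seq ::
  "nat \<Rightarrow> ('o, 'm) category \<Rightarrow> ('o, 'm) endofunctor \<Rightarrow> ('o, 'm) chain \<Rightarrow> bool"
  where "is_sigma_seq n \<C> \<Sigma> X \<longleftrightarrow>
    (\<forall>i\<le>n + 1. Vx X i \<in> Obj \<C>) \<and>
    (\<forall>i\<le>n. Dif X i \<in> Mor \<C> (Vx X i) (Vx X (i + 1))) \<and>
    Dif X (n + 1) \<in> Mor \<C> (Vx X (n + 1)) (FOb \<Sigma> (Vx X 0))"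

definition sigma_mor ::
  "nat \<Rightarrow> ('o, 'm) category \<Rightarrow> ('o, 'm) endofunctor \<Rightarrow> ('o, 'm) chain \<Rightarrow> ('o, 'm) chain \<Rightarrow>
    (nat \<Rightarrow> 'm) \<Rightarrow> bool"
  where "sigma_mor n \<C> \<Sigma> X Y \<phi> \<longleftrightarrow>
    (\<forall>i\<le>n + 1. \<phi> i \<in> Mor \<C> (Vx X i) (Vx Y i)) \<and>
    (\<forall>i\<le>n. \<phi> (i + 1) \<cdot>\<^bsub>\<C>\<^esub> Dif X i = Dif Y i \<cdot>\<^bsub>\<C>\<^esub> \<phi> i) \<and>
    FMor \<Sigma> (\<phi> 0) \<cdot>\<^bsub>\<C>\<^esub> Dif X (n + 1) = Dif Y (n + 1) \<cdot>\<^bsub>\<C>\<^esub> \<phi> (n + 1)"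

definition sigma_isomorphic ::
  "nat \<Rightarrow> ('o, 'm) category \<Rightarrow> ('o, 'm) endofunctor \<Rightarrow> ('o, 'm) chain \<Rightarrow> ('o, 'm) chain \<Rightarrow> bool"
  where "sigma_isomorphic n \<C> \<Sigma> X Y \<longleftrightarrow>
    (\<exists>\<phi>. sigma_mor n \<C> \<Sigma> X Y \<phi> \<and> (\<forall>i\<le>n + 1. iso_mor \<C> (Vx X i) (Vx Y i) (\<phi> i)))"

text \<open>\<open>S\<close> is a direct sum of \<open>X\<close> and \<open>Y\<close>: a biproduct in every degree whose injections and projections
  are morphisms of \<open>\<Sigma>\<close>-sequences.\<close>

definition sigma_direct_sum ::
  "nat \<Rightarrow> ('o, 'm) category \<Rightarrow> ('o, 'm) endofunctor \<Rightarrow> ('o, 'm) chain \<Rightarrow> ('o, 'm) chain \<Rightarrow>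
    ('o, 'm) chain \<Rightarrow> bool"
  where "sigma_direct_sum n \<C> \<Sigma> X Y S \<longleftrightarrow>
    (\<exists>inc prj.
      (\<forall>k\<le>n + 1. biproduct \<C> {Fst, Snd} (\<lambda>i. if i = Fst then Vx X k else Vx Y k) (Vx S k)
        (inc k) (prj k)) \<and>
      sigma_mor n \<C> \<Sigma> X S (\<lambda>k. inc k Fst) \<and> sigma_mor n \<C> \<Sigma> Y S (\<lambda>k. inc k Snd) \<and>
      sigma_mor n \<C> \<Sigma> S X (\<lambda>k. prj k Fst) \<and> sigma_mor n \<C> \<Sigma> S Y (\<lambda>k. prj k Snd))"

definition left_rotation ::
  "nat \<Rightarrow> ('o, 'm) category \<Rightarrow> ('o, 'm) endofunctor \<Rightarrow> ('o, 'm) chain \<Rightarrow> ('o, 'm) chain"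
  where "left_rotation n \<C> \<Sigma> X =
    \<lparr>Vx = (\<lambda>i. if i \<le> n then Vx X (i + 1) else FOb \<Sigma> (Vx X 0)),
     Dif = (\<lambda>i. if i \<le> n then Dif X (i + 1)
       else sgn_mor \<C> (FOb \<Sigma> (Vx X 0)) (FOb \<Sigma> (Vx X 1)) n (FMor \<Sigma> (Dif X 0)))\<rparr>"

text \<open>\<open>0 \<rightarrow> A \<rightarrow> A \<rightarrow> 0 \<rightarrow> \<dots> \<rightarrow> 0 \<rightarrow> \<Sigma> 0\<close> for the zero object \<open>Z\<close>.\<close>

definition trivial_sigma_seq ::
  "nat \<Rightarrow> ('o, 'm) category \<Rightarrow> ('o, 'm) endofunctor \<Rightarrow> 'o \<Rightarrow> 'o \<Rightarrow> ('o, 'm) chain"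
  where "trivial_sigma_seq n \<C> \<Sigma> Z A =
    (let X = id_chain \<C> Z A 1
     in X\<lparr>Dif := (Dif X)(n + 1 := zero_mor \<C> (Vx X (n + 1)) (FOb \<Sigma> Z))\<rparr>)"

text \<open>The octahedral sequence of three \<open>\<Sigma>\<close>-sequences \<open>(A, f)\<close>, \<open>(B, g)\<close>, \<open>(C, h)\<close>. In degree \<open>k\<close> its
  summands are \<open>A\<^sub>k\<^sub>+\<^sub>2\<close> (if \<open>k + 2 \<le> n + 1\<close>), \<open>B\<^sub>k\<^sub>+\<^sub>1\<close> (if \<open>1 \<le> k \<le> n\<close>) and \<open>C\<^sub>k\<close> (if \<open>2 \<le> k\<close>); in
  particular it starts in \<open>A\<^sub>2\<close> and ends in \<open>C\<^sub>n\<^sub>+\<^sub>1\<close>. The entry \<open>(-1)^(i+1) \<phi>\<^sub>i\<close> of the matrix out of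
  \<open>A\<^sub>i \<oplus> B\<^sub>i\<^sub>-\<^sub>1 \<oplus> C\<^sub>i\<^sub>-\<^sub>2\<close> occurs for \<open>i = k + 2\<close>; only the first map, \<open>k = 0\<close>, has the entries \<open>f\<^sub>2\<close> and
  \<open>\<phi>\<^sub>2\<close> without signs.\<close>

definition octahedral_seq ::
  "nat \<Rightarrow> ('o, 'm) category \<Rightarrow> ('o, 'm) endofunctor \<Rightarrow> ('o, 'm) chain \<Rightarrow> ('o, 'm) chain \<Rightarrow>
    ('o, 'm) chain \<Rightarrow> (nat \<Rightarrow> 'm) \<Rightarrow> (nat \<Rightarrow> 'm) \<Rightarrow> (nat \<Rightarrow> 'm) \<Rightarrow> ('o, 'm) chain \<Rightarrow> bool"
  where "octahedral_seq n \<C> \<Sigma> A B C \<phi> \<psi> \<phi>' T \<longleftrightarrow>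
    (let F = (\<lambda>k i. case i of Fst \<Rightarrow> Vx A (k + 2) | Snd \<Rightarrow> Vx B (k + 1) | Trd \<Rightarrow> Vx C k) in
      block_chain n \<C>
        (\<lambda>k. {i. i = Fst \<and> k + 2 \<le> n + 1 \<or> i = Snd \<and> 1 \<le> k \<and> k \<le> n \<or> i = Trd \<and> 2 \<le> k})
        F
        (\<lambda>k r c. case (r, c) of
            (Fst, Fst) \<Rightarrow>
              if k = 0 then Dif A 2 else neg_mor \<C> (Vx A (k + 2)) (Vx A (k + 3)) (Dif A (k + 2))
          | (Snd, Fst) \<Rightarrow>
              if k = 0 then \<phi> 2 else sgn_mor \<C> (Vx A (k + 2)) (Vx B (k + 2)) (k + 3) (\<phi> (k + 2))
          | (Trd, Fst) \<Rightarrow> \<phi>' (k + 2)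
          | (Snd, Snd) \<Rightarrow> neg_mor \<C> (Vx B (k + 1)) (Vx B (k + 2)) (Dif B (k + 1))
          | (Trd, Snd) \<Rightarrow> \<psi> (k + 1)
          | (Trd, Trd) \<Rightarrow> Dif C k
          | _ \<Rightarrow> zero_mor \<C> (F k c) (F (k + 1) r))
        T) \<and>
    Dif T (n + 1) = FMor \<Sigma> (Dif A 1) \<cdot>\<^bsub>\<C>\<^esub> Dif C (n + 1)"

locale right_angulated_category = additive_category \<C>
  for \<C> :: "('o, 'm) category" (structure) +
  fixes n :: nat and \<Sigma> :: "('o, 'm) endofunctor" and \<Theta> :: "('o, 'm) chain set"
  assumes suspension: "additive_endofunctor \<C> \<Sigma>"
    and angle_seq: "X \<in> \<Theta> \<Longrightarrow> is_sigma_seq n \<C> \<Sigma> X"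
    and RN1_iso: "X \<in> \<Theta> \<Longrightarrow> is_sigma_seq n \<C> \<Sigma> Y \<Longrightarrow> sigma_isomorphic n \<C> \<Sigma> X Y \<Longrightarrow> Y \<in> \<Theta>"
    and RN1_sum: "X \<in> \<Theta> \<Longrightarrow> Y \<in> \<Theta> \<Longrightarrow> is_sigma_seq n \<C> \<Sigma> S \<Longrightarrow>
      sigma_direct_sum n \<C> \<Sigma> X Y S \<Longrightarrow> S \<in> \<Theta>"
    and RN1_summand: "S \<in> \<Theta> \<Longrightarrow> is_sigma_seq n \<C> \<Sigma> X \<Longrightarrow> is_sigma_seq n \<C> \<Sigma> Y \<Longrightarrow>
      sigma_direct_sum n \<C> \<Sigma> X Y S \<Longrightarrow> X \<in> \<Theta> \<and> Y \<in> \<Theta>"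
    and RN1_trivial: "A \<in> Obj \<C> \<Longrightarrow> zero_object \<C> Z \<Longrightarrow> trivial_sigma_seq n \<C> \<Sigma> Z A \<in> \<Theta>"
    and RN1_extend: "f \<in> Mor \<C> A B \<Longrightarrow> \<exists>X\<in>\<Theta>. Vx X 0 = A \<and> Vx X 1 = B \<and> Dif X 0 = f"
    and RN2: "X \<in> \<Theta> \<Longrightarrow> left_rotation n \<C> \<Sigma> X \<in> \<Theta>"
    and RN3: "X \<in> \<Theta> \<Longrightarrow> Y \<in> \<Theta> \<Longrightarrow>
      u \<in> Mor \<C> (Vx X 0) (Vx Y 0) \<Longrightarrow> v \<in> Mor \<C> (Vx X 1) (Vx Y 1) \<Longrightarrow>
      v \<cdot> Dif X 0 = Dif Y 0 \<cdot> u \<Longrightarrow>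
      \<exists>\<phi>. sigma_mor n \<C> \<Sigma> X Y \<phi> \<and> \<phi> 0 = u \<and> \<phi> 1 = v"
    and RN4: "X \<in> \<Theta> \<Longrightarrow> Y \<in> \<Theta> \<Longrightarrow> W \<in> \<Theta> \<Longrightarrow>
      Vx Y 0 = Vx X 0 \<Longrightarrow> Vx W 0 = Vx X 1 \<Longrightarrow> Vx W 1 = Vx Y 1 \<Longrightarrow>
      Dif Y 0 = Dif W 0 \<cdot> Dif X 0 \<Longrightarrow>
      \<exists>\<phi> \<psi> \<phi>' T.
        \<phi> 0 = IdM \<C> (Vx X 0) \<and> \<phi> 1 = Dif W 0 \<and> sigma_mor n \<C> \<Sigma> X Y \<phi> \<and>
        (\<forall>j\<in>{2..n + 1}. \<psi> j \<in> Mor \<C> (Vx Y j) (Vx W j)) \<and>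
        (\<forall>k\<in>{3..n + 1}. \<phi>' k \<in> Mor \<C> (Vx X k) (Vx W (k - 1))) \<and>
        Dif W (n + 1) \<cdot> \<psi> (n + 1) = FMor \<Sigma> (Dif X 0) \<cdot> Dif Y (n + 1) \<and>
        octahedral_seq n \<C> \<Sigma> X Y W \<phi> \<psi> \<phi>' T \<and> T \<in> \<Theta>"

text \<open>The \<open>n\<close>-exangulated structure \<open>(\<C>, E, \<s>)\<close> is induced by \<open>(\<Sigma>, \<Theta>)\<close>. In the last clause a right
  angle \<open>X\<close> also serves as the complex \<open>X\<^sub>0 \<rightarrow> \<dots> \<rightarrow> X\<^sub>n\<^sub>+\<^sub>1\<close>; its map \<open>Dif X (n + 1)\<close> is then ignored.\<close>

definition induced_by ::
  "nat \<Rightarrow> ('o, 'm) category \<Rightarrow> ('o, 'm, 'e) bifunctor \<Rightarrow> ('o, 'm, 'e) realization \<Rightarrow>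
    ('o, 'm) endofunctor \<Rightarrow> ('o, 'm) chain set \<Rightarrow> bool"
  where "induced_by n \<C> E \<s> \<Sigma> \<Theta> \<longleftrightarrow>
    (\<exists>\<Phi>. bifunctor_iso \<C> E \<Sigma> \<Phi> \<and>
      (\<forall>C\<in>Obj \<C>. \<forall>A\<in>Obj \<C>. \<forall>\<delta>\<in>carrier (Ext E C A).
        (\<exists>X\<in>\<Theta>. Vx X 0 = A \<and> Vx X (n + 1) = C \<and> Dif X (n + 1) = \<Phi> C A \<delta>) \<and>
        (\<forall>X\<in>\<Theta>. Vx X 0 = A \<and> Vx X (n + 1) = C \<and> Dif X (n + 1) = \<Phi> C A \<delta> \<longrightarrow>
          distinguished n \<C> E \<s> X \<delta>)))"

end

theory Submission
  imports Defs
begin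

text \<open>Everything rests on the exangles \<open>C \<rightarrow> 0 \<rightarrow> \<dots> \<rightarrow> 0 \<rightarrow> \<Sigma>C\<close> with extension \<open>\<eta>\<^sub>C \<in> E(\<Sigma>C, C)\<close>. The
  axioms EA2 and EA2op prolong the exact sequences of an exangle by one term into \<open>E\<close> (\<open>pull_surj\<close>,
  \<open>push_surj\<close>). Applied to an exangle with vanishing middle terms, the prolonged sequences say that
  \<open>c \<mapsto> c\<^sup>*\<eta>\<^sub>C\<close> and \<open>a \<mapsto> a\<^sub>*\<eta>\<^sub>C\<close> are bijections. So \<open>\<Sigma>C\<close> represents \<open>E(-, C)\<close>, the objects \<open>\<Sigma>C\<close>
  form a functor, and the second bijection makes it fully faithful (\<open>suspension_exists\<close>). Conversely,
  if \<open>E \<cong> \<C>(-, \<Sigma>-)\<close> with \<open>\<Sigma>\<close> fully faithful, a realization of the extension that corresponds to the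
  identity of \<open>\<Sigma>C\<close> has vanishing first and last differentials, and such a chain may be replaced by the
  one with zero objects in the middle (\<open>dist_suspension\<close>).

  The replacement uses a criterion for being distinguished that is applied throughout
  (\<open>dist_transfer\<close>): a complex \<open>Y\<close> on which the functors \<open>\<C>(-, T)\<close> are exact in the middle, and which
  has morphisms from and to a distinguished \<open>X\<close> that are identities at both ends, is in the class of
  \<open>X\<close>. The reason is that an endomorphism \<open>e\<close> of such a complex with \<open>e = 0\<close> at both ends satisfies
  \<open>e\<^sup>2 \<simeq> 0\<close>; hence if \<open>e = 1 - gf\<close>, then \<open>(1 + e) g\<close> is a homotopy inverse of \<open>f\<close>. In consequence,
  distinguished exangles are closed under everything that is covered by distinguished exangles in a
  split way (\<open>dist_split_cover\<close>), in particular under direct sums, retracts and isomorphisms.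

  Given \<open>\<Sigma>\<close>, the right angles are the distinguished exangles together with the map \<open>X\<^sub>n\<^sub>+\<^sub>1 \<rightarrow> \<Sigma>X\<^sub>0\<close>
  that corresponds to the extension. Rotation is EA2 for this map and the exangle of \<open>\<eta>\<close> at \<open>X\<^sub>0\<close>,
  whose cone is the rotated sequence up to signs. Every morphism \<open>f : A \<rightarrow> B\<close> starts an angle by EA2op
  for \<open>\<eta>\<^sub>A\<close> and \<open>f\<close>. Morphisms extend because of \<open>pull_surj\<close> and a correction by a homotopy
  (\<open>dist_lift_prescribed\<close>). For the octahedral axiom, EA2 is used twice: first for the morphism of
  the two angles that start at \<open>A\<^sub>0\<close>, then for a morphism from its cone to the third angle. The second
  cone is the octahedral sequence plus a contractible summand, so the latter is a retract of an angle
  (\<open>octa_angle\<close>, \<open>octa_octahedral\<close>).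

  A right angulation that induces the exangulated structure contains \<open>A \<rightarrow> 0 \<rightarrow> \<dots> \<rightarrow> \<Sigma>0 \<rightarrow> \<Sigma>A\<close>, the
  trivial angle of \<open>A\<close> rotated twice; this makes \<open>A \<rightarrow> 0\<close> a trivial inflation.\<close>

section \<open>Calculus of morphisms\<close>

context additive_category
begin

text \<open>Since a morphism determines its domain and codomain, sums and negatives need no reference to
  the hom-group. The simplification rules below have side conditions in terms of \<open>arr\<close>, \<open>dm\<close> and \<open>cd\<close>, which contain
  no variables that the conclusion does not mention; the simplifier can therefore discharge them.\<close>

definition arr :: "'m \<Rightarrow> bool" where "arr f \<longleftrightarrow> (\<exists>A B. f \<in> Mor \<C> A B)"
definition dm :: "'m \<Rightarrow> 'o" where "dm f = (THE A. \<exists>B. f \<in> Mor \<C> A B)"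
definition cd :: "'m \<Rightarrow> 'o" where "cd f = (THE B. \<exists>A. f \<in> Mor \<C> A B)"
definition madd :: "'m \<Rightarrow> 'm \<Rightarrow> 'm" (infixl "\<boxplus>" 65)
  where "f \<boxplus> g = add_mor \<C> (dm f) (cd f) f g"
definition mneg :: "'m \<Rightarrow> 'm" ("\<boxminus> _" [80] 80)
  where "\<boxminus> f = neg_mor \<C> (dm f) (cd f) f"

lemma dm_eq: "f \<in> Mor \<C> A B \<Longrightarrow> dm f = A"
  unfolding dm_def by (blast dest: mor_disjoint)

lemma cd_eq: "f \<in> Mor \<C> A B \<Longrightarrow> cd f = B"
  unfolding cd_def by (blast dest: mor_disjoint)

lemma Mor_iff: "f \<in> Mor \<C> A B \<longleftrightarrow> arr f \<and> dm f = A \<and> cd f = B"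
  unfolding arr_def by (auto dest: dm_eq cd_eq)

lemma arr_mor: "arr f \<Longrightarrow> f \<in> Mor \<C> (dm f) (cd f)"
  by (simp add: Mor_iff)

lemma arr_Obj [simp]: "arr f \<Longrightarrow> dm f \<in> Obj \<C>" "arr f \<Longrightarrow> cd f \<in> Obj \<C>"
  using arr_mor mor_objects by blast+

lemma arr_comp [simp]:
  assumes "arr f" "arr g" "dm g = cd f"
  shows "arr (g \<cdot> f)" "dm (g \<cdot> f) = dm f" "cd (g \<cdot> f) = cd g"
  using comp_mor[of f "dm f" "cd f" g "cd g"] assms by (auto simp: Mor_iff)

lemma arr_id [simp]:
  assumes "A \<in> Obj \<C>"
  shows "arr (IdM \<C> A)" "dm (IdM \<C> A) = A" "cd (IdM \<C> A) = A"
  using id_mor[OF assms] by (auto simp: Mor_iff)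

lemma arr_zero [simp]:
  assumes "A \<in> Obj \<C>" "B \<in> Obj \<C>"
  shows "arr (zero_mor \<C> A B)" "dm (zero_mor \<C> A B) = A" "cd (zero_mor \<C> A B) = B"
  using monoid.one_closed[of "Hom \<C> A B"] hom_group[OF assms]
  by (auto simp: Mor_iff comm_group_def group_def)

lemma arr_madd [simp]:
  assumes "arr f" "arr g" "dm f = dm g" "cd f = cd g"
  shows "arr (f \<boxplus> g)" "dm (f \<boxplus> g) = dm g" "cd (f \<boxplus> g) = cd g"
  using monoid.m_closed[of "Hom \<C> (dm g) (cd g)" f g] hom_group[of "dm g" "cd g"] assms
  by (auto simp: Mor_iff comm_group_def group_def madd_def)

lemma arr_mneg [simp]:
  assumes "arr f" shows "arr (\<boxminus> f)" "dm (\<boxminus> f) = dm f" "cd (\<boxminus> f) = cd f"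
  using group.inv_closed[of "Hom \<C> (dm f) (cd f)" f] hom_group[of "dm f" "cd f"] assms
  by (auto simp: Mor_iff comm_group_def mneg_def)

lemma add_mor_eq: "dm f = A \<Longrightarrow> cd f = B \<Longrightarrow> add_mor \<C> A B f g = f \<boxplus> g"
  by (simp add: madd_def)

lemma neg_mor_eq: "dm f = A \<Longrightarrow> cd f = B \<Longrightarrow> neg_mor \<C> A B f = \<boxminus> f"
  by (simp add: mneg_def)

lemma comp_assoc_arr [simp]:
  "arr f \<Longrightarrow> arr g \<Longrightarrow> arr h \<Longrightarrow> dm g = cd f \<Longrightarrow> dm h = cd g \<Longrightarrow> (h \<cdot> g) \<cdot> f = h \<cdot> (g \<cdot> f)"
  using comp_assoc[of f "dm f" "cd f" g "cd g" h "cd h"] by (simp add: Mor_iff)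

lemma comp_id_arr [simp]:
  "arr f \<Longrightarrow> dm f = A \<Longrightarrow> f \<cdot> IdM \<C> A = f"
  "arr f \<Longrightarrow> cd f = B \<Longrightarrow> IdM \<C> B \<cdot> f = f"
  using comp_id[of f "dm f" "cd f"] by (auto simp: Mor_iff)

text \<open>Rewriting with \<open>g \<cdot> f = k\<close> inside a composite that is bracketed to the right.\<close>

lemma comp_reassoc:
  "g \<cdot> f = k \<Longrightarrow> arr g \<Longrightarrow> arr f \<Longrightarrow> dm g = cd f \<Longrightarrow> arr x \<Longrightarrow> cd x = dm f \<Longrightarrow> g \<cdot> (f \<cdot> x) = k \<cdot> x"
  by (metis comp_assoc_arr)

lemma madd_comp [simp]:
  assumes "arr f" "arr g" "dm f = dm g" "cd f = cd g"
  shows "arr h \<Longrightarrow> dm h = cd g \<Longrightarrow> h \<cdot> (f \<boxplus> g) = h \<cdot> f \<boxplus> h \<cdot> g"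
    and "arr h \<Longrightarrow> cd h = dm g \<Longrightarrow> (f \<boxplus> g) \<cdot> h = f \<cdot> h \<boxplus> g \<cdot> h"
  using comp_add_right[of f "dm f" "cd f" g h "cd h"] comp_add_left[of h "dm h" "cd h" f "cd f" g]
    assms by (auto simp: Mor_iff madd_def)

lemma madd_group:
  assumes "A \<in> Obj \<C>" "B \<in> Obj \<C>"
  shows "comm_group (Hom \<C> A B)" "group (Hom \<C> A B)" "monoid (Hom \<C> A B)"
    "comm_monoid (Hom \<C> A B)"
  using hom_group[OF assms] by (auto simp: comm_group_def group_def)

lemma madd_zero [simp]:
  "arr f \<Longrightarrow> dm f = A \<Longrightarrow> cd f = B \<Longrightarrow> f \<boxplus> zero_mor \<C> A B = f"
  "arr f \<Longrightarrow> dm f = A \<Longrightarrow> cd f = B \<Longrightarrow> zero_mor \<C> A B \<boxplus> f = f"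
  using monoid.r_one[of "Hom \<C> A B" f] monoid.l_one[of "Hom \<C> A B" f] madd_group(3)[of A B]
  by (auto simp: Mor_iff madd_def)

lemma madd_neg [simp]:
  "arr f \<Longrightarrow> f \<boxplus> \<boxminus> f = zero_mor \<C> (dm f) (cd f)"
  "arr f \<Longrightarrow> \<boxminus> f \<boxplus> f = zero_mor \<C> (dm f) (cd f)"
  using group.r_inv[of "Hom \<C> (dm f) (cd f)" f] group.l_inv[of "Hom \<C> (dm f) (cd f)" f]
    madd_group(2)[of "dm f" "cd f"]
  by (simp_all add: Mor_iff madd_def) (simp_all add: mneg_def)

lemma madd_assoc:
  assumes "arr f" "arr g" "arr h" "dm f = dm g" "cd f = cd g" "dm g = dm h" "cd g = cd h"
  shows "(f \<boxplus> g) \<boxplus> h = f \<boxplus> (g \<boxplus> h)"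
  using monoid.m_assoc[of "Hom \<C> (dm h) (cd h)" f g h] madd_group(3)[of "dm h" "cd h"] assms
  by (simp add: Mor_iff add_mor_eq)

lemma madd_comm:
  assumes "arr f" "arr g" "dm f = dm g" "cd f = cd g"
  shows "f \<boxplus> g = g \<boxplus> f"
  using comm_monoid.m_comm[of "Hom \<C> (dm g) (cd g)" f g] madd_group(4)[of "dm g" "cd g"] assms
  by (simp add: Mor_iff add_mor_eq)

lemma madd_lcomm:
  assumes "arr f" "arr g" "arr h" "dm f = dm g" "cd f = cd g" "dm g = dm h" "cd g = cd h"
  shows "f \<boxplus> (g \<boxplus> h) = g \<boxplus> (f \<boxplus> h)"
  using madd_assoc[of f g h] madd_assoc[of g f h] madd_comm[of f g] assms by simp

lemmas madd_ac = madd_assoc madd_comm madd_lcomm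

lemma madd_cancel:
  assumes "arr f" "arr g" "dm f = dm g" "cd f = cd g"
  shows "f \<boxplus> (\<boxminus> f \<boxplus> g) = g" "\<boxminus> f \<boxplus> (f \<boxplus> g) = g"
  using madd_assoc[of f "\<boxminus> f" g] madd_assoc[of "\<boxminus> f" f g] assms by simp_all

lemma mneg_unique:
  assumes "arr f" "arr g" "dm f = dm g" "cd f = cd g" "f \<boxplus> g = zero_mor \<C> (dm g) (cd g)"
  shows "g = \<boxminus> f"
proof -
  have "g = \<boxminus> f \<boxplus> (f \<boxplus> g)" using assms(1-4) by (simp add: madd_cancel del: madd_neg)
  also have "\<dots> = \<boxminus> f" using assms by simp
  finally show ?thesis .
qed

lemma zero_comp [simp]:
  assumes "arr f" "A \<in> Obj \<C>"
  shows "cd f = B \<Longrightarrow> zero_mor \<C> B A \<cdot> f = zero_mor \<C> (dm f) A"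
    and "dm f = B \<Longrightarrow> f \<cdot> zero_mor \<C> A B = zero_mor \<C> A (cd f)"
proof -
  have *: "x = zero_mor \<C> (dm x) (cd x)" if "arr x" "x \<boxplus> x = x" for x
    using madd_cancel(2)[of x x] that by simp
  show "zero_mor \<C> B A \<cdot> f = zero_mor \<C> (dm f) A" if "cd f = B"
  proof -
    have "zero_mor \<C> B A \<cdot> f \<boxplus> zero_mor \<C> B A \<cdot> f = (zero_mor \<C> B A \<boxplus> zero_mor \<C> B A) \<cdot> f"
      using assms that by (subst madd_comp(2)) auto
    then show ?thesis using *[of "zero_mor \<C> B A \<cdot> f"] assms that by auto
  qed
  show "f \<cdot> zero_mor \<C> A B = zero_mor \<C> A (cd f)" if "dm f = B"
  proof -
    have "f \<cdot> zero_mor \<C> A B \<boxplus> f \<cdot> zero_mor \<C> A B = f \<cdot> (zero_mor \<C> A B \<boxplus> zero_mor \<C> A B)"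
      using assms that by (subst madd_comp(1)) auto
    then show ?thesis using *[of "f \<cdot> zero_mor \<C> A B"] assms that by auto
  qed
qed

lemma mneg_comp [simp]:
  assumes "arr f" "arr g" "dm g = cd f"
  shows "g \<cdot> \<boxminus> f = \<boxminus> (g \<cdot> f)" "\<boxminus> g \<cdot> f = \<boxminus> (g \<cdot> f)"
proof -
  have "g \<cdot> f \<boxplus> g \<cdot> \<boxminus> f = g \<cdot> (f \<boxplus> \<boxminus> f)"
    using assms by (subst madd_comp(1)) simp_all
  then show "g \<cdot> \<boxminus> f = \<boxminus> (g \<cdot> f)"
    using assms by (intro mneg_unique) simp_all
  have "g \<cdot> f \<boxplus> \<boxminus> g \<cdot> f = (g \<boxplus> \<boxminus> g) \<cdot> f"
    using assms by (subst madd_comp(2)) simp_all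
  then show "\<boxminus> g \<cdot> f = \<boxminus> (g \<cdot> f)"
    using assms by (intro mneg_unique) simp_all
qed

lemma mneg_mneg [simp]: "arr f \<Longrightarrow> \<boxminus> \<boxminus> f = f"
  using mneg_unique[of "\<boxminus> f" f] by simp

lemma mneg_zero [simp]: "A \<in> Obj \<C> \<Longrightarrow> B \<in> Obj \<C> \<Longrightarrow> \<boxminus> zero_mor \<C> A B = zero_mor \<C> A B"
  using mneg_unique[of "zero_mor \<C> A B" "zero_mor \<C> A B"] by simp

lemma mneg_madd [simp]:
  assumes "arr f" "arr g" "dm f = dm g" "cd f = cd g"
  shows "\<boxminus> (f \<boxplus> g) = \<boxminus> f \<boxplus> \<boxminus> g"
proof -
  have "f \<boxplus> (g \<boxplus> (\<boxminus> f \<boxplus> \<boxminus> g)) = zero_mor \<C> (dm g) (cd g)"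
    using assms madd_lcomm[of g "\<boxminus> f" "\<boxminus> g"] by (simp add: madd_cancel)
  then show ?thesis
    using assms by (intro mneg_unique[symmetric]) (simp_all add: madd_assoc)
qed

lemma madd_eq_zero_iff:
  assumes "arr f" "arr g" "dm f = A" "dm g = A" "cd f = B" "cd g = B"
  shows "f \<boxplus> \<boxminus> g = zero_mor \<C> A B \<longleftrightarrow> f = g"
  using assms mneg_unique[of "\<boxminus> g" f] madd_comm[of f "\<boxminus> g"] by auto

lemma sgn_mor_eq: "dm f = A \<Longrightarrow> cd f = B \<Longrightarrow> sgn_mor \<C> A B k f = (if even k then f else \<boxminus> f)"
  by (simp add: sgn_mor_def mneg_def)

lemma zero_objectD:
  assumes "zero_object \<C> Z"
  shows "Z \<in> Obj \<C>"
    and "arr f \<Longrightarrow> dm f = Z \<Longrightarrow> f = zero_mor \<C> Z (cd f)"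
    and "arr f \<Longrightarrow> cd f = Z \<Longrightarrow> f = zero_mor \<C> (dm f) Z"
proof -
  show Z: "Z \<in> Obj \<C>" using assms by (simp add: zero_object_def)
  have u: "x = y" if "x \<in> Mor \<C> Z A \<and> y \<in> Mor \<C> Z A \<or> x \<in> Mor \<C> A Z \<and> y \<in> Mor \<C> A Z" for x y A
    using assms that mor_objects unfolding zero_object_def by blast
  show "f = zero_mor \<C> Z (cd f)" if "arr f" "dm f = Z"
    using that Z u[of f "cd f" "zero_mor \<C> Z (cd f)"] by (simp add: Mor_iff)
  show "f = zero_mor \<C> (dm f) Z" if "arr f" "cd f = Z"
    using that Z u[of f "dm f" "zero_mor \<C> (dm f) Z"] by (simp add: Mor_iff)
qed

lemma zero_object_iff: "zero_object \<C> Z \<longleftrightarrow> Z \<in> Obj \<C> \<and> IdM \<C> Z = zero_mor \<C> Z Z"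
proof
  assume Z: "zero_object \<C> Z"
  then show "Z \<in> Obj \<C> \<and> IdM \<C> Z = zero_mor \<C> Z Z"
    using zero_objectD(1)[OF Z] zero_objectD(2)[OF Z, of "IdM \<C> Z"] by simp
next
  assume Z: "Z \<in> Obj \<C> \<and> IdM \<C> Z = zero_mor \<C> Z Z"
  have 1: "f = zero_mor \<C> A Z" if "f \<in> Mor \<C> A Z" for f A
    using comp_id_arr(2)[of f Z] zero_comp(1)[of f Z Z] that Z by (auto simp: Mor_iff)
  have 2: "f = zero_mor \<C> Z A" if "f \<in> Mor \<C> Z A" for f A
    using comp_id_arr(1)[of f Z] zero_comp(2)[of f Z Z] that Z by (auto simp: Mor_iff)
  show "zero_object \<C> Z"
    unfolding zero_object_def
  proof (intro conjI ballI)
    fix A assume A: "A \<in> Obj \<C>"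
    show "\<exists>!f. f \<in> Mor \<C> A Z"
      using A Z by (intro ex1I[of _ "zero_mor \<C> A Z"] 1) (simp_all add: Mor_iff)
    show "\<exists>!f. f \<in> Mor \<C> Z A"
      using A Z by (intro ex1I[of _ "zero_mor \<C> Z A"] 2) (simp_all add: Mor_iff)
  qed (use Z in simp)
qed

end

section \<open>Biproducts\<close>

context additive_category
begin

lemma biproduct_iff:
  "biproduct \<C> {Fst, Snd} F S inc prj \<longleftrightarrow> S \<in> Obj \<C> \<and>
    (\<forall>i\<in>{Fst, Snd}. F i \<in> Obj \<C> \<and> inc i \<in> Mor \<C> (F i) S \<and> prj i \<in> Mor \<C> S (F i) \<and>
      prj i \<cdot> inc i = IdM \<C> (F i)) \<and>
    prj Snd \<cdot> inc Fst = zero_mor \<C> (F Fst) (F Snd) \<and>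
    prj Fst \<cdot> inc Snd = zero_mor \<C> (F Snd) (F Fst) \<and>
    inc Fst \<cdot> prj Fst \<boxplus> inc Snd \<cdot> prj Snd = IdM \<C> S" (is "?L \<longleftrightarrow> ?R")
proof -
  have "finprod (Hom \<C> S S) (\<lambda>i. inc i \<cdot> prj i) {Fst, Snd} = inc Fst \<cdot> prj Fst \<boxplus> inc Snd \<cdot> prj Snd"
    if "S \<in> Obj \<C>" "inc Fst \<in> Mor \<C> (F Fst) S" "prj Fst \<in> Mor \<C> S (F Fst)"
      "inc Snd \<in> Mor \<C> (F Snd) S" "prj Snd \<in> Mor \<C> S (F Snd)"
  proof -
    interpret comm_monoid "Hom \<C> S S" using that madd_group by blast
    show ?thesis using that by (subst finprod_insert) (auto simp: Mor_iff add_mor_eq)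
  qed
  then show ?thesis unfolding biproduct_def by auto
qed

lemma biproduct_singleton_iff:
  "biproduct \<C> {i} F S inc prj \<longleftrightarrow> S \<in> Obj \<C> \<and> F i \<in> Obj \<C> \<and> inc i \<in> Mor \<C> (F i) S \<and>
    prj i \<in> Mor \<C> S (F i) \<and> prj i \<cdot> inc i = IdM \<C> (F i) \<and> inc i \<cdot> prj i = IdM \<C> S"
proof -
  have "finprod (Hom \<C> S S) (\<lambda>i. inc i \<cdot> prj i) {i} = inc i \<cdot> prj i"
    if "S \<in> Obj \<C>" "inc i \<in> Mor \<C> (F i) S" "prj i \<in> Mor \<C> S (F i)"
  proof -
    interpret comm_monoid "Hom \<C> S S" using that madd_group by blast
    show ?thesis using that by (subst finprod_insert) (auto simp: Mor_iff)
  qed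
  then show ?thesis unfolding biproduct_def by auto
qed

abbreviation biprod :: "'o \<Rightarrow> 'o \<Rightarrow> 'o \<Rightarrow> (summand \<Rightarrow> 'm) \<Rightarrow> (summand \<Rightarrow> 'm) \<Rightarrow> bool"
  where "biprod A B S inc prj \<equiv> biproduct \<C> {Fst, Snd} (\<lambda>i. if i = Fst then A else B) S inc prj"

lemma biproduct_pairD:
  assumes "biprod A B S inc prj"
  shows "S \<in> Obj \<C>" "A \<in> Obj \<C>" "B \<in> Obj \<C>"
    "arr (inc Fst)" "dm (inc Fst) = A" "cd (inc Fst) = S"
    "arr (inc Snd)" "dm (inc Snd) = B" "cd (inc Snd) = S"
    "arr (prj Fst)" "dm (prj Fst) = S" "cd (prj Fst) = A"
    "arr (prj Snd)" "dm (prj Snd) = S" "cd (prj Snd) = B"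
    "prj Fst \<cdot> inc Fst = IdM \<C> A" "prj Snd \<cdot> inc Snd = IdM \<C> B"
    "prj Snd \<cdot> inc Fst = zero_mor \<C> A B" "prj Fst \<cdot> inc Snd = zero_mor \<C> B A"
    "inc Fst \<cdot> prj Fst \<boxplus> inc Snd \<cdot> prj Snd = IdM \<C> S"
    "arr x \<Longrightarrow> cd x = A \<Longrightarrow> prj Fst \<cdot> (inc Fst \<cdot> x) = x"
    "arr x \<Longrightarrow> cd x = B \<Longrightarrow> prj Snd \<cdot> (inc Snd \<cdot> x) = x"
    "arr x \<Longrightarrow> cd x = A \<Longrightarrow> prj Snd \<cdot> (inc Fst \<cdot> x) = zero_mor \<C> (dm x) B"
    "arr x \<Longrightarrow> cd x = B \<Longrightarrow> prj Fst \<cdot> (inc Snd \<cdot> x) = zero_mor \<C> (dm x) A"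
    "arr x \<Longrightarrow> cd x = S \<Longrightarrow> inc Fst \<cdot> (prj Fst \<cdot> x) \<boxplus> inc Snd \<cdot> (prj Snd \<cdot> x) = x"
    "arr z \<Longrightarrow> dm z = S \<Longrightarrow> (z \<cdot> inc Fst) \<cdot> prj Fst \<boxplus> (z \<cdot> inc Snd) \<cdot> prj Snd = z"
proof -
  note b = assms[unfolded biproduct_iff]
  show *: "S \<in> Obj \<C>" "A \<in> Obj \<C>" "B \<in> Obj \<C>"
    "arr (inc Fst)" "dm (inc Fst) = A" "cd (inc Fst) = S"
    "arr (inc Snd)" "dm (inc Snd) = B" "cd (inc Snd) = S"
    "arr (prj Fst)" "dm (prj Fst) = S" "cd (prj Fst) = A"
    "arr (prj Snd)" "dm (prj Snd) = S" "cd (prj Snd) = B"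
    and r: "prj Fst \<cdot> inc Fst = IdM \<C> A" "prj Snd \<cdot> inc Snd = IdM \<C> B"
    "prj Snd \<cdot> inc Fst = zero_mor \<C> A B" "prj Fst \<cdot> inc Snd = zero_mor \<C> B A"
    and s: "inc Fst \<cdot> prj Fst \<boxplus> inc Snd \<cdot> prj Snd = IdM \<C> S"
    using b by (simp_all add: Mor_iff)
  show "arr x \<Longrightarrow> cd x = A \<Longrightarrow> prj Fst \<cdot> (inc Fst \<cdot> x) = x"
    "arr x \<Longrightarrow> cd x = A \<Longrightarrow> prj Snd \<cdot> (inc Fst \<cdot> x) = zero_mor \<C> (dm x) B"
    by (subst comp_reassoc[OF r(1)] comp_reassoc[OF r(3)]; simp add: *)+
  show "arr x \<Longrightarrow> cd x = B \<Longrightarrow> prj Snd \<cdot> (inc Snd \<cdot> x) = x"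
    "arr x \<Longrightarrow> cd x = B \<Longrightarrow> prj Fst \<cdot> (inc Snd \<cdot> x) = zero_mor \<C> (dm x) A"
    by (subst comp_reassoc[OF r(2)] comp_reassoc[OF r(4)]; simp add: *)+
  show "inc Fst \<cdot> (prj Fst \<cdot> x) \<boxplus> inc Snd \<cdot> (prj Snd \<cdot> x) = x" if "arr x" "cd x = S"
    using arg_cong[OF s, of "\<lambda>y. y \<cdot> x"] that * by simp
  show "(z \<cdot> inc Fst) \<cdot> prj Fst \<boxplus> (z \<cdot> inc Snd) \<cdot> prj Snd = z" if "arr z" "dm z = S"
    using arg_cong[OF s, of "\<lambda>y. z \<cdot> y"] that * by simp
qed

lemma finprod_insert_Hom:
  assumes "A \<in> Obj \<C>" "B \<in> Obj \<C>" "finite I" "x \<notin> I" "\<And>i. i \<in> insert x I \<Longrightarrow> f i \<in> Mor \<C> A B"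
  shows "finprod (Hom \<C> A B) f (insert x I) = f x \<boxplus> finprod (Hom \<C> A B) f I"
    and "finprod (Hom \<C> A B) f I \<in> Mor \<C> A B"
proof -
  interpret comm_monoid "Hom \<C> A B" using madd_group[OF assms(1,2)] by blast
  show "finprod (Hom \<C> A B) f (insert x I) = f x \<boxplus> finprod (Hom \<C> A B) f I"
    using assms by (subst finprod_insert) (auto simp: Mor_iff add_mor_eq)
  show "finprod (Hom \<C> A B) f I \<in> Mor \<C> A B"
    using assms by (intro finprod_closed) auto
qed

lemma finprod_comp_Hom:
  assumes "finite I" "\<And>i. i \<in> I \<Longrightarrow> f i \<in> Mor \<C> A B" "A \<in> Obj \<C>" "B \<in> Obj \<C>"
    and "arr g" "dm g = B" "arr h" "cd h = A"
  shows "g \<cdot> finprod (Hom \<C> A B) f I \<cdot> h = finprod (Hom \<C> (dm h) (cd g)) (\<lambda>i. g \<cdot> f i \<cdot> h) I"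
  using assms
proof (induction I rule: finite_induct)
  case empty
  interpret a: comm_monoid "Hom \<C> A B" using madd_group[OF assms(3,4)] by blast
  interpret b: comm_monoid "Hom \<C> (dm h) (cd g)" using madd_group assms by simp
  show ?case using empty by simp
next
  case (insert x I)
  have "finprod (Hom \<C> A B) f (insert x I) = f x \<boxplus> finprod (Hom \<C> A B) f I"
    "finprod (Hom \<C> A B) f I \<in> Mor \<C> A B"
    using finprod_insert_Hom[of A B I x f] insert by auto
  moreover have "finprod (Hom \<C> (dm h) (cd g)) (\<lambda>i. g \<cdot> f i \<cdot> h) (insert x I) =
    g \<cdot> f x \<cdot> h \<boxplus> finprod (Hom \<C> (dm h) (cd g)) (\<lambda>i. g \<cdot> f i \<cdot> h) I"
    using insert by (intro finprod_insert_Hom(1)) (auto simp: Mor_iff)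
  ultimately show ?case using insert by (simp add: Mor_iff)
qed

lemma biproductD:
  assumes "biproduct \<C> I F S inc prj"
  shows "finite I" "S \<in> Obj \<C>" "i \<in> I \<Longrightarrow> F i \<in> Obj \<C>"
    "i \<in> I \<Longrightarrow> arr (inc i)" "i \<in> I \<Longrightarrow> dm (inc i) = F i" "i \<in> I \<Longrightarrow> cd (inc i) = S"
    "i \<in> I \<Longrightarrow> arr (prj i)" "i \<in> I \<Longrightarrow> dm (prj i) = S" "i \<in> I \<Longrightarrow> cd (prj i) = F i"
    "i \<in> I \<Longrightarrow> j \<in> I \<Longrightarrow> prj j \<cdot> inc i = (if i = j then IdM \<C> (F i) else zero_mor \<C> (F i) (F j))"
    "i \<in> I \<Longrightarrow> j \<in> I \<Longrightarrow> arr x \<Longrightarrow> cd x = F i \<Longrightarrow>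
      prj j \<cdot> (inc i \<cdot> x) = (if i = j then x else zero_mor \<C> (dm x) (F j))"
    "finprod (Hom \<C> S S) (\<lambda>i. inc i \<cdot> prj i) I = IdM \<C> S"
proof -
  show *: "finite I" "S \<in> Obj \<C>" "i \<in> I \<Longrightarrow> F i \<in> Obj \<C>"
    "i \<in> I \<Longrightarrow> arr (inc i)" "i \<in> I \<Longrightarrow> dm (inc i) = F i" "i \<in> I \<Longrightarrow> cd (inc i) = S"
    "i \<in> I \<Longrightarrow> arr (prj i)" "i \<in> I \<Longrightarrow> dm (prj i) = S" "i \<in> I \<Longrightarrow> cd (prj i) = F i" 
    "i \<in> I \<Longrightarrow> j \<in> I \<Longrightarrow> prj j \<cdot> inc i = (if i = j then IdM \<C> (F i) else zero_mor \<C> (F i) (F j))"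
    "finprod (Hom \<C> S S) (\<lambda>i. inc i \<cdot> prj i) I = IdM \<C> S" for i j
    using assms unfolding biproduct_def Mor_iff by auto
  show "prj j \<cdot> (inc i \<cdot> x) = (if i = j then x else zero_mor \<C> (dm x) (F j))"
    if "i \<in> I" "j \<in> I" "arr x" "cd x = F i"
    using comp_reassoc[OF *(10)[OF that(1,2)], of x] that *(3-9)[of i] *(3-9)[of j] by auto
qed

lemma biproduct_cong:
  assumes "biproduct \<C> I F S inc prj"
    and "\<And>i. i \<in> I \<Longrightarrow> F i = F' i" "\<And>i. i \<in> I \<Longrightarrow> inc i = inc' i" "\<And>i. i \<in> I \<Longrightarrow> prj i = prj' i"
  shows "biproduct \<C> I F' S inc' prj'"
proof -
  note b = biproductD[OF assms(1)]
  interpret comm_monoid "Hom \<C> S S" using madd_group[OF b(2,2)] by blast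
  have "finprod (Hom \<C> S S) (\<lambda>i. inc' i \<cdot> prj' i) I = finprod (Hom \<C> S S) (\<lambda>i. inc i \<cdot> prj i) I"
    using assms(3,4) b by (intro finprod_cong') (auto simp: Mor_iff)
  then show ?thesis
    using b(1-10,12) unfolding biproduct_def Mor_iff by (simp add: assms(2-4)[symmetric])
qed

text \<open>This puts signs into a block matrix without touching the morphism that it describes.\<close>

lemma biproduct_change_signs:
  assumes "biproduct \<C> I F S inc prj"
  shows "biproduct \<C> I F S (\<lambda>i. if P i then \<boxminus> inc i else inc i) (\<lambda>i. if P i then \<boxminus> prj i else prj i)"
proof -
  note b = biproductD[OF assms(1)]
  interpret comm_monoid "Hom \<C> S S" using madd_group[OF b(2,2)] by blast
  have "finprod (Hom \<C> S S) (\<lambda>i. (if P i then \<boxminus> inc i else inc i) \<cdot> (if P i then \<boxminus> prj i else prj i)) I =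
    finprod (Hom \<C> S S) (\<lambda>i. inc i \<cdot> prj i) I"
    using b by (intro finprod_cong') (auto simp: Mor_iff)
  then show ?thesis
    using b unfolding biproduct_def Mor_iff by auto
qed

text \<open>The decomposition of a biproduct one of whose two summands is itself a biproduct.\<close>

lemma biproduct_nested:
  assumes a: "biproduct \<C> I F S i p" and b: "biprod S B S' i' p'"
    and t: "t \<notin> I"
  shows "biproduct \<C> (insert t I) (F(t := B)) S' (\<lambda>x. if x = t then i' Snd else i' Fst \<cdot> i x)
    (\<lambda>x. if x = t then p' Snd else p x \<cdot> p' Fst)"
proof -
  note a' = biproductD[OF a] and b' = biproduct_pairD[OF b]
  let ?i = "\<lambda>x. if x = t then i' Snd else i' Fst \<cdot> i x" and ?p = "\<lambda>x. if x = t then p' Snd else p x \<cdot> p' Fst"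
  have nt: "x \<in> I \<Longrightarrow> x \<noteq> t" for x using t by auto
  interpret comm_monoid "Hom \<C> S' S'" using madd_group[OF b'(1,1)] by blast
  have "finprod (Hom \<C> S' S') (\<lambda>x. ?i x \<cdot> ?p x) I =
    finprod (Hom \<C> S' S') (\<lambda>x. i' Fst \<cdot> (i x \<cdot> p x) \<cdot> p' Fst) I"
    using nt a' b' by (intro finprod_cong') (auto simp: Mor_iff)
  also have "\<dots> = i' Fst \<cdot> finprod (Hom \<C> S S) (\<lambda>x. i x \<cdot> p x) I \<cdot> p' Fst"
    using finprod_comp_Hom[of I "\<lambda>x. i x \<cdot> p x" S S "i' Fst" "p' Fst"] a' b' by (simp add: Mor_iff)
  also have "\<dots> = i' Fst \<cdot> p' Fst"
    using a'(12) b' by simp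
  finally have e: "finprod (Hom \<C> S' S') (\<lambda>x. ?i x \<cdot> ?p x) I = i' Fst \<cdot> p' Fst" .
  have "finprod (Hom \<C> S' S') (\<lambda>x. ?i x \<cdot> ?p x) (insert t I) = i' Snd \<cdot> p' Snd \<boxplus> i' Fst \<cdot> p' Fst"
  proof (subst finprod_insert_Hom(1)[OF b'(1,1) a'(1) t])
    show "?i x \<cdot> ?p x \<in> Mor \<C> S' S'" if "x \<in> insert t I" for x
      using that a' b' nt by (auto simp: Mor_iff)
    show "?i t \<cdot> ?p t \<boxplus> finprod (Hom \<C> S' S') (\<lambda>x. ?i x \<cdot> ?p x) I = i' Snd \<cdot> p' Snd \<boxplus> i' Fst \<cdot> p' Fst"
      unfolding e by simp
  qed
  also have "\<dots> = IdM \<C> S'"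
    using b'(20) b'(1-15) madd_comm[of "i' Snd \<cdot> p' Snd" "i' Fst \<cdot> p' Fst"] by simp
  finally show ?thesis
    unfolding biproduct_def Mor_iff using a' b' nt t by (auto simp: a'(11))
qed

end

section \<open>Right exact complexes and homotopy\<close>

context additive_category
begin

lemma is_complexD:
  assumes "is_complex n \<C> X"
  shows "i \<le> Suc n \<Longrightarrow> Vx X i \<in> Obj \<C>" "i \<le> n \<Longrightarrow> arr (Dif X i)"
    "i \<le> n \<Longrightarrow> dm (Dif X i) = Vx X i" "i \<le> n \<Longrightarrow> cd (Dif X i) = Vx X (Suc i)"
    "i < n \<Longrightarrow> Dif X (Suc i) \<cdot> Dif X i = zero_mor \<C> (Vx X i) (Vx X (Suc (Suc i)))"
    "i < n \<Longrightarrow> arr x \<Longrightarrow> cd x = Vx X i \<Longrightarrow>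
      Dif X (Suc i) \<cdot> (Dif X i \<cdot> x) = zero_mor \<C> (dm x) (Vx X (Suc (Suc i)))"
proof -
  note d = assms[unfolded is_complex_def Mor_iff]
  show *: "i \<le> Suc n \<Longrightarrow> Vx X i \<in> Obj \<C>" "i \<le> n \<Longrightarrow> arr (Dif X i)"
    "i \<le> n \<Longrightarrow> dm (Dif X i) = Vx X i" "i \<le> n \<Longrightarrow> cd (Dif X i) = Vx X (Suc i)"
    "i < n \<Longrightarrow> Dif X (Suc i) \<cdot> Dif X i = zero_mor \<C> (Vx X i) (Vx X (Suc (Suc i)))" for i
    using d by simp_all
  show "i < n \<Longrightarrow> arr x \<Longrightarrow> cd x = Vx X i \<Longrightarrow>
      Dif X (Suc i) \<cdot> (Dif X i \<cdot> x) = zero_mor \<C> (dm x) (Vx X (Suc (Suc i)))"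
    by (subst comp_reassoc[OF *(5)]) (simp_all add: *)
qed

lemma complex_morD:
  assumes "complex_mor n \<C> X Y f"
  shows "i \<le> Suc n \<Longrightarrow> arr (f i)" "i \<le> Suc n \<Longrightarrow> dm (f i) = Vx X i" "i \<le> Suc n \<Longrightarrow> cd (f i) = Vx Y i"
    "i \<le> n \<Longrightarrow> f (Suc i) \<cdot> Dif X i = Dif Y i \<cdot> f i"
  using assms unfolding complex_mor_def Mor_iff by simp_all

lemma complex_mor_reassoc:
  assumes "complex_mor n \<C> X Y f" "is_complex n \<C> X" "is_complex n \<C> Y"
    and "i \<le> n" "arr x" "cd x = Vx X i"
  shows "f (Suc i) \<cdot> (Dif X i \<cdot> x) = Dif Y i \<cdot> (f i \<cdot> x)"
  using comp_reassoc[OF complex_morD(4)[OF assms(1,4)], of x] assms(4-6)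
    complex_morD[OF assms(1)] is_complexD[OF assms(2)] is_complexD[OF assms(3)] by simp

lemma complex_mor_comp:
  assumes X: "is_complex n \<C> X" and Y: "is_complex n \<C> Y" and Z: "is_complex n \<C> Z"
    and f: "complex_mor n \<C> X Y f" and g: "complex_mor n \<C> Y Z g"
  shows "complex_mor n \<C> X Z (\<lambda>i. g i \<cdot> f i)"
  unfolding complex_mor_def Mor_iff
  using is_complexD[OF X] is_complexD[OF Y] is_complexD[OF Z] complex_morD[OF f] complex_morD[OF g]
    complex_mor_reassoc[OF g Y Z] by simp

lemma complex_mor_madd:
  assumes X: "is_complex n \<C> X" and Y: "is_complex n \<C> Y"
    and f: "complex_mor n \<C> X Y f" and g: "complex_mor n \<C> X Y g"
  shows "complex_mor n \<C> X Y (\<lambda>i. f i \<boxplus> g i)"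
  unfolding complex_mor_def Mor_iff
  using is_complexD[OF X] is_complexD[OF Y] complex_morD[OF f] complex_morD[OF g] by simp

lemma complex_mor_mneg:
  assumes X: "is_complex n \<C> X" and Y: "is_complex n \<C> Y" and f: "complex_mor n \<C> X Y f"
  shows "complex_mor n \<C> X Y (\<lambda>i. \<boxminus> f i)"
  unfolding complex_mor_def Mor_iff
  using is_complexD[OF X] is_complexD[OF Y] complex_morD[OF f] by simp

lemma complex_mor_id:
  assumes X: "is_complex n \<C> X"
  shows "complex_mor n \<C> X X (\<lambda>i. IdM \<C> (Vx X i))"
  unfolding complex_mor_def Mor_iff
  using is_complexD[OF X] by simp

text \<open>Exactness of \<open>\<C>(X\<^sub>n\<^sub>+\<^sub>1, -) \<rightarrow> \<dots> \<rightarrow> \<C>(X\<^sub>0, -)\<close> at the inner terms. This is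
  the exactness property of an exangle on which the comparison of homotopy classes is based.\<close>

definition right_exact :: "nat \<Rightarrow> ('o, 'm) chain \<Rightarrow> bool"
  where "right_exact n X \<longleftrightarrow>
    (\<forall>i u. i < n \<longrightarrow> arr u \<longrightarrow> dm u = Vx X (Suc i) \<longrightarrow> u \<cdot> Dif X i = zero_mor \<C> (Vx X i) (cd u) \<longrightarrow>
      (\<exists>w. arr w \<and> dm w = Vx X (Suc (Suc i)) \<and> cd w = cd u \<and> u = w \<cdot> Dif X (Suc i)))"

lemma right_exactD:
  assumes "right_exact n X" "i < n" "arr u" "dm u = Vx X (Suc i)"
    "u \<cdot> Dif X i = zero_mor \<C> (Vx X i) (cd u)"
  obtains w where "arr w" "dm w = Vx X (Suc (Suc i))" "cd w = cd u" "u = w \<cdot> Dif X (Suc i)"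
  using assms unfolding right_exact_def by blast

text \<open>The homotopy is built from left to right, as for a morphism out of a projective resolution. At the
  right end it need not vanish, so this alone is not a homotopy in the sense of \<open>homotopic\<close>.\<close>

lemma homotopy_from_right_exact:
  assumes X: "is_complex n \<C> X" and Y: "is_complex n \<C> Y" and ex: "right_exact n X"
    and e: "complex_mor n \<C> X Y e" and e0: "e 0 = zero_mor \<C> (Vx X 0) (Vx Y 0)"
  obtains \<phi> where "\<phi> 1 = zero_mor \<C> (Vx X 1) (Vx Y 0)"
    and "\<And>i. i \<le> n \<Longrightarrow> \<phi> (Suc i) \<in> Mor \<C> (Vx X (Suc i)) (Vx Y i)"
    and "\<And>i. i < n \<Longrightarrow> e (Suc i) = Dif Y i \<cdot> \<phi> (Suc i) \<boxplus> \<phi> (Suc (Suc i)) \<cdot> Dif X (Suc i)"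
proof -
  note X' = is_complexD[OF X] and Y' = is_complexD[OF Y] and e' = complex_morD[OF e]
  \<comment> \<open>\<open>P j x\<close>: the map \<open>x\<close> can serve as \<open>\<phi>\<^sub>j\<^sub>+\<^sub>1\<close>. Its last clause says that \<open>e\<^sub>j\<^sub>+\<^sub>1 - d x\<close> kills the image of \<open>d\<close>,
    so that it factors and yields \<open>\<phi>\<^sub>j\<^sub>+\<^sub>2\<close>.\<close>
  define P where "P j x \<longleftrightarrow> (j \<le> n \<longrightarrow> x \<in> Mor \<C> (Vx X (Suc j)) (Vx Y j)) \<and>
    (j = 0 \<longrightarrow> x = zero_mor \<C> (Vx X 1) (Vx Y 0)) \<and>
    (j < n \<longrightarrow> e (Suc j) \<cdot> Dif X j = Dif Y j \<cdot> (x \<cdot> Dif X j))" for j x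
  define Q where "Q j x y \<longleftrightarrow>
    (j < n \<longrightarrow> e (Suc j) = Dif Y j \<cdot> x \<boxplus> y \<cdot> Dif X (Suc j))" for j x y
  have "\<exists>\<psi>. \<forall>j. P j (\<psi> j) \<and> Q j (\<psi> j) (\<psi> (Suc j))"
  proof (rule dependent_nat_choice)
    show "\<exists>x. P 0 x"
      unfolding P_def using X' Y' e' e0
      by (intro exI[of _ "zero_mor \<C> (Vx X 1) (Vx Y 0)"]) (simp add: Mor_iff)
  next
    fix x j assume P: "P j x"
    show "\<exists>y. P (Suc j) y \<and> Q j x y"
    proof (cases "j < n")
      case False then show ?thesis unfolding P_def Q_def by auto
    next
      case True
      have x: "arr x" "dm x = Vx X (Suc j)" "cd x = Vx Y j"
        "e (Suc j) \<cdot> Dif X j = Dif Y j \<cdot> (x \<cdot> Dif X j)"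
        using P True by (auto simp: P_def Mor_iff)
      let ?u = "e (Suc j) \<boxplus> \<boxminus> (Dif Y j \<cdot> x)"
      have u: "arr ?u" "dm ?u = Vx X (Suc j)" "cd ?u = Vx Y (Suc j)"
        using x X' Y' e' True by simp_all
      have "?u \<cdot> Dif X j = zero_mor \<C> (Vx X j) (cd ?u)"
        using x X' Y' e' True by simp
      then obtain y where y: "arr y" "dm y = Vx X (Suc (Suc j))" "cd y = Vx Y (Suc j)"
        "?u = y \<cdot> Dif X (Suc j)"
        using right_exactD[OF ex True u(1,2)] u(3) by metis
      have "e (Suc j) = Dif Y j \<cdot> x \<boxplus> ?u"
        using x X' Y' e' True by (simp add: madd_ac madd_cancel)
      then have e2: "e (Suc j) = Dif Y j \<cdot> x \<boxplus> y \<cdot> Dif X (Suc j)"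
        by (simp only: y(4))
      have "e (Suc (Suc j)) \<cdot> Dif X (Suc j) = Dif Y (Suc j) \<cdot> e (Suc j)"
        using True e' by simp
      also have "\<dots> = Dif Y (Suc j) \<cdot> (y \<cdot> Dif X (Suc j))" if "Suc j < n"
        unfolding e2 using x y X' Y' True that by simp
      finally show ?thesis
        unfolding P_def Q_def Mor_iff using e2 y True by (intro exI[of _ y]) simp
    qed
  qed
  then obtain \<psi> where \<psi>: "\<And>j. P j (\<psi> j)" "\<And>j. Q j (\<psi> j) (\<psi> (Suc j))" by blast
  show thesis
    using \<psi> unfolding P_def Q_def by (intro that[of "\<lambda>i. \<psi> (i - 1)"]) auto
qed

text \<open>Here \<open>(1 + e) h = 1 - e\<^sup>2\<close>. If \<open>e = d\<phi> + \<phi>d\<close> in the inner degrees, then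
  \<open>e\<^sup>2 = d(\<phi>e) + (\<phi>e)d\<close>, and \<open>\<phi>e\<close> satisfies the boundary conditions of a homotopy at both ends: on the
  left because \<open>\<phi>\<^sub>1 = 0\<close>, on the right because \<open>e\<close> vanishes there.\<close>

lemma homotopic_to_id:
  assumes n: "1 \<le> n" and X: "is_complex n \<C> X" and ex: "right_exact n X" and h: "fixed_ends_mor n \<C> X X h"
  defines "e \<equiv> \<lambda>i. IdM \<C> (Vx X i) \<boxplus> \<boxminus> h i"
  shows "homotopic n \<C> X X (\<lambda>i. (IdM \<C> (Vx X i) \<boxplus> e i) \<cdot> h i) (\<lambda>i. IdM \<C> (Vx X i))"
proof -
  have hm: "complex_mor n \<C> X X h" and ends: "h 0 = IdM \<C> (Vx X 0)" "h (Suc n) = IdM \<C> (Vx X (Suc n))"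
    using h unfolding fixed_ends_mor_def by auto
  note X' = is_complexD[OF X] and h' = complex_morD[OF hm]
  have em: "complex_mor n \<C> X X e"
    unfolding e_def by (intro complex_mor_madd complex_mor_mneg complex_mor_id X hm)
  note e' = complex_morD[OF em]
  have e0: "e 0 = zero_mor \<C> (Vx X 0) (Vx X 0)"
    and en: "e (Suc n) = zero_mor \<C> (Vx X (Suc n)) (Vx X (Suc n))"
    using X' ends unfolding e_def by simp_all
  obtain \<phi> where p1: "\<phi> 1 = zero_mor \<C> (Vx X 1) (Vx X 0)"
    and p: "\<And>i. i \<le> n \<Longrightarrow> \<phi> (Suc i) \<in> Mor \<C> (Vx X (Suc i)) (Vx X i)"
    and pe: "\<And>i. i < n \<Longrightarrow> e (Suc i) = Dif X i \<cdot> \<phi> (Suc i) \<boxplus> \<phi> (Suc (Suc i)) \<cdot> Dif X (Suc i)"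
    using homotopy_from_right_exact[OF X X ex em e0] by metis
  have p': "i \<le> n \<Longrightarrow> arr (\<phi> (Suc i))" "i \<le> n \<Longrightarrow> dm (\<phi> (Suc i)) = Vx X (Suc i)"
    "i \<le> n \<Longrightarrow> cd (\<phi> (Suc i)) = Vx X i" for i
    using p[of i] by (auto simp: Mor_iff)
  show ?thesis
    unfolding homotopic_def
  proof (intro exI[of _ "\<lambda>i. \<phi> i \<cdot> e i"] conjI ballI)
    fix i assume "i \<in> {1..n + 1}"
    then obtain j where j: "i = Suc j" "j \<le> n" by (cases i) auto
    then show "\<phi> i \<cdot> e i \<in> Mor \<C> (Vx X i) (Vx X (i - 1))"
      using p' e' by (simp add: Mor_iff)
  next
    show "(\<phi> 1 \<cdot> e 1) \<cdot> Dif X 0 = zero_mor \<C> (Vx X 0) (Vx X 0)"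
      using p1 X' e' p'[of 0] by simp
    show "Dif X n \<cdot> \<phi> (n + 1) \<cdot> e (n + 1) = zero_mor \<C> (Vx X (n + 1)) (Vx X (n + 1))"
      using en X' p' e' by simp
  next
    fix i assume "i \<in> {1..n}"
    then obtain j where j: "i = Suc j" "j < n" by (cases i) auto
    note t = X' h' e' p' j
    have "IdM \<C> (Vx X i) \<boxplus> \<boxminus> ((IdM \<C> (Vx X i) \<boxplus> e i) \<cdot> h i) = e i \<cdot> e i"
      unfolding e_def using X' h' j by (simp add: madd_ac)
    also have "\<dots> = (Dif X j \<cdot> \<phi> i \<boxplus> \<phi> (Suc i) \<cdot> Dif X i) \<cdot> e i"
      using pe[OF j(2)] j by simp
    also have "\<dots> = Dif X j \<cdot> (\<phi> i \<cdot> e i) \<boxplus> (\<phi> (Suc i) \<cdot> e (Suc i)) \<cdot> Dif X i"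
      using t by simp
    finally have "IdM \<C> (Vx X i) \<boxplus> \<boxminus> ((IdM \<C> (Vx X i) \<boxplus> e i) \<cdot> h i) = 
      Dif X j \<cdot> (\<phi> i \<cdot> e i) \<boxplus> (\<phi> (Suc i) \<cdot> e (Suc i)) \<cdot> Dif X i" .
    then show "add_mor \<C> (Vx X i) (Vx X i) (IdM \<C> (Vx X i))
        (neg_mor \<C> (Vx X i) (Vx X i) ((IdM \<C> (Vx X i) \<boxplus> e i) \<cdot> h i)) =
      add_mor \<C> (Vx X i) (Vx X i) (Dif X (i - 1) \<cdot> \<phi> i \<cdot> e i) ((\<phi> (i + 1) \<cdot> e (i + 1)) \<cdot> Dif X i)"
      using t by (simp add: add_mor_eq neg_mor_eq)
  qed
qed

lemma homotopic_cong:
  assumes "\<And>i. 1 \<le> i \<Longrightarrow> i \<le> n \<Longrightarrow> f i = f' i" "\<And>i. 1 \<le> i \<Longrightarrow> i \<le> n \<Longrightarrow> g i = g' i"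
  shows "homotopic n \<C> X Y f g \<longleftrightarrow> homotopic n \<C> X Y f' g'"
  unfolding homotopic_def using assms by auto

lemma fixed_ends_mor_comp:
  assumes X: "is_complex n \<C> X" and Y: "is_complex n \<C> Y" and Z: "is_complex n \<C> Z"
    and f: "fixed_ends_mor n \<C> X Y f" and g: "fixed_ends_mor n \<C> Y Z g"
  shows "fixed_ends_mor n \<C> X Z (\<lambda>i. g i \<cdot> f i)"
  using complex_mor_comp[OF X Y Z] is_complexD(1)[OF Z] f g unfolding fixed_ends_mor_def by auto

text \<open>The morphisms \<open>f\<close> and \<open>g\<close> are only related at the ends, so the inverse of \<open>f\<close> is in general not \<open>g\<close>
  but \<open>(1 + e) g\<close> with \<open>e = 1 - gf\<close>. Since \<open>f e = (1 - fg) f\<close>, the same formula gives the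
  homotopy on the other side.\<close>

lemma homotopy_equivalent_if_maps_both_ways:
  assumes n: "1 \<le> n" and X: "is_complex n \<C> X" and Y: "is_complex n \<C> Y"
    and exX: "right_exact n X" and exY: "right_exact n Y"
    and f: "fixed_ends_mor n \<C> X Y f" and g: "fixed_ends_mor n \<C> Y X g"
  shows "homotopy_equivalent n \<C> X Y"
proof -
  have fm: "complex_mor n \<C> X Y f" and gm: "complex_mor n \<C> Y X g"
    using f g unfolding fixed_ends_mor_def by auto
  note X' = is_complexD[OF X] and Y' = is_complexD[OF Y]
    and f' = complex_morD[OF fm] and g' = complex_morD[OF gm]
  define e where "e = (\<lambda>i. IdM \<C> (Vx X i) \<boxplus> \<boxminus> (g i \<cdot> f i))"
  define k where "k = (\<lambda>i. (IdM \<C> (Vx X i) \<boxplus> e i) \<cdot> g i)"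
  have em: "complex_mor n \<C> X X e"
    unfolding e_def by (intro complex_mor_madd complex_mor_mneg complex_mor_id complex_mor_comp[OF X Y X] X fm gm)
  note e' = complex_morD[OF em]
  have km: "complex_mor n \<C> Y X k"
    unfolding k_def by (intro complex_mor_madd complex_mor_id complex_mor_comp[OF Y X X] X em gm)
  have "fixed_ends_mor n \<C> Y X k"
    using f g km X' Y' unfolding fixed_ends_mor_def k_def e_def by auto
  moreover have "homotopic n \<C> X X (\<lambda>i. k i \<cdot> f i) (\<lambda>i. IdM \<C> (Vx X i))"
  proof (subst homotopic_cong)
    show "homotopic n \<C> X X (\<lambda>i. (IdM \<C> (Vx X i) \<boxplus> e i) \<cdot> (g i \<cdot> f i)) (\<lambda>i. IdM \<C> (Vx X i))"
      unfolding e_def by (rule homotopic_to_id[OF n X exX fixed_ends_mor_comp[OF X Y X f g]])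
  qed (use X' f' g' e' in \<open>simp_all add: k_def\<close>)
  moreover have "homotopic n \<C> Y Y (\<lambda>i. f i \<cdot> k i) (\<lambda>i. IdM \<C> (Vx Y i))"
  proof (subst homotopic_cong)
    show "homotopic n \<C> Y Y (\<lambda>i. (IdM \<C> (Vx Y i) \<boxplus> (IdM \<C> (Vx Y i) \<boxplus> \<boxminus> (f i \<cdot> g i))) \<cdot> (f i \<cdot> g i))
      (\<lambda>i. IdM \<C> (Vx Y i))"
      by (rule homotopic_to_id[OF n Y exY fixed_ends_mor_comp[OF Y X Y g f]])
  qed (use X' Y' f' g' in \<open>simp_all add: k_def e_def\<close>)
  ultimately show ?thesis
    using f unfolding homotopy_equivalent_def by blast
qed

text \<open>If \<open>u\<close> vanishes on the image of \<open>d\<close>, then so does \<open>uf\<close>, and \<open>u = (uf)g + u(1 - fg)\<close> splits into a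
  part that factors because \<open>uf\<close> does and a part that factors because of the homotopy.\<close>

lemma right_exact_homotopy_equivalent:
  assumes X: "is_complex n \<C> X" and Z: "is_complex n \<C> Z" and ex: "right_exact n X"
    and eq: "homotopy_equivalent n \<C> X Z"
  shows "right_exact n Z"
proof -
  obtain f g \<phi> where fm: "complex_mor n \<C> X Z f" and gm: "complex_mor n \<C> Z X g"
    and p: "\<forall>i\<in>{1..n + 1}. \<phi> i \<in> Mor \<C> (Vx Z i) (Vx Z (i - 1))"
    and hom: "\<forall>i\<in>{1..n}. add_mor \<C> (Vx Z i) (Vx Z i) (IdM \<C> (Vx Z i)) (neg_mor \<C> (Vx Z i) (Vx Z i) (f i \<cdot> g i))
      = add_mor \<C> (Vx Z i) (Vx Z i) (Dif Z (i - 1) \<cdot> \<phi> i) (\<phi> (i + 1) \<cdot> Dif Z i)"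
    using eq unfolding homotopy_equivalent_def fixed_ends_mor_def homotopic_def by blast
  note X' = is_complexD[OF X] and Z' = is_complexD[OF Z]
    and f' = complex_morD[OF fm] and g' = complex_morD[OF gm]
  show ?thesis
    unfolding right_exact_def
  proof (intro allI impI)
    fix i u assume i: "i < n" and u: "arr u" "dm u = Vx Z (Suc i)"
      and z: "u \<cdot> Dif Z i = zero_mor \<C> (Vx Z i) (cd u)"
    have p': "arr (\<phi> (Suc i))" "dm (\<phi> (Suc i)) = Vx Z (Suc i)" "cd (\<phi> (Suc i)) = Vx Z i"
      "arr (\<phi> (Suc (Suc i)))" "dm (\<phi> (Suc (Suc i))) = Vx Z (Suc (Suc i))" "cd (\<phi> (Suc (Suc i))) = Vx Z (Suc i)"
      using p[rule_format, of "Suc i"] p[rule_format, of "Suc (Suc i)"] i by (auto simp: Mor_iff)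
    note t = i u X' Z' f' g' p'
    have "(u \<cdot> f (Suc i)) \<cdot> Dif X i = u \<cdot> (Dif Z i \<cdot> f i)"
      using t by simp
    also have "\<dots> = zero_mor \<C> (Vx X i) (cd (u \<cdot> f (Suc i)))"
      using t by (subst comp_reassoc[OF z]) simp_all
    finally have zf: "(u \<cdot> f (Suc i)) \<cdot> Dif X i = zero_mor \<C> (Vx X i) (cd (u \<cdot> f (Suc i)))" .
    have uf: "arr (u \<cdot> f (Suc i))" "dm (u \<cdot> f (Suc i)) = Vx X (Suc i)" "cd (u \<cdot> f (Suc i)) = cd u"
      using t by simp_all
    obtain w where w: "arr w" "dm w = Vx X (Suc (Suc i))" "cd w = cd u"
      "u \<cdot> f (Suc i) = w \<cdot> Dif X (Suc i)"
      using right_exactD[OF ex i uf(1,2) zf] unfolding uf(3) by metis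
    have 1: "f (Suc i) \<cdot> g (Suc i) \<boxplus> (IdM \<C> (Vx Z (Suc i)) \<boxplus> \<boxminus> (f (Suc i) \<cdot> g (Suc i))) = IdM \<C> (Vx Z (Suc i))"
      using t by (simp add: madd_ac madd_cancel)
    have 2: "IdM \<C> (Vx Z (Suc i)) \<boxplus> \<boxminus> (f (Suc i) \<cdot> g (Suc i)) =
      Dif Z i \<cdot> \<phi> (Suc i) \<boxplus> \<phi> (Suc (Suc i)) \<cdot> Dif Z (Suc i)"
      using hom[rule_format, of "Suc i"] t by (simp add: add_mor_eq neg_mor_eq)
    have "u = u \<cdot> (f (Suc i) \<cdot> g (Suc i) \<boxplus> (IdM \<C> (Vx Z (Suc i)) \<boxplus> \<boxminus> (f (Suc i) \<cdot> g (Suc i))))"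
      unfolding 1 using t by simp
    also have "\<dots> = (u \<cdot> f (Suc i)) \<cdot> g (Suc i) \<boxplus> (u \<cdot> (Dif Z i \<cdot> \<phi> (Suc i)) \<boxplus> u \<cdot> (\<phi> (Suc (Suc i)) \<cdot> Dif Z (Suc i)))"
      unfolding 2 using t by simp
    also have "u \<cdot> (Dif Z i \<cdot> \<phi> (Suc i)) = zero_mor \<C> (Vx Z (Suc i)) (cd u)"
      using t by (subst comp_reassoc[OF z]) simp_all
    also have "(u \<cdot> f (Suc i)) \<cdot> g (Suc i) = (w \<cdot> g (Suc (Suc i))) \<cdot> Dif Z (Suc i)"
      using t w complex_morD(4)[OF gm, of "Suc i"] unfolding w(4) by simp
    finally have "u = (w \<cdot> g (Suc (Suc i)) \<boxplus> u \<cdot> \<phi> (Suc (Suc i))) \<cdot> Dif Z (Suc i)"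
      using t w by simp
    then show "\<exists>w. arr w \<and> dm w = Vx Z (Suc (Suc i)) \<and> cd w = cd u \<and> u = w \<cdot> Dif Z (Suc i)"
      using t w by (intro exI[of _ "w \<cdot> g (Suc (Suc i)) \<boxplus> u \<cdot> \<phi> (Suc (Suc i))"]) auto
  qed
qed

text \<open>Compositions through \<open>X\<close> or \<open>Y\<close> give maps both ways between \<open>Y\<close> or \<open>X\<close> and any member of the
  other class, so homotopies never have to be composed.\<close>

lemma homotopy_class_eq:
  assumes n: "1 \<le> n" and X: "is_complex n \<C> X" and Y: "is_complex n \<C> Y"
    and exX: "right_exact n X" and exY: "right_exact n Y"
    and f: "fixed_ends_mor n \<C> X Y f" and g: "fixed_ends_mor n \<C> Y X g"
  shows "homotopy_class n \<C> X = homotopy_class n \<C> Y"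
proof -
  have "Z \<in> homotopy_class n \<C> Y" 
    if X: "is_complex n \<C> X" and Y: "is_complex n \<C> Y"
      and exX: "right_exact n X" and exY: "right_exact n Y"
      and f: "fixed_ends_mor n \<C> X Y f" and g: "fixed_ends_mor n \<C> Y X g"
      and Z: "Z \<in> homotopy_class n \<C> X" for X Y Z f g
  proof -
    have Zc: "is_complex n \<C> Z" and eq: "homotopy_equivalent n \<C> X Z"
      using Z unfolding homotopy_class_def by auto
    obtain p q where p: "fixed_ends_mor n \<C> X Z p" and q: "fixed_ends_mor n \<C> Z X q"
      using eq unfolding homotopy_equivalent_def by blast
    show ?thesis
      unfolding homotopy_class_def
      using homotopy_equivalent_if_maps_both_ways[OF n Y Zc exY right_exact_homotopy_equivalent[OF X Zc exX eq]
        fixed_ends_mor_comp[OF Y X Zc g p] fixed_ends_mor_comp[OF Zc X Y q f]] Zc by simp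
  qed
  then show ?thesis using assms by blast
qed

end

section \<open>Mapping cones\<close>

context additive_category
begin

text \<open>The mapping cone read column by column. In this form the differentials can be composed with
  maps into and out of the cone without mentioning matrix entries.\<close>

definition cone_data ::
  "nat \<Rightarrow> ('o, 'm) chain \<Rightarrow> ('o, 'm) chain \<Rightarrow> (nat \<Rightarrow> 'm) \<Rightarrow> ('o, 'm) chain \<Rightarrow>
    (nat \<Rightarrow> summand \<Rightarrow> 'm) \<Rightarrow> (nat \<Rightarrow> summand \<Rightarrow> 'm) \<Rightarrow> bool"
  where "cone_data n X Y f M inc prj \<longleftrightarrow>
    Vx M 0 = Vx X 1 \<and> inc 0 Fst = IdM \<C> (Vx X 1) \<and> prj 0 Fst = IdM \<C> (Vx X 1) \<and>
    Vx M (Suc n) = Vx Y (Suc n) \<and> inc (Suc n) Snd = IdM \<C> (Vx Y (Suc n)) \<and>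
    prj (Suc n) Snd = IdM \<C> (Vx Y (Suc n)) \<and>
    (\<forall>k<n. biprod (Vx X (Suc (Suc k))) (Vx Y (Suc k)) (Vx M (Suc k)) (inc (Suc k)) (prj (Suc k))) \<and>
    (\<forall>k\<le>n. Dif M k \<in> Mor \<C> (Vx M k) (Vx M (Suc k))) \<and>
    (\<forall>k<n. Dif M k \<cdot> inc k Fst =
      inc (Suc k) Fst \<cdot> \<boxminus> Dif X (Suc k) \<boxplus> inc (Suc k) Snd \<cdot> f (Suc k)) \<and>
    Dif M n \<cdot> inc n Fst = f (Suc n) \<and>
    (\<forall>k<n. Dif M (Suc k) \<cdot> inc (Suc k) Snd = inc (Suc (Suc k)) Snd \<cdot> Dif Y (Suc k))"

definition cone_index :: "nat \<Rightarrow> nat \<Rightarrow> summand set"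
  where "cone_index n k = {i. i = Fst \<and> k \<le> n \<or> i = Snd \<and> 1 \<le> k}"

lemma cone_index_middle: "k < n \<Longrightarrow> cone_index n (Suc k) = {Fst, Snd}"
  by (auto simp: cone_index_def)

lemma cone_data_exists:
  assumes n: "1 \<le> n" and X: "is_complex n \<C> X" and Y: "is_complex n \<C> Y"
    and M: "mapping_cone n \<C> X Y f M"
  obtains inc prj where "cone_data n X Y f M inc prj"
proof -
  note Y' = is_complexD[OF Y]
  let ?F = "\<lambda>k i. if i = Fst then Vx X (k + 1) else Vx Y k"
  let ?D = "\<lambda>k r c. case (r, c) of
          (Fst, Fst) \<Rightarrow> neg_mor \<C> (Vx X (k + 1)) (Vx X (k + 2)) (Dif X (k + 1))
        | (Snd, Fst) \<Rightarrow> f (k + 1)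
        | (Snd, Snd) \<Rightarrow> Dif Y k
        | _ \<Rightarrow> zero_mor \<C> (Vx Y k) (Vx X (k + 2))"
  obtain inc prj where B: "\<forall>k\<le>n + 1. biproduct \<C> (cone_index n k) (?F k) (Vx M k) (inc k) (prj k)"
    and E: "\<forall>k\<in>{0, n + 1}. \<forall>i\<in>cone_index n k.
        Vx M k = ?F k i \<and> inc k i = IdM \<C> (?F k i) \<and> prj k i = IdM \<C> (?F k i)"
    and D: "\<forall>k\<le>n. Dif M k \<in> Mor \<C> (Vx M k) (Vx M (k + 1)) \<and>
        (\<forall>c\<in>cone_index n k. \<forall>r\<in>cone_index n (k + 1). prj (k + 1) r \<cdot> Dif M k \<cdot> inc k c = ?D k r c)"
    using M unfolding mapping_cone_def block_chain_def cone_index_def by blast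
  have ends: "Vx M 0 = Vx X 1" "inc 0 Fst = IdM \<C> (Vx X 1)" "prj 0 Fst = IdM \<C> (Vx X 1)"
    "Vx M (Suc n) = Vx Y (Suc n)" "inc (Suc n) Snd = IdM \<C> (Vx Y (Suc n))"
    "prj (Suc n) Snd = IdM \<C> (Vx Y (Suc n))"
    using E unfolding cone_index_def by simp_all
  have entry: "k \<le> n \<Longrightarrow> c \<in> cone_index n k \<Longrightarrow> r \<in> cone_index n (k + 1) \<Longrightarrow>
      prj (k + 1) r \<cdot> Dif M k \<cdot> inc k c = ?D k r c" for k c r
    using D by blast
  have e: "k < n \<Longrightarrow> prj (Suc k) Fst \<cdot> (Dif M k \<cdot> inc k Fst) = \<boxminus> Dif X (Suc k)"
    "k \<le> n \<Longrightarrow> prj (Suc k) Snd \<cdot> (Dif M k \<cdot> inc k Fst) = f (Suc k)"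
    "Suc k < n \<Longrightarrow> prj (Suc (Suc k)) Fst \<cdot> (Dif M (Suc k) \<cdot> inc (Suc k) Snd) =
      zero_mor \<C> (Vx Y (Suc k)) (Vx X (Suc (Suc (Suc k))))"
    "k < n \<Longrightarrow> prj (Suc (Suc k)) Snd \<cdot> (Dif M (Suc k) \<cdot> inc (Suc k) Snd) = Dif Y (Suc k)" for k
    using entry[of k Fst Fst] entry[of k Fst Snd] entry[of "Suc k" Snd Fst] entry[of "Suc k" Snd Snd]
      is_complexD[OF X] by (simp_all add: cone_index_def neg_mor_eq)
  have b: "k < n \<Longrightarrow> biprod (Vx X (Suc (Suc k))) (Vx Y (Suc k)) (Vx M (Suc k)) (inc (Suc k)) (prj (Suc k))" for k
    using B[rule_format, of "Suc k"] cone_index_middle by (simp cong: if_cong)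
  note b' = biproduct_pairD[OF b]
  have d: "arr (Dif M k)" "dm (Dif M k) = Vx M k" "cd (Dif M k) = Vx M (Suc k)" if "k \<le> n" for k
    using D that unfolding Mor_iff by auto
  have i: "arr (inc k Fst)" "cd (inc k Fst) = Vx M k" if "k \<le> n" for k
    using b'[of "k - 1"] ends that is_complexD(1)[OF X, of 1] by (cases k; simp)+
  have "Dif M k \<cdot> inc k Fst =
    inc (Suc k) Fst \<cdot> \<boxminus> Dif X (Suc k) \<boxplus> inc (Suc k) Snd \<cdot> f (Suc k)" if "k < n" for k
    using b'(25)[of k "Dif M k \<cdot> inc k Fst"] e(1,2)[of k] that d i by simp
  moreover have "Dif M n \<cdot> inc n Fst = f (Suc n)"
    using e(2)[of n] ends d i by simp
  moreover have "Dif M (Suc k) \<cdot> inc (Suc k) Snd = inc (Suc (Suc k)) Snd \<cdot> Dif Y (Suc k)" if "k < n" for k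
  proof (cases "Suc k = n")
    case True
    have i: "arr (inc n Snd)" "cd (inc n Snd) = Vx M n" "dm (inc n Snd) = Vx Y n"
      using b'(7,8,9)[OF that] unfolding True by simp_all
    have "IdM \<C> (Vx Y (Suc n)) \<cdot> (Dif M n \<cdot> inc n Snd) = Dif Y n"
      using e(4)[OF that] unfolding True ends .
    then have "Dif M n \<cdot> inc n Snd = Dif Y n"
      using i d[of n] ends(4) by simp
    then show ?thesis unfolding True ends(5) using Y' by simp
  next
    case False
    then show ?thesis
      using b'(25)[of "Suc k" "Dif M (Suc k) \<cdot> inc (Suc k) Snd"] e(3,4)[of k] that d b' Y' by simp
  qed
  ultimately have "cone_data n X Y f M inc prj"
    unfolding cone_data_def Mor_iff using ends b d by simp
  then show thesis by (rule that)
qed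

text \<open>A homotopy that lives in degrees \<open>1\<close> and \<open>2\<close> only changes \<open>f\<close>, but not the cone: the shear by
  \<open>h\<close> of the term \<open>X\<^sub>2 \<oplus> Y\<^sub>1\<close> in degree \<open>1\<close> turns the matrices for \<open>f\<close> into those for the new map, so the same
  chain \<open>M\<close> is a cone of both. For \<open>n = 1\<close> this modifies \<open>f\<close> at its right end.\<close>

lemma mapping_cone_homotopy_change:
  assumes n: "1 \<le> n" and X: "is_complex n \<C> X" and Y: "is_complex n \<C> Y" and f: "complex_mor n \<C> X Y f"
    and h: "arr h" "dm h = Vx X 2" "cd h = Vx Y 1"
  defines "f' \<equiv> f(1 := f 1 \<boxplus> h \<cdot> Dif X 1, 2 := f 2 \<boxplus> Dif Y 1 \<cdot> h)"
  shows "complex_mor n \<C> X Y f'"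
    and "mapping_cone n \<C> X Y f M \<Longrightarrow> mapping_cone n \<C> X Y f' M"
proof -
  note X' = is_complexD[OF X] and Y' = is_complexD[OF Y] and f' = complex_morD[OF f]
  have h2: "dm h = Vx X (Suc (Suc 0))" "cd h = Vx Y (Suc 0)" using h by (simp_all add: numeral_2_eq_2)
  have f'_simps: "f' 0 = f 0" "f' (Suc 0) = f 1 \<boxplus> h \<cdot> Dif X 1" "f' (Suc (Suc 0)) = f 2 \<boxplus> Dif Y 1 \<cdot> h"
    "f' (Suc (Suc (Suc k))) = f (Suc (Suc (Suc k)))" for k
    unfolding f'_def by simp_all
  have f2: "arr (f 2)" "dm (f 2) = Vx X (Suc (Suc 0))" "cd (f 2) = Vx Y (Suc (Suc 0))"
    "f 2 \<cdot> Dif X (Suc 0) = Dif Y (Suc 0) \<cdot> f (Suc 0)" "2 \<le> n \<Longrightarrow> f (Suc (Suc (Suc 0))) \<cdot> Dif X 2 = Dif Y 2 \<cdot> f 2"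
    using f'(1-3)[of 2] f'(4)[of 1] f'(4)[of 2] n by (simp_all add: numeral_2_eq_2)
  show cm: "complex_mor n \<C> X Y f'"
    unfolding complex_mor_def Mor_iff
  proof (intro conjI allI impI)
    fix i assume i: "i \<le> n + 1"
    consider "i = 0" | "i = Suc 0" | "i = Suc (Suc 0)" | k where "i = Suc (Suc (Suc k))"
      by (metis not0_implies_Suc)
    then show "arr (f' i)" "dm (f' i) = Vx X i" "cd (f' i) = Vx Y i"
      by (cases; use X' Y' f' h(1) h2 f2 n i f'_simps in simp)+
  next
    fix i assume i: "i \<le> n"
    consider "i = 0" | "i = Suc 0" | "i = Suc (Suc 0)" | k where "i = Suc (Suc (Suc k))"
      by (metis not0_implies_Suc)
    then show "f' (i + 1) \<cdot> Dif X i = Dif Y i \<cdot> f' i"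
    proof cases
      case 3
      then show ?thesis using X' Y' f' h(1) h2 f2 n i f'_simps by (simp add: numeral_2_eq_2)
    qed (use X' Y' f' h(1) h2 f2 n i f'_simps in simp_all)
  qed
  let ?F = "\<lambda>k i. if i = Fst then Vx X (k + 1) else Vx Y k"
  let ?D = "\<lambda>f k r c. case (r, c) of
          (Fst, Fst) \<Rightarrow> neg_mor \<C> (Vx X (k + 1)) (Vx X (k + 2)) (Dif X (k + 1))
        | (Snd, Fst) \<Rightarrow> f (k + 1)
        | (Snd, Snd) \<Rightarrow> Dif Y k
        | _ \<Rightarrow> zero_mor \<C> (Vx Y k) (Vx X (k + 2))"
  assume "mapping_cone n \<C> X Y f M"
  then obtain inc prj where B: "\<forall>k\<le>n + 1. biproduct \<C> (cone_index n k) (?F k) (Vx M k) (inc k) (prj k)"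
    and e: "\<forall>k\<in>{0, n + 1}. \<forall>i\<in>cone_index n k.
        Vx M k = ?F k i \<and> inc k i = IdM \<C> (?F k i) \<and> prj k i = IdM \<C> (?F k i)"
    and d: "\<forall>k\<le>n. Dif M k \<in> Mor \<C> (Vx M k) (Vx M (k + 1)) \<and>
        (\<forall>c\<in>cone_index n k. \<forall>r\<in>cone_index n (k + 1). prj (k + 1) r \<cdot> Dif M k \<cdot> inc k c = ?D f k r c)"
    unfolding mapping_cone_def block_chain_def cone_index_def by blast
  have n0: "0 < n" using n by simp
  have b1: "biprod (Vx X (Suc (Suc 0))) (Vx Y (Suc 0)) (Vx M (Suc 0)) (inc (Suc 0)) (prj (Suc 0))"
    using B[rule_format, of "Suc 0"] cone_index_middle[OF n0] n by (simp cong: if_cong)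
  note b1' = biproduct_pairD[OF b1]
  \<comment> \<open>The shear by \<open>h\<close>, applied to the decomposition of the degree \<open>1\<close> term and not to the
    differentials.\<close>
  define inc' where "inc' k i = (if k = 1 \<and> i = Fst then inc 1 Fst \<boxplus> inc 1 Snd \<cdot> h else inc k i)" for k i
  define prj' where "prj' k i = (if k = 1 \<and> i = Snd then prj 1 Snd \<boxplus> \<boxminus> (h \<cdot> prj 1 Fst) else prj k i)" for k i
  have "block_chain n \<C> (cone_index n) ?F (?D f') M"
    unfolding block_chain_def
  proof (rule exI[of _ inc'], rule exI[of _ prj'], intro conjI allI impI ballI)
    fix k assume k: "k \<le> n + 1"
    show "biproduct \<C> (cone_index n k) (?F k) (Vx M k) (inc' k) (prj' k)"
    proof (cases "k = 1")
      case True
      have "biprod (Vx X (Suc (Suc 0))) (Vx Y (Suc 0)) (Vx M (Suc 0)) (inc' (Suc 0)) (prj' (Suc 0))"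
        unfolding biproduct_iff Mor_iff inc'_def prj'_def
        using b1' h(1) h2 by (simp add: madd_ac madd_cancel)
      then show ?thesis using True cone_index_middle[OF n0] by (simp cong: if_cong)
    next
      case False
      then have "inc' k = inc k" "prj' k = prj k" by (simp_all add: inc'_def prj'_def fun_eq_iff)
      then show ?thesis using B k by simp
    qed
  next
    fix k i assume "k \<in> {0, n + 1}" "i \<in> cone_index n k"
    then show "Vx M k = ?F k i" "inc' k i = IdM \<C> (?F k i)" "prj' k i = IdM \<C> (?F k i)"
      using e n by (auto simp: inc'_def prj'_def)
  next
    fix k assume k: "k \<le> n"
    then show "Dif M k \<in> Mor \<C> (Vx M k) (Vx M (k + 1))" using d by blast
    then have dk: "arr (Dif M k)" "dm (Dif M k) = Vx M k" "cd (Dif M k) = Vx M (Suc k)"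
      by (simp_all add: Mor_iff)
    fix c r assume c: "c \<in> cone_index n k" and r: "r \<in> cone_index n (k + 1)"
    have old: "k \<le> n \<Longrightarrow> c \<in> cone_index n k \<Longrightarrow> r \<in> cone_index n (k + 1) \<Longrightarrow>
      prj (k + 1) r \<cdot> Dif M k \<cdot> inc k c = ?D f k r c" for k c r
      using d by blast
    have p: "arr (prj (Suc k) r)" "dm (prj (Suc k) r) = Vx M (Suc k)"
      using biproductD(7,8)[OF B[rule_format, of "Suc k"], of r] k r by simp_all
    have i: "arr (inc k c)" "cd (inc k c) = Vx M k"
      using biproductD(4,6)[OF B[rule_format, of k], of c] k c by simp_all
    consider "k = 0" "r = Snd" | "k = 0" "r \<noteq> Snd" | "k = 1" "c = Fst" | "k = 1" "c \<noteq> Fst" | "2 \<le> k" by linarith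
    then show "prj' (k + 1) r \<cdot> Dif M k \<cdot> inc' k c = ?D f' k r c"
    proof cases
      case 1
      have "c = Fst" using c 1 by (auto simp: cone_index_def)
      moreover have "prj (Suc 0) Fst \<cdot> (Dif M 0 \<cdot> inc 0 Fst) = \<boxminus> Dif X 1"
        "prj (Suc 0) Snd \<cdot> (Dif M 0 \<cdot> inc 0 Fst) = f 1"
        using old[of 0 Fst Fst] old[of 0 Fst Snd] n X' by (simp_all add: cone_index_def neg_mor_eq)
      ultimately show ?thesis
        using 1 dk i b1' h(1) h2 X' n by (simp add: prj'_def inc'_def f'_simps)
    next
      case 2
      then show ?thesis using old[OF k c r] c r by (auto simp: prj'_def inc'_def cone_index_def)
    next
      case 3
      have "prj (Suc k) r \<cdot> (Dif M k \<cdot> (inc 1 Fst \<boxplus> inc 1 Snd \<cdot> h)) =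
          prj (Suc k) r \<cdot> (Dif M k \<cdot> inc 1 Fst) \<boxplus> (prj (Suc k) r \<cdot> (Dif M k \<cdot> inc 1 Snd)) \<cdot> h"
        using p dk b1' h(1) h2 3 by simp
      then show ?thesis
        using 3 r old[OF n, of Fst r] old[OF n, of Snd r] X' Y' h(1) h2 n f2
        by (auto simp: prj'_def inc'_def cone_index_def neg_mor_eq f'_def numeral_2_eq_2 numeral_3_eq_3)
    next
      case 4
      then show ?thesis using old[OF k c r] c r by (auto simp: prj'_def inc'_def cone_index_def)
    next
      case 5
      then have "f' (k + 1) = f (k + 1)" by (simp add: f'_def)
      then show ?thesis using old[OF k c r] 5 by (simp add: prj'_def inc'_def split: summand.split)
    qed
  qed
  then show "mapping_cone n \<C> X Y f' M"
    unfolding mapping_cone_def cone_index_def .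
qed

end

section \<open>Extensions\<close>

context additive_bifunctor
begin

lemma pull_closed [simp]:
  assumes "arr c" "dm c = C'" "A \<in> Obj \<C>" "\<delta> \<in> carrier (Ext E (cd c) A)"
  shows "pull \<C> E A c \<delta> \<in> carrier (Ext E C' A)"
  using emap_hom[of c C' "cd c" "IdM \<C> A" A A] assms unfolding pull_def hom_def
  by (auto simp: Mor_iff)

lemma push_closed [simp]:
  assumes "arr a" "cd a = A'" "C \<in> Obj \<C>" "\<delta> \<in> carrier (Ext E C (dm a))"
  shows "push \<C> E C a \<delta> \<in> carrier (Ext E C A')"
  using emap_hom[of "IdM \<C> C" C C a "dm a" A'] assms unfolding push_def hom_def
  by (auto simp: Mor_iff)

lemma pull_id [simp]: "C \<in> Obj \<C> \<Longrightarrow> A \<in> Obj \<C> \<Longrightarrow> \<delta> \<in> carrier (Ext E C A) \<Longrightarrow> pull \<C> E A (IdM \<C> C) \<delta> = \<delta>"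
  unfolding pull_def by (rule emap_id)

lemma push_id [simp]: "C \<in> Obj \<C> \<Longrightarrow> A \<in> Obj \<C> \<Longrightarrow> \<delta> \<in> carrier (Ext E C A) \<Longrightarrow> push \<C> E C (IdM \<C> A) \<delta> = \<delta>"
  unfolding push_def by (rule emap_id)

lemma pull_comp [simp]:
  assumes "arr c" "arr c'" "dm c = cd c'" "A \<in> Obj \<C>" "\<delta> \<in> carrier (Ext E (cd c) A)"
  shows "pull \<C> E A (c \<cdot> c') \<delta> = pull \<C> E A c' (pull \<C> E A c \<delta>)"
  using emap_comp[of c "dm c" "cd c" c' "dm c'" "IdM \<C> A" A A "IdM \<C> A" A \<delta>] assms
  unfolding pull_def by (simp add: Mor_iff)

lemma push_comp [simp]:
  assumes "arr a" "arr a'" "dm a' = cd a" "C \<in> Obj \<C>" "\<delta> \<in> carrier (Ext E C (dm a))"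
  shows "push \<C> E C (a' \<cdot> a) \<delta> = push \<C> E C a' (push \<C> E C a \<delta>)"
  using emap_comp[of "IdM \<C> C" C C "IdM \<C> C" C a "dm a" "cd a" a' "cd a'" \<delta>] assms
  unfolding push_def by (simp add: Mor_iff)

text \<open>With \<open>emap_eq_pull_push\<close> this expresses the action of \<open>E\<close> on a pair of morphisms by the two partial
  actions, which therefore commute.\<close>

lemma emap_eq_push_pull:
  assumes "arr a" "arr c" "dm a = A" "dm c = C'" "\<delta> \<in> carrier (Ext E (cd c) A)"
  shows "push \<C> E C' a (pull \<C> E A c \<delta>) = EMap E c a \<delta>"
  using emap_comp[of c C' "cd c" "IdM \<C> C'" C' "IdM \<C> A" A A a "cd a" \<delta>] assms
  unfolding push_def pull_def by (auto simp: Mor_iff)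

lemma emap_eq_pull_push:
  assumes "arr a" "arr c" "cd a = A'" "cd c = C" "\<delta> \<in> carrier (Ext E C (dm a))"
  shows "pull \<C> E A' c (push \<C> E C a \<delta>) = EMap E c a \<delta>"
  using emap_comp[of "IdM \<C> C" C C c "dm c" a "dm a" A' "IdM \<C> A'" A' \<delta>] assms
  unfolding push_def pull_def by (auto simp: Mor_iff)

lemma push_pull:
  assumes "arr a" "arr c" "dm a = A" "cd a = A'" "dm c = C'" "cd c = C" "\<delta> \<in> carrier (Ext E C A)"
  shows "push \<C> E C' a (pull \<C> E A c \<delta>) = pull \<C> E A' c (push \<C> E C a \<delta>)"
  using emap_eq_push_pull[of a c A C' \<delta>] emap_eq_pull_push[of a c A' C \<delta>] assms by simp

lemma ext_monoid:
  assumes "C \<in> Obj \<C>" "A \<in> Obj \<C>"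
  shows "comm_group (Ext E C A)" "group (Ext E C A)" "monoid (Ext E C A)"
  using ext_group[OF assms] by (auto simp: comm_group_def group_def)

lemma ext_closed [simp]:
  assumes "C \<in> Obj \<C>" "A \<in> Obj \<C>"
  shows "\<one>\<^bsub>Ext E C A\<^esub> \<in> carrier (Ext E C A)"
    and "\<delta> \<in> carrier (Ext E C A) \<Longrightarrow> \<epsilon> \<in> carrier (Ext E C A) \<Longrightarrow> \<delta> \<otimes>\<^bsub>Ext E C A\<^esub> \<epsilon> \<in> carrier (Ext E C A)"
    and "\<delta> \<in> carrier (Ext E C A) \<Longrightarrow> \<delta> \<otimes>\<^bsub>Ext E C A\<^esub> \<one>\<^bsub>Ext E C A\<^esub> = \<delta>"
    and "\<delta> \<in> carrier (Ext E C A) \<Longrightarrow> \<one>\<^bsub>Ext E C A\<^esub> \<otimes>\<^bsub>Ext E C A\<^esub> \<delta> = \<delta>"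
  using ext_monoid(3)[OF assms] by (auto intro: monoid.m_closed monoid.one_closed)

lemma pull_group_hom:
  assumes "arr c" "A \<in> Obj \<C>"
  shows "group_hom (Ext E (cd c) A) (Ext E (dm c) A) (pull \<C> E A c)"
  using emap_hom[of c "dm c" "cd c" "IdM \<C> A" A A] assms ext_monoid(2)
  unfolding group_hom_def group_hom_axioms_def by (auto simp: Mor_iff pull_def hom_def)

lemma push_group_hom:
  assumes "arr a" "C \<in> Obj \<C>"
  shows "group_hom (Ext E C (dm a)) (Ext E C (cd a)) (push \<C> E C a)"
  using emap_hom[of "IdM \<C> C" C C a "dm a" "cd a"] assms ext_monoid(2)
  unfolding group_hom_def group_hom_axioms_def by (auto simp: Mor_iff push_def hom_def)

lemma pull_mult [simp]:
  assumes "arr c" "A \<in> Obj \<C>" "cd c = C" "\<delta> \<in> carrier (Ext E C A)" "\<epsilon> \<in> carrier (Ext E C A)"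
  shows "pull \<C> E A c (\<delta> \<otimes>\<^bsub>Ext E C A\<^esub> \<epsilon>) = pull \<C> E A c \<delta> \<otimes>\<^bsub>Ext E (dm c) A\<^esub> pull \<C> E A c \<epsilon>"
  using group_hom.hom_mult[OF pull_group_hom[of c A]] assms by auto

lemma push_mult [simp]:
  assumes "arr a" "C \<in> Obj \<C>" "dm a = A" "\<delta> \<in> carrier (Ext E C A)" "\<epsilon> \<in> carrier (Ext E C A)"
  shows "push \<C> E C a (\<delta> \<otimes>\<^bsub>Ext E C A\<^esub> \<epsilon>) = push \<C> E C a \<delta> \<otimes>\<^bsub>Ext E C (cd a)\<^esub> push \<C> E C a \<epsilon>"
  using group_hom.hom_mult[OF push_group_hom[of a C]] assms by auto

lemma pull_one [simp]:
  "arr c \<Longrightarrow> A \<in> Obj \<C> \<Longrightarrow> cd c = C \<Longrightarrow> pull \<C> E A c \<one>\<^bsub>Ext E C A\<^esub> = \<one>\<^bsub>Ext E (dm c) A\<^esub>"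
  using group_hom.hom_one[OF pull_group_hom[of c A]] by auto

lemma push_one [simp]:
  "arr a \<Longrightarrow> C \<in> Obj \<C> \<Longrightarrow> dm a = A \<Longrightarrow> push \<C> E C a \<one>\<^bsub>Ext E C A\<^esub> = \<one>\<^bsub>Ext E C (cd a)\<^esub>"
  using group_hom.hom_one[OF push_group_hom[of a C]] by auto

lemma pull_madd [simp]:
  assumes "arr c" "arr c'" "dm c = dm c'" "cd c = cd c'" "A \<in> Obj \<C>" "\<delta> \<in> carrier (Ext E (cd c') A)"
  shows "pull \<C> E A (c \<boxplus> c') \<delta> = pull \<C> E A c \<delta> \<otimes>\<^bsub>Ext E (dm c') A\<^esub> pull \<C> E A c' \<delta>"
  using pull_add[of A c "dm c'" "cd c'" c' \<delta>] assms by (simp add: Mor_iff add_mor_eq)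

lemma push_madd [simp]:
  assumes "arr a" "arr a'" "dm a = dm a'" "cd a = cd a'" "C \<in> Obj \<C>" "\<delta> \<in> carrier (Ext E C (dm a'))"
  shows "push \<C> E C (a \<boxplus> a') \<delta> = push \<C> E C a \<delta> \<otimes>\<^bsub>Ext E C (cd a')\<^esub> push \<C> E C a' \<delta>"
  using push_add[of C a "dm a'" "cd a'" a' \<delta>] assms by (simp add: Mor_iff add_mor_eq)

lemma ext_idem_one:
  assumes "C \<in> Obj \<C>" "A \<in> Obj \<C>" "x \<in> carrier (Ext E C A)" "x = x \<otimes>\<^bsub>Ext E C A\<^esub> x"
  shows "x = \<one>\<^bsub>Ext E C A\<^esub>"
  using group.l_cancel_one'[OF ext_monoid(2)[OF assms(1,2)] assms(3,3)] assms(4) by simp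

lemma pull_zero [simp]:
  assumes "A \<in> Obj \<C>" "C' \<in> Obj \<C>" "C \<in> Obj \<C>" "\<delta> \<in> carrier (Ext E C A)"
  shows "pull \<C> E A (zero_mor \<C> C' C) \<delta> = \<one>\<^bsub>Ext E C' A\<^esub>"
  using ext_idem_one[of C' A "pull \<C> E A (zero_mor \<C> C' C) \<delta>"]
    pull_madd[of "zero_mor \<C> C' C" "zero_mor \<C> C' C" A \<delta>] assms by (simp del: pull_madd)

lemma push_zero [simp]:
  assumes "A \<in> Obj \<C>" "A' \<in> Obj \<C>" "C \<in> Obj \<C>" "\<delta> \<in> carrier (Ext E C A)"
  shows "push \<C> E C (zero_mor \<C> A A') \<delta> = \<one>\<^bsub>Ext E C A'\<^esub>"
  using ext_idem_one[of C A' "push \<C> E C (zero_mor \<C> A A') \<delta>"]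
    push_madd[of "zero_mor \<C> A A'" "zero_mor \<C> A A'" C \<delta>] assms by (simp del: push_madd)

end

section \<open>Recognizing distinguished n-exangles\<close>

locale n_exangulated = n_exangulated_category \<C> E n \<s>
  for \<C> :: "('o, 'm) category" (structure) and E :: "('o, 'm, 'e) bifunctor"
    and n :: nat and \<s> :: "('o, 'm, 'e) realization" +
  assumes n_pos: "1 \<le> n"
begin

abbreviation dist :: "('o, 'm) chain \<Rightarrow> 'e \<Rightarrow> bool" where "dist \<equiv> distinguished n \<C> E \<s>"

lemma distD:
  assumes "dist X \<delta>"
  shows "is_complex n \<C> X" "\<delta> \<in> carrier (Ext E (Vx X (Suc n)) (Vx X 0))"
    "push \<C> E (Vx X (Suc n)) (Dif X 0) \<delta> = \<one>\<^bsub>Ext E (Vx X (Suc n)) (Vx X 1)\<^esub>"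
    "pull \<C> E (Vx X 0) (Dif X n) \<delta> = \<one>\<^bsub>Ext E (Vx X n) (Vx X 0)\<^esub>"
  using R1[OF assms] unfolding n_exangle_def by simp_all

lemma dist_right_exact:
  assumes "dist X \<delta>" shows "right_exact n X"
  unfolding right_exact_def
proof (intro allI impI)
  fix i u assume "i < n" "arr u" "dm u = Vx X (Suc i)" "u \<cdot> Dif X i = zero_mor \<C> (Vx X i) (cd u)"
  moreover from this have "{f \<in> Mor \<C> (Vx X (i + 1)) (cd u). f \<cdot> Dif X i = zero_mor \<C> (Vx X i) (cd u)}
      = (\<lambda>g. g \<cdot> Dif X (i + 1)) ` Mor \<C> (Vx X (i + 2)) (cd u)"
    using R1[OF assms] unfolding n_exangle_def by simp
  ultimately have "u \<in> (\<lambda>g. g \<cdot> Dif X (i + 1)) ` Mor \<C> (Vx X (i + 2)) (cd u)"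
    by (auto simp: Mor_iff)
  then show "\<exists>w. arr w \<and> dm w = Vx X (Suc (Suc i)) \<and> cd w = cd u \<and> u = w \<cdot> Dif X (Suc i)"
    by (auto simp: Mor_iff)
qed

lemma pull_eq_one_factor:
  assumes X: "dist X \<delta>" and c: "arr c" "cd c = Vx X (Suc n)"
    and z: "pull \<C> E (Vx X 0) c \<delta> = \<one>\<^bsub>Ext E (dm c) (Vx X 0)\<^esub>"
  obtains y where "arr y" "dm y = dm c" "cd y = Vx X n" "c = Dif X n \<cdot> y"
proof -
  have "{f \<in> Mor \<C> (dm c) (Vx X (n + 1)). pull \<C> E (Vx X 0) f \<delta> = \<one>\<^bsub>Ext E (dm c) (Vx X 0)\<^esub>}
        = (\<lambda>g. Dif X n \<cdot> g) ` Mor \<C> (dm c) (Vx X n)"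
    using R1[OF X] c unfolding n_exangle_def by simp
  then have "c \<in> (\<lambda>g. Dif X n \<cdot> g) ` Mor \<C> (dm c) (Vx X n)"
    using c z by (auto simp: Mor_iff)
  then show thesis using that by (auto simp: Mor_iff)
qed

lemma push_eq_one_factor:
  assumes X: "dist X \<delta>" and a: "arr a" "dm a = Vx X 0"
    and z: "push \<C> E (Vx X (Suc n)) a \<delta> = \<one>\<^bsub>Ext E (Vx X (Suc n)) (cd a)\<^esub>"
  obtains y where "arr y" "cd y = cd a" "dm y = Vx X 1" "a = y \<cdot> Dif X 0"
proof -
  have "{f \<in> Mor \<C> (Vx X 0) (cd a). push \<C> E (Vx X (n + 1)) f \<delta> = \<one>\<^bsub>Ext E (Vx X (n + 1)) (cd a)\<^esub>}
        = (\<lambda>g. g \<cdot> Dif X 0) ` Mor \<C> (Vx X 1) (cd a)"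
    using R1[OF X] a unfolding n_exangle_def by simp
  then have "a \<in> (\<lambda>g. g \<cdot> Dif X 0) ` Mor \<C> (Vx X 1) (cd a)"
    using a z by (auto simp: Mor_iff)
  then show thesis using that by (auto simp: Mor_iff)
qed

text \<open>Maps both ways put \<open>Y\<close> into the homotopy class of \<open>X\<close>, and a distinguished exangle is recognized by
  its class. The realization axiom provides such maps whenever the extensions match.\<close>

lemma dist_transfer:
  assumes X: "dist X \<delta>" and Y: "is_complex n \<C> Y" "right_exact n Y"
    and f: "fixed_ends_mor n \<C> X Y f" and g: "fixed_ends_mor n \<C> Y X g"
  shows "dist Y \<delta>"
proof -
  have "Vx X 0 = Vx Y 0" "Vx X (Suc n) = Vx Y (Suc n)"
    using f unfolding fixed_ends_mor_def by simp_all
  then show ?thesis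
    using X homotopy_class_eq[OF n_pos distD(1)[OF X] Y(1) dist_right_exact[OF X] Y(2) f g] Y(1)
    unfolding distinguished_def by simp
qed

lemma dist_lift:
  assumes "dist X \<delta>" "dist Y \<rho>" "arr a" "dm a = Vx X 0" "cd a = Vx Y 0"
    "arr c" "dm c = Vx X (Suc n)" "cd c = Vx Y (Suc n)"
    "push \<C> E (Vx X (Suc n)) a \<delta> = pull \<C> E (Vx Y 0) c \<rho>"
  obtains f where "complex_mor n \<C> X Y f" "f 0 = a" "f (Suc n) = c"
  using R0[OF assms(1,2), of a c] assms by (auto simp: Mor_iff)

lemma dist_realized:
  assumes "C \<in> Obj \<C>" "A \<in> Obj \<C>" "\<delta> \<in> carrier (Ext E C A)"
  obtains X where "Vx X 0 = A" "Vx X (Suc n) = C" "dist X \<delta>"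
  using realized[OF assms] by auto

text \<open>\<open>S\<close> is compared with a realization \<open>R\<close> of \<open>\<sigma>\<close>. The compatibility with the extensions allows
  to lift the end components of \<open>i, j, p, q\<close> to morphisms between \<open>X\<close>, \<open>Y\<close> and \<open>R\<close>; going through \<open>X\<close>
  and \<open>Y\<close> and adding gives morphisms \<open>S \<rightarrow> R\<close> and \<open>R \<rightarrow> S\<close>, which are the identity at the ends since
  \<open>ip + jq = 1\<close>. With \<open>X = Y\<close> and zero maps for \<open>j, q\<close> this is closure under retracts.\<close>

lemma dist_split_cover:
  assumes X: "dist X \<delta>" and Y: "dist Y \<epsilon>"
    and S: "\<And>k. k \<le> Suc n \<Longrightarrow> Vx S k \<in> Obj \<C>"
      "\<And>k. k \<le> n \<Longrightarrow> Dif S k \<in> Mor \<C> (Vx S k) (Vx S (Suc k))"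
    and \<sigma>: "\<sigma> \<in> carrier (Ext E (Vx S (Suc n)) (Vx S 0))"
    and i: "complex_mor n \<C> X S i" and p: "complex_mor n \<C> S X p"
    and j: "complex_mor n \<C> Y S j" and q: "complex_mor n \<C> S Y q"
    and id: "\<And>k. k \<le> Suc n \<Longrightarrow> i k \<cdot> p k \<boxplus> j k \<cdot> q k = IdM \<C> (Vx S k)"
    and ei: "push \<C> E (Vx X (Suc n)) (i 0) \<delta> = pull \<C> E (Vx S 0) (i (Suc n)) \<sigma>"
    and ej: "push \<C> E (Vx Y (Suc n)) (j 0) \<epsilon> = pull \<C> E (Vx S 0) (j (Suc n)) \<sigma>"
    and ep: "push \<C> E (Vx S (Suc n)) (p 0) \<sigma> = pull \<C> E (Vx X 0) (p (Suc n)) \<delta>"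
    and eq: "push \<C> E (Vx S (Suc n)) (q 0) \<sigma> = pull \<C> E (Vx Y 0) (q (Suc n)) \<epsilon>"
  shows "dist S \<sigma>"
proof -
  note X' = is_complexD[OF distD(1)[OF X]] and Y' = is_complexD[OF distD(1)[OF Y]]
    and i' = complex_morD[OF i] and j' = complex_morD[OF j]
    and p' = complex_morD[OF p] and q' = complex_morD[OF q]
  have S': "k \<le> n \<Longrightarrow> arr (Dif S k)" "k \<le> n \<Longrightarrow> dm (Dif S k) = Vx S k"
    "k \<le> n \<Longrightarrow> cd (Dif S k) = Vx S (Suc k)" for k
    using S(2)[of k] by (auto simp: Mor_iff)
  have ip: "(u \<cdot> i k) \<cdot> p k \<boxplus> (u \<cdot> j k) \<cdot> q k = u" if "k \<le> Suc n" "arr u" "dm u = Vx S k" for k u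
    using arg_cong[OF id[OF that(1)], of "\<lambda>x. u \<cdot> x"] that i' j' p' q' by simp
  have Sc: "is_complex n \<C> S"
    unfolding is_complex_def
  proof (intro conjI allI impI)
    fix k assume k: "k < n"
    have "(Dif S (Suc k) \<cdot> Dif S k) \<cdot> i k = zero_mor \<C> (Vx X k) (Vx S (Suc (Suc k)))"
    proof -
      have "(Dif S (Suc k) \<cdot> Dif S k) \<cdot> i k = (Dif S (Suc k) \<cdot> i (Suc k)) \<cdot> Dif X k"
        using k S' i' X' by simp
      also have "\<dots> = i (Suc (Suc k)) \<cdot> (Dif X (Suc k) \<cdot> Dif X k)"
        using k S' i'(1-3) X'(1-4) i'(4)[of "Suc k", symmetric] by simp
      also have "\<dots> = zero_mor \<C> (Vx X k) (Vx S (Suc (Suc k)))"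
        using k S' i' X' S by simp
      finally show ?thesis .
    qed
    moreover have "(Dif S (Suc k) \<cdot> Dif S k) \<cdot> j k = zero_mor \<C> (Vx Y k) (Vx S (Suc (Suc k)))"
    proof -
      have "(Dif S (Suc k) \<cdot> Dif S k) \<cdot> j k = (Dif S (Suc k) \<cdot> j (Suc k)) \<cdot> Dif Y k"
        using k S' j' Y' by simp
      also have "\<dots> = j (Suc (Suc k)) \<cdot> (Dif Y (Suc k) \<cdot> Dif Y k)"
        using k S' j'(1-3) Y'(1-4) j'(4)[of "Suc k", symmetric] by simp
      also have "\<dots> = zero_mor \<C> (Vx Y k) (Vx S (Suc (Suc k)))"
        using k S' j' Y' S by simp
      finally show ?thesis .
    qed
    ultimately show "Dif S (k + 1) \<cdot> Dif S k = zero_mor \<C> (Vx S k) (Vx S (k + 2))"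
      using ip[of k "Dif S (Suc k) \<cdot> Dif S k"] k S' p' q' S(1) by simp
  qed (use S in simp_all)
  have Sex: "right_exact n S"
    unfolding right_exact_def
  proof (intro allI impI)
    fix k u assume k: "k < n" and u: "arr u" "dm u = Vx S (Suc k)"
      and z: "u \<cdot> Dif S k = zero_mor \<C> (Vx S k) (cd u)"
    have zi: "(u \<cdot> i (Suc k)) \<cdot> Dif X k = zero_mor \<C> (Vx X k) (cd (u \<cdot> i (Suc k)))"
      using k u i' X' S' comp_reassoc[OF z, of "i k"] S(1) by simp
    have zj: "(u \<cdot> j (Suc k)) \<cdot> Dif Y k = zero_mor \<C> (Vx Y k) (cd (u \<cdot> j (Suc k)))"
      using k u j' Y' S' comp_reassoc[OF z, of "j k"] S(1) by simp
    have ui: "arr (u \<cdot> i (Suc k))" "dm (u \<cdot> i (Suc k)) = Vx X (Suc k)" "cd (u \<cdot> i (Suc k)) = cd u"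
      and uj: "arr (u \<cdot> j (Suc k))" "dm (u \<cdot> j (Suc k)) = Vx Y (Suc k)" "cd (u \<cdot> j (Suc k)) = cd u"
      using k u i' j' by simp_all
    obtain v where v: "arr v" "dm v = Vx X (Suc (Suc k))" "cd v = cd u" "u \<cdot> i (Suc k) = v \<cdot> Dif X (Suc k)"
      using right_exactD[OF dist_right_exact[OF X] k ui(1,2) zi] unfolding ui(3) by metis
    obtain w where w: "arr w" "dm w = Vx Y (Suc (Suc k))" "cd w = cd u" "u \<cdot> j (Suc k) = w \<cdot> Dif Y (Suc k)"
      using right_exactD[OF dist_right_exact[OF Y] k uj(1,2) zj] unfolding uj(3) by metis
    have "u = (v \<cdot> Dif X (Suc k)) \<cdot> p (Suc k) \<boxplus> (w \<cdot> Dif Y (Suc k)) \<cdot> q (Suc k)"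
      using ip[of "Suc k" u] k u unfolding v(4) w(4) by simp
    also have "\<dots> = (v \<cdot> p (Suc (Suc k)) \<boxplus> w \<cdot> q (Suc (Suc k))) \<cdot> Dif S (Suc k)"
      using k u v(1-3) w(1-3) X'(1-4) Y'(1-4) S' p' q' by simp
    finally have "u = (v \<cdot> p (Suc (Suc k)) \<boxplus> w \<cdot> q (Suc (Suc k))) \<cdot> Dif S (Suc k)" .
    moreover have "arr (v \<cdot> p (Suc (Suc k)) \<boxplus> w \<cdot> q (Suc (Suc k)))"
      "dm (v \<cdot> p (Suc (Suc k)) \<boxplus> w \<cdot> q (Suc (Suc k))) = Vx S (Suc (Suc k))"
      "cd (v \<cdot> p (Suc (Suc k)) \<boxplus> w \<cdot> q (Suc (Suc k))) = cd u"
      using k v(1-3) w(1-3) p' q' by simp_all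
    ultimately show "\<exists>w. arr w \<and> dm w = Vx S (Suc (Suc k)) \<and> cd w = cd u \<and> u = w \<cdot> Dif S (Suc k)"
      by blast
  qed
  obtain R where R: "Vx R 0 = Vx S 0" "Vx R (Suc n) = Vx S (Suc n)" "dist R \<sigma>"
    using dist_realized[OF S(1)[of "Suc n"] S(1)[of 0] \<sigma>] by auto
  note Rc = distD(1)[OF R(3)]
  obtain f where f: "complex_mor n \<C> X R f" "f 0 = i 0" "f (Suc n) = i (Suc n)"
    using dist_lift[OF X R(3), of "i 0" "i (Suc n)"] i' R ei by auto
  obtain g where g: "complex_mor n \<C> Y R g" "g 0 = j 0" "g (Suc n) = j (Suc n)"
    using dist_lift[OF Y R(3), of "j 0" "j (Suc n)"] j' R ej by auto
  obtain f' where f': "complex_mor n \<C> R X f'" "f' 0 = p 0" "f' (Suc n) = p (Suc n)"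
    using dist_lift[OF R(3) X, of "p 0" "p (Suc n)"] p' R ep by auto
  obtain g' where g': "complex_mor n \<C> R Y g'" "g' 0 = q 0" "g' (Suc n) = q (Suc n)"
    using dist_lift[OF R(3) Y, of "q 0" "q (Suc n)"] q' R eq by auto
  have "complex_mor n \<C> S R (\<lambda>k. f k \<cdot> p k \<boxplus> g k \<cdot> q k)"
    by (intro complex_mor_madd complex_mor_comp[OF Sc _ Rc p f(1)] complex_mor_comp[OF Sc _ Rc q g(1)]
      Sc Rc distD(1)[OF X] distD(1)[OF Y])
  then have 1: "fixed_ends_mor n \<C> S R (\<lambda>k. f k \<cdot> p k \<boxplus> g k \<cdot> q k)"
    unfolding fixed_ends_mor_def using R f g id[of 0] id[of "Suc n"] by simp
  have "complex_mor n \<C> R S (\<lambda>k. i k \<cdot> f' k \<boxplus> j k \<cdot> g' k)"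
    by (intro complex_mor_madd complex_mor_comp[OF Rc _ Sc f'(1) i] complex_mor_comp[OF Rc _ Sc g'(1) j]
      Sc Rc distD(1)[OF X] distD(1)[OF Y])
  then have 2: "fixed_ends_mor n \<C> R S (\<lambda>k. i k \<cdot> f' k \<boxplus> j k \<cdot> g' k)"
    unfolding fixed_ends_mor_def using R f' g' id[of 0] id[of "Suc n"] by simp
  show ?thesis by (rule dist_transfer[OF R(3) Sc Sex 2 1])
qed

lemma dist_retract:
  assumes X: "dist X \<delta>"
    and S: "\<And>k. k \<le> Suc n \<Longrightarrow> Vx S k \<in> Obj \<C>"
      "\<And>k. k \<le> n \<Longrightarrow> Dif S k \<in> Mor \<C> (Vx S k) (Vx S (Suc k))"
    and \<sigma>: "\<sigma> \<in> carrier (Ext E (Vx S (Suc n)) (Vx S 0))"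
    and i: "complex_mor n \<C> X S i" and p: "complex_mor n \<C> S X p"
    and id: "\<And>k. k \<le> Suc n \<Longrightarrow> i k \<cdot> p k = IdM \<C> (Vx S k)"
    and ei: "push \<C> E (Vx X (Suc n)) (i 0) \<delta> = pull \<C> E (Vx S 0) (i (Suc n)) \<sigma>"
    and ep: "push \<C> E (Vx S (Suc n)) (p 0) \<sigma> = pull \<C> E (Vx X 0) (p (Suc n)) \<delta>"
  shows "dist S \<sigma>"
proof (rule dist_split_cover[where j = "\<lambda>k. zero_mor \<C> (Vx X k) (Vx S k)"
      and q = "\<lambda>k. zero_mor \<C> (Vx S k) (Vx X k)", OF X X S \<sigma> i p _ _ _ ei _ ep])
  note X' = is_complexD[OF distD(1)[OF X]]
  have S': "k \<le> n \<Longrightarrow> arr (Dif S k)" "k \<le> n \<Longrightarrow> dm (Dif S k) = Vx S k"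
    "k \<le> n \<Longrightarrow> cd (Dif S k) = Vx S (Suc k)" for k
    using S(2)[of k] by (auto simp: Mor_iff)
  show "complex_mor n \<C> X S (\<lambda>k. zero_mor \<C> (Vx X k) (Vx S k))"
    "complex_mor n \<C> S X (\<lambda>k. zero_mor \<C> (Vx S k) (Vx X k))"
    unfolding complex_mor_def Mor_iff using X' S(1) S' by simp_all
  show "i k \<cdot> p k \<boxplus> zero_mor \<C> (Vx X k) (Vx S k) \<cdot> zero_mor \<C> (Vx S k) (Vx X k) = IdM \<C> (Vx S k)"
    if "k \<le> Suc n" for k using id[OF that] X' S(1) that by simp
  show "push \<C> E (Vx X (Suc n)) (zero_mor \<C> (Vx X 0) (Vx S 0)) \<delta> =
    pull \<C> E (Vx S 0) (zero_mor \<C> (Vx X (Suc n)) (Vx S (Suc n))) \<sigma>"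
    "push \<C> E (Vx S (Suc n)) (zero_mor \<C> (Vx S 0) (Vx X 0)) \<sigma> =
    pull \<C> E (Vx X 0) (zero_mor \<C> (Vx S (Suc n)) (Vx X (Suc n))) \<delta>"
    using \<sigma> distD(2)[OF X] X' S(1) by simp_all
qed

text \<open>The chain \<open>A \<rightarrow> Z \<rightarrow> \<dots> \<rightarrow> Z \<rightarrow> B\<close> with zero differentials, to be used for a zero object \<open>Z\<close>.\<close>

definition flat_chain :: "'o \<Rightarrow> 'o \<Rightarrow> 'o \<Rightarrow> ('o, 'm) chain"
  where "flat_chain Z A B =
    (let V = \<lambda>i. if i = 0 then A else if i = Suc n then B else Z
     in \<lparr>Vx = V, Dif = \<lambda>i. zero_mor \<C> (V i) (V (Suc i))\<rparr>)"

lemma flat_chain_simps [simp]: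
  "Vx (flat_chain Z A B) 0 = A" "Vx (flat_chain Z A B) (Suc n) = B"
  "i \<noteq> 0 \<Longrightarrow> i \<noteq> Suc n \<Longrightarrow> Vx (flat_chain Z A B) i = Z"
  "Dif (flat_chain Z A B) i = zero_mor \<C> (Vx (flat_chain Z A B) i) (Vx (flat_chain Z A B) (Suc i))"
  unfolding flat_chain_def by (simp_all add: Let_def)

text \<open>As both outer differentials vanish, identities at the ends and zeros in between are morphisms of
  complexes in both directions, and no contraction of the middle part has to be constructed.\<close>

lemma dist_flat_chain:
  assumes X: "dist X \<delta>" and z: "Dif X 0 = zero_mor \<C> (Vx X 0) (Vx X 1)"
    "Dif X n = zero_mor \<C> (Vx X n) (Vx X (Suc n))" and Z: "zero_object \<C> Z"
  shows "dist (flat_chain Z (Vx X 0) (Vx X (Suc n))) \<delta>"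
proof -
  let ?Y = "flat_chain Z (Vx X 0) (Vx X (Suc n))"
  note X' = is_complexD[OF distD(1)[OF X]] and Zo = zero_objectD(1)[OF Z]
  have Yo: "k \<le> Suc n \<Longrightarrow> Vx ?Y k \<in> Obj \<C>" for k
    using X' Zo by (cases "k = 0"; cases "k = Suc n") auto
  have Yc: "is_complex n \<C> ?Y"
    unfolding is_complex_def Mor_iff using Yo Zo by simp
  have Yex: "right_exact n ?Y"
    unfolding right_exact_def
  proof (intro allI impI)
    fix i u assume u: "i < n" "arr u" "dm u = Vx ?Y (Suc i)"
    then have "zero_mor \<C> (Vx ?Y (Suc (Suc i))) (cd u) \<cdot> Dif ?Y (Suc i) = zero_mor \<C> Z (cd u)"
      using Yo Zo by simp
    also have "\<dots> = u"
      using u zero_objectD(2)[OF Z, of u] by simp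
    finally show "\<exists>w. arr w \<and> dm w = Vx ?Y (Suc (Suc i)) \<and> cd w = cd u \<and> u = w \<cdot> Dif ?Y (Suc i)"
      using u Yo by (intro exI[of _ "zero_mor \<C> (Vx ?Y (Suc (Suc i))) (cd u)"]) simp
  qed
  define f where "f = (\<lambda>(S :: ('o, 'm) chain) (T :: ('o, 'm) chain) k. if k = 0 \<or> k = Suc n then IdM \<C> (Vx S k) else zero_mor \<C> (Vx S k) (Vx T k))"
  have "fixed_ends_mor n \<C> S T (f S T)"
    if S: "is_complex n \<C> S" "Vx S 0 = Vx X 0" "Vx S (Suc n) = Vx X (Suc n)"
      "Dif S 0 = zero_mor \<C> (Vx S 0) (Vx S 1)" "Dif S n = zero_mor \<C> (Vx S n) (Vx S (Suc n))"
      and T: "is_complex n \<C> T" "Vx T 0 = Vx X 0" "Vx T (Suc n) = Vx X (Suc n)"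
      "Dif T 0 = zero_mor \<C> (Vx T 0) (Vx T 1)" "Dif T n = zero_mor \<C> (Vx T n) (Vx T (Suc n))"
    for S T
  proof -
    note S' = is_complexD[OF S(1)] and T' = is_complexD[OF T(1)]
    have ft: "arr (f S T k)" "dm (f S T k) = Vx S k" "cd (f S T k) = Vx T k" if "k \<le> Suc n" for k
      using that S T S' T' X'(1)[of 0] X'(1)[of "Suc n"] unfolding f_def by auto
    have "f S T (Suc k) \<cdot> Dif S k = Dif T k \<cdot> f S T k" if k: "k \<le> n" for k
    proof -
      consider "k = 0" | "k = n" | "0 < k" "k < n" using k by linarith
      then show ?thesis
      proof cases
        case 1
        then show ?thesis using k S(2-5) T(2-5) S' T' X' ft[of 0] ft[of 1] n_pos by simp
      next
        case 2
        then show ?thesis using S(2-5) T(2-5) S' T' X' ft[of n] ft[of "Suc n"] n_pos by simp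
      next
        case 3
        then show ?thesis using S' T' by (simp add: f_def)
      qed
    qed
    then show ?thesis
      unfolding fixed_ends_mor_def complex_mor_def Mor_iff using S T ft by (simp add: f_def)
  qed
  then have "fixed_ends_mor n \<C> X ?Y (f X ?Y)" "fixed_ends_mor n \<C> ?Y X (f ?Y X)"
    using distD(1)[OF X] Yc z by simp_all
  then show ?thesis using dist_transfer[OF X Yc Yex] by blast
qed

section \<open>Long exact sequences and lifts of morphisms\<close>

text \<open>The start of a mapping cocone: it is the part that splits in \<open>push_surj\<close> and that begins with a given
  morphism in \<open>angles_RN1_extend\<close>.\<close>

lemma cocone_start:
  assumes M: "mapping_cocone n \<C> X Y f M"
  obtains inc prj :: "nat \<Rightarrow> summand \<Rightarrow> 'm" where "Vx M 0 = Vx X 0" "Vx M (Suc n) = Vx Y n"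
    "biprod (Vx Y 0) (Vx X 1) (Vx M 1) (inc 1) (prj 1)"
    "prj 1 Fst \<cdot> Dif M 0 = f 0" "prj 1 Snd \<cdot> Dif M 0 = Dif X 0"
proof -
  define I where "I k = {i. i = Fst \<and> 1 \<le> k \<or> i = Snd \<and> k \<le> n}" for k :: nat
  let ?F = "\<lambda>k i. if i = Fst then Vx Y (k - 1) else Vx X k"
  let ?D = "\<lambda>k r c. case (r, c) of
          (Fst, Fst) \<Rightarrow> neg_mor \<C> (Vx Y (k - 1)) (Vx Y k) (Dif Y (k - 1))
        | (Fst, Snd) \<Rightarrow> f k
        | (Snd, Snd) \<Rightarrow> Dif X k
        | _ \<Rightarrow> zero_mor \<C> (Vx Y (k - 1)) (Vx X (k + 1))"
  obtain inc prj where b: "\<forall>k\<le>n + 1. biproduct \<C> (I k) (?F k) (Vx M k) (inc k) (prj k)"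
    and e: "\<forall>k\<in>{0, n + 1}. \<forall>i\<in>I k.
        Vx M k = ?F k i \<and> inc k i = IdM \<C> (?F k i) \<and> prj k i = IdM \<C> (?F k i)"
    and d: "\<forall>k\<le>n. Dif M k \<in> Mor \<C> (Vx M k) (Vx M (k + 1)) \<and>
        (\<forall>c\<in>I k. \<forall>r\<in>I (k + 1). prj (k + 1) r \<cdot> Dif M k \<cdot> inc k c = ?D k r c)"
    using M unfolding mapping_cocone_def block_chain_def I_def by blast
  have I: "Snd \<in> I 0" "I 1 = {Fst, Snd}" "Fst \<in> I (n + 1)" using n_pos by (auto simp: I_def)
  have b1: "biprod (Vx Y 0) (Vx X 1) (Vx M 1) (inc 1) (prj 1)"
    using b[rule_format, of 1] n_pos unfolding I by (simp cong: if_cong)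
  have e0: "Vx M 0 = Vx X 0" "inc 0 Snd = IdM \<C> (Vx X 0)" "Vx M (Suc n) = Vx Y n"
    using e[rule_format, of 0 Snd] e[rule_format, of "n + 1" Fst] I by simp_all
  have m: "prj 1 r \<cdot> Dif M 0 \<cdot> inc 0 Snd = ?D 0 r Snd" if "r \<in> {Fst, Snd}" for r
    using d[rule_format, of 0, THEN conjunct2] I that by auto
  have "arr (Dif M 0)" "dm (Dif M 0) = Vx M 0" "cd (Dif M 0) = Vx M 1"
    using d[rule_format, of 0, THEN conjunct1] by (auto simp: Mor_iff)
  then show thesis
    using that[of inc prj] b1 e0 m[of Fst] m[of Snd] biproduct_pairD[OF b1] by simp
qed

text \<open>The exact sequence of \<open>X\<close> is prolonged by \<open>\<C>(T, X\<^sub>n\<^sub>+\<^sub>1) \<rightarrow> E(T, X\<^sub>0) \<rightarrow> E(T, X\<^sub>1)\<close>. Let \<open>\<rho>\<close> be the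
  extension of \<open>X\<^sub>n\<^sub>+\<^sub>1 \<oplus> T\<close> with components \<open>\<delta>\<close> and \<open>\<epsilon>\<close>, and \<open>Y\<close> a realization of it. Since \<open>\<rho>\<close> pulls
  back to \<open>\<delta>\<close>, EA2 yields a cone of a map \<open>X \<rightarrow> Y\<close> whose extension is the push-out of \<open>\<rho>\<close> along the
  first differential of \<open>X\<close>. This push-out vanishes, as those of \<open>\<delta>\<close> and \<open>\<epsilon>\<close> do. So the inclusion of
  \<open>T\<close> lifts along the last differential of the cone, whose source is \<open>X\<^sub>n\<^sub>+\<^sub>1 \<oplus> Y\<^sub>n\<close>. On pulling back \<open>\<rho>\<close>,
  the contribution of \<open>Y\<^sub>n\<close> vanishes and \<open>\<epsilon>\<close> becomes a pull-back of \<open>\<delta>\<close>.\<close>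

lemma pull_surj:
  assumes X: "dist X \<delta>" and T: "T \<in> Obj \<C>" and \<epsilon>: "\<epsilon> \<in> carrier (Ext E T (Vx X 0))"
    and z: "push \<C> E T (Dif X 0) \<epsilon> = \<one>\<^bsub>Ext E T (Vx X 1)\<^esub>"
  obtains x where "arr x" "dm x = T" "cd x = Vx X (Suc n)" "pull \<C> E (Vx X 0) x \<delta> = \<epsilon>"
proof -
  let ?A = "Vx X 0" and ?C = "Vx X (Suc n)"
  note X' = is_complexD[OF distD(1)[OF X]]
  have o: "?A \<in> Obj \<C>" "?C \<in> Obj \<C>" "Vx X 1 \<in> Obj \<C>" "Vx X n \<in> Obj \<C>" using X' n_pos by simp_all
  obtain S i p where b: "biprod ?C T S i p"
    using has_biproducts[OF o(2) T] by blast
  note b' = biproduct_pairD[OF b]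
  let ?\<rho> = "pull \<C> E ?A (p Fst) \<delta> \<otimes>\<^bsub>Ext E S ?A\<^esub> pull \<C> E ?A (p Snd) \<epsilon>"
  note \<delta> = distD(2)[OF X]
  have \<rho>: "?\<rho> \<in> carrier (Ext E S ?A)"
    using b' o \<delta> \<epsilon> by simp
  have pF: "pull \<C> E ?A (i Fst) ?\<rho> = \<delta>" and pS: "pull \<C> E ?A (i Snd) ?\<rho> = \<epsilon>"
    using b' o \<delta> \<epsilon> T by (simp_all flip: pull_comp)
  obtain Y where Y: "Vx Y 0 = ?A" "Vx Y (Suc n) = S" "dist Y ?\<rho>"
    using dist_realized[OF b'(1) o(1) \<rho>] by blast
  have z\<rho>: "push \<C> E S (Dif X 0) ?\<rho> = \<one>\<^bsub>Ext E S (Vx X 1)\<^esub>"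
    using b' o \<delta> \<epsilon> X' distD(3)[OF X] z by (simp add: push_pull[where A' = "Vx X 1"])
  obtain f M where f: "complex_mor n \<C> X Y f" "f (Suc n) = i Fst"
    and M: "mapping_cone n \<C> X Y f M" "dist M \<one>\<^bsub>Ext E S (Vx X 1)\<^esub>"
    using EA2[OF \<rho>, of "i Fst" ?C X Y] b' X Y pF z\<rho> by (auto simp: Mor_iff)
  note Yc = distD(1)[OF Y(3)] note Y' = is_complexD[OF Yc] and f' = complex_morD[OF f(1)]
  note Mc = is_complexD[OF distD(1)[OF M(2)]]
  obtain inc prj where c: "cone_data n X Y f M inc prj"
    using cone_data_exists[OF n_pos distD(1)[OF X] Yc M(1)] .
  have Me: "Vx M 0 = Vx X 1" "Vx M (Suc n) = S"
    using c Y unfolding cone_data_def by auto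
  obtain m where m: "n = Suc m" using n_pos by (cases n) auto
  have bm: "biprod ?C (Vx Y n) (Vx M n) (inc n) (prj n)"
    using c unfolding cone_data_def m by auto
  note bm' = biproduct_pairD[OF bm]
  have dF: "Dif M n \<cdot> inc n Fst = i Fst"
    using c f(2) unfolding cone_data_def by auto
  have dS: "Dif M n \<cdot> inc n Snd = Dif Y n"
  proof -
    have "Dif M n \<cdot> inc n Snd = inc (Suc n) Snd \<cdot> Dif Y n" "inc (Suc n) Snd = IdM \<C> (Vx Y (Suc n))"
      using c unfolding cone_data_def m by blast+
    then show ?thesis using Y' by simp
  qed
  have "pull \<C> E (Vx M 0) (i Snd) \<one>\<^bsub>Ext E S (Vx X 1)\<^esub> = \<one>\<^bsub>Ext E (dm (i Snd)) (Vx M 0)\<^esub>"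
    using b' o Me by simp
  then obtain y where y: "arr y" "dm y = T" "cd y = Vx M n" "i Snd = Dif M n \<cdot> y"
    using pull_eq_one_factor[OF M(2), of "i Snd"] b' Me by metis
  have "i Snd = Dif M n \<cdot> (inc n Fst \<cdot> (prj n Fst \<cdot> y) \<boxplus> inc n Snd \<cdot> (prj n Snd \<cdot> y))"
    using y bm'(25)[of y] by simp
  also have "\<dots> = i Fst \<cdot> (prj n Fst \<cdot> y) \<boxplus> Dif Y n \<cdot> (prj n Snd \<cdot> y)"
    using y(1-3) bm'(1-15) Mc(1-4) comp_reassoc[OF dF, of "prj n Fst \<cdot> y"] comp_reassoc[OF dS, of "prj n Snd \<cdot> y"]
    by simp
  finally have iS: "i Snd = i Fst \<cdot> (prj n Fst \<cdot> y) \<boxplus> Dif Y n \<cdot> (prj n Snd \<cdot> y)" .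
  let ?x = "prj n Fst \<cdot> y" and ?w = "prj n Snd \<cdot> y"
  have x: "arr ?x" "dm ?x = T" "cd ?x = ?C" and w: "arr ?w" "dm ?w = T" "cd ?w = Vx Y n"
    using y(1-3) bm'(1-15) by simp_all
  have "\<epsilon> = pull \<C> E ?A (i Fst \<cdot> ?x \<boxplus> Dif Y n \<cdot> ?w) ?\<rho>"
    using pS iS by simp
  also have "\<dots> = pull \<C> E ?A ?x (pull \<C> E ?A (i Fst) ?\<rho>) \<otimes>\<^bsub>Ext E T ?A\<^esub> pull \<C> E ?A ?w (pull \<C> E ?A (Dif Y n) ?\<rho>)"
    using x w b'(1-15) Y'(1-4) Y \<rho> o by simp
  also have "\<dots> = pull \<C> E ?A ?x \<delta>"
    unfolding pF using distD(4)[OF Y(3)] Y x w o T \<delta> by simp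
  finally show thesis using that[of ?x] x by simp
qed

text \<open>The dual of the previous lemma, with a cocone and its first differential, which splits.\<close>

lemma push_surj:
  assumes Y: "dist Y \<delta>" and T: "T \<in> Obj \<C>" and \<epsilon>: "\<epsilon> \<in> carrier (Ext E (Vx Y (Suc n)) T)"
    and z: "pull \<C> E T (Dif Y n) \<epsilon> = \<one>\<^bsub>Ext E (Vx Y n) T\<^esub>"
  obtains x where "arr x" "dm x = Vx Y 0" "cd x = T" "push \<C> E (Vx Y (Suc n)) x \<delta> = \<epsilon>"
proof -
  let ?B = "Vx Y 0" and ?C = "Vx Y (Suc n)"
  note Y' = is_complexD[OF distD(1)[OF Y]]
  have o: "?B \<in> Obj \<C>" "?C \<in> Obj \<C>" "Vx Y 1 \<in> Obj \<C>" "Vx Y n \<in> Obj \<C>" using Y' n_pos by simp_all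
  obtain S i p where b: "biprod ?B T S i p"
    using has_biproducts[OF o(1) T] by blast
  note b' = biproduct_pairD[OF b]
  let ?\<rho> = "push \<C> E ?C (i Fst) \<delta> \<otimes>\<^bsub>Ext E ?C S\<^esub> push \<C> E ?C (i Snd) \<epsilon>"
  note \<delta> = distD(2)[OF Y]
  have \<rho>: "?\<rho> \<in> carrier (Ext E ?C S)"
    using b' o \<delta> \<epsilon> by simp
  have pF: "push \<C> E ?C (p Fst) ?\<rho> = \<delta>" and pS: "push \<C> E ?C (p Snd) ?\<rho> = \<epsilon>"
    using b' o \<delta> \<epsilon> T by (simp_all flip: push_comp)
  obtain X where X: "Vx X 0 = S" "Vx X (Suc n) = ?C" "dist X ?\<rho>"
    using dist_realized[OF o(2) b'(1) \<rho>] by blast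
  have z\<rho>: "pull \<C> E S (Dif Y n) ?\<rho> = \<one>\<^bsub>Ext E (Vx Y n) S\<^esub>"
    using b' o \<delta> \<epsilon> Y' distD(4)[OF Y] z
    by (simp flip: push_pull[where C' = "Vx Y n" and C = ?C and A' = S and A = ?B]
      push_pull[where C' = "Vx Y n" and C = ?C and A' = S and A = T])
  obtain f M where f: "complex_mor n \<C> X Y f" "f 0 = p Fst"
    and M: "mapping_cocone n \<C> X Y f M" "dist M \<one>\<^bsub>Ext E (Vx Y n) S\<^esub>"
    using EA2_op[OF \<rho>, of "p Fst" ?B X Y] b' X Y pF z\<rho> by (auto simp: Mor_iff)
  note Xc = distD(1)[OF X(3)] note X' = is_complexD[OF Xc] and f' = complex_morD[OF f(1)]
  note Mc = is_complexD[OF distD(1)[OF M(2)]]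
  obtain inc prj :: "nat \<Rightarrow> summand \<Rightarrow> 'm" where Me: "Vx M 0 = S" "Vx M (Suc n) = Vx Y n"
    and bm: "biprod ?B (Vx X 1) (Vx M 1) (inc 1) (prj 1)"
    and dF: "prj 1 Fst \<cdot> Dif M 0 = p Fst" and dS: "prj 1 Snd \<cdot> Dif M 0 = Dif X 0"
    using cocone_start[OF M(1)] unfolding X(1) f(2) by blast
  note bm' = biproduct_pairD[OF bm]
  have "push \<C> E (Vx M (Suc n)) (p Snd) \<one>\<^bsub>Ext E (Vx Y n) S\<^esub> = \<one>\<^bsub>Ext E (Vx M (Suc n)) (cd (p Snd))\<^esub>"
    using b' o Me by simp
  then obtain y where y: "arr y" "cd y = T" "dm y = Vx M 1" "p Snd = y \<cdot> Dif M 0"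
    using push_eq_one_factor[OF M(2), of "p Snd"] b' Me by metis
  let ?x = "y \<cdot> inc 1 Fst" and ?w = "y \<cdot> inc 1 Snd"
  have x: "arr ?x" "dm ?x = ?B" "cd ?x = T" and w: "arr ?w" "dm ?w = Vx X 1" "cd ?w = T"
    using y(1-3) bm'(1-15) by simp_all
  have "p Snd = (?x \<cdot> prj 1 Fst \<boxplus> ?w \<cdot> prj 1 Snd) \<cdot> Dif M 0"
    using y(1-4) bm'(26)[of y] by simp
  also have "\<dots> = ?x \<cdot> (prj 1 Fst \<cdot> Dif M 0) \<boxplus> ?w \<cdot> (prj 1 Snd \<cdot> Dif M 0)"
    using x w bm'(1-15) Mc(1-4) y(1-3) by simp
  finally have iS: "p Snd = ?x \<cdot> p Fst \<boxplus> ?w \<cdot> Dif X 0" unfolding dF dS .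
  then obtain x w where x: "arr x" "dm x = ?B" "cd x = T" and w: "arr w" "dm w = Vx X 1" "cd w = T"
    and iS: "p Snd = x \<cdot> p Fst \<boxplus> w \<cdot> Dif X 0"
    using x w by blast
  have "push \<C> E ?C (x \<cdot> p Fst \<boxplus> w \<cdot> Dif X 0) \<theta> =
      push \<C> E ?C x (push \<C> E ?C (p Fst) \<theta>) \<otimes>\<^bsub>Ext E ?C T\<^esub> push \<C> E ?C w (push \<C> E ?C (Dif X 0) \<theta>)"
    if "\<theta> \<in> carrier (Ext E ?C S)" for \<theta>
    using x w b'(1-15) X'(1-4) X that o by simp
  from this[OF \<rho>] have "\<epsilon> = push \<C> E ?C x \<delta> \<otimes>\<^bsub>Ext E ?C T\<^esub> push \<C> E ?C w (push \<C> E ?C (Dif X 0) ?\<rho>)"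
    unfolding pF iS[symmetric] pS .
  also have "\<dots> = push \<C> E ?C x \<delta>"
  proof -
    have "push \<C> E ?C (Dif X 0) ?\<rho> = \<one>\<^bsub>Ext E ?C (Vx X 1)\<^esub>"
      using distD(3)[OF X(3)] X by simp
    then show ?thesis using x w o T \<delta> by simp
  qed
  finally show thesis using that[of x] x by simp
qed

text \<open>The two candidates \<open>f\<^sub>1\<close> and \<open>v\<close> agree on the image of \<open>X\<^sub>0\<close>, so they differ by some \<open>h d\<close>. The
  corresponding homotopy replaces \<open>f\<^sub>1\<close> by \<open>v\<close> and modifies \<open>f\<^sub>2\<close>; for \<open>n = 1\<close> the latter is the
  component at the right end, but the pull-back of \<open>\<rho>\<close> does not change.\<close>

lemma lift_adjust:
  assumes X: "dist X \<delta>" and Y: "dist Y \<rho>" and f: "complex_mor n \<C> X Y f"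
    and v: "arr v" "dm v = Vx X 1" "cd v = Vx Y 1" "v \<cdot> Dif X 0 = Dif Y 0 \<cdot> f 0"
  obtains g where "complex_mor n \<C> X Y g" "g 0 = f 0" "g 1 = v"
    "pull \<C> E (Vx Y 0) (g (Suc n)) \<rho> = pull \<C> E (Vx Y 0) (f (Suc n)) \<rho>"
    "\<And>M. mapping_cone n \<C> X Y f M \<Longrightarrow> mapping_cone n \<C> X Y g M"
proof -
  note Xc = distD(1)[OF X] and Yc = distD(1)[OF Y]
  note X' = is_complexD[OF Xc] and Y' = is_complexD[OF Yc] and f' = complex_morD[OF f]
  let ?u = "v \<boxplus> \<boxminus> f 1"
  have u: "arr ?u" "dm ?u = Vx X (Suc 0)" "cd ?u = Vx Y 1"
    using v n_pos f' by simp_all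
  have "?u \<cdot> Dif X 0 = zero_mor \<C> (Vx X 0) (cd ?u)"
    using v n_pos f' X' Y' by simp
  then obtain h where h: "arr h" "dm h = Vx X 2" "cd h = Vx Y 1" "?u = h \<cdot> Dif X 1"
    using right_exactD[OF dist_right_exact[OF X], of 0 ?u] n_pos u
    by (metis One_nat_def Suc_1 less_le_trans zero_less_one)
  define g where "g = f(1 := f 1 \<boxplus> h \<cdot> Dif X 1, 2 := f 2 \<boxplus> Dif Y 1 \<cdot> h)"
  have v': "f 1 \<boxplus> h \<cdot> Dif X 1 = v"
    unfolding h(4)[symmetric] using v n_pos f' by (simp add: madd_ac madd_cancel)
  have h2: "dm h = Vx X (Suc (Suc 0))" "cd h = Vx Y (Suc 0)" using h by (simp_all add: numeral_2_eq_2)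
  have "pull \<C> E (Vx Y 0) (g (Suc n)) \<rho> = pull \<C> E (Vx Y 0) (f (Suc n)) \<rho>"
  proof (cases "n = 1")
    case True
    have d: "pull \<C> E (Vx Y 0) (Dif Y 1) \<rho> = \<one>\<^bsub>Ext E (Vx Y 1) (Vx Y 0)\<^esub>"
      using distD(4)[OF Y] True by simp
    have g: "g (Suc n) = f (Suc n) \<boxplus> Dif Y 1 \<cdot> h"
      unfolding g_def using True by (simp add: numeral_2_eq_2)
    show ?thesis
      unfolding g using True d h(1) h2 f' X' Y' distD(2)[OF Y] by simp
  next
    case False then show ?thesis using n_pos by (simp add: g_def)
  qed
  moreover have "complex_mor n \<C> X Y g" "\<And>M. mapping_cone n \<C> X Y f M \<Longrightarrow> mapping_cone n \<C> X Y g M"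
    using mapping_cone_homotopy_change(2)[OF n_pos Xc Yc f h(1-3)] mapping_cone_homotopy_change(1)[OF n_pos Xc Yc f h(1-3)]
    unfolding g_def by blast+
  moreover have "g 0 = f 0" "g 1 = v" unfolding g_def using v' by simp_all
  ultimately show thesis using that by blast
qed

text \<open>A commutative square at the beginning extends to a morphism of exangles, not just of complexes: the
  component at the right end exists by \<open>pull_surj\<close>, because \<open>u\<^sub>*\<delta>\<close> dies in \<open>E(-, Y\<^sub>1)\<close>.\<close>

lemma dist_lift_prescribed:
  assumes X: "dist X \<delta>" and Y: "dist Y \<rho>"
    and u: "arr u" "dm u = Vx X 0" "cd u = Vx Y 0" and v: "arr v" "dm v = Vx X 1" "cd v = Vx Y 1"
    and sq: "v \<cdot> Dif X 0 = Dif Y 0 \<cdot> u"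
  obtains f where "complex_mor n \<C> X Y f" "f 0 = u" "f 1 = v"
    "push \<C> E (Vx X (Suc n)) u \<delta> = pull \<C> E (Vx Y 0) (f (Suc n)) \<rho>"
proof -
  note X' = is_complexD[OF distD(1)[OF X]] and Y' = is_complexD[OF distD(1)[OF Y]]
  let ?C = "Vx X (Suc n)"
  have "push \<C> E ?C (Dif Y 0) (push \<C> E ?C u \<delta>) = push \<C> E ?C (v \<cdot> Dif X 0) \<delta>"
    unfolding sq using u X' Y' distD(2)[OF X] by simp
  also have "\<dots> = \<one>\<^bsub>Ext E ?C (Vx Y 1)\<^esub>"
    using v X' distD(2,3)[OF X] by simp
  finally have "push \<C> E ?C (Dif Y 0) (push \<C> E ?C u \<delta>) = \<one>\<^bsub>Ext E ?C (Vx Y 1)\<^esub>" .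
  moreover have "push \<C> E ?C u \<delta> \<in> carrier (Ext E ?C (Vx Y 0))"
    using u X' distD(2)[OF X] by simp
  ultimately obtain c where c: "arr c" "dm c = ?C" "cd c = Vx Y (Suc n)"
    "pull \<C> E (Vx Y 0) c \<rho> = push \<C> E ?C u \<delta>"
    using pull_surj[OF Y, of ?C] X' by auto
  obtain f where f: "complex_mor n \<C> X Y f" "f 0 = u" "f (Suc n) = c"
    using dist_lift[OF X Y u c(1-3)] c(4) by auto
  show thesis
    using lift_adjust[OF X Y f(1) v] f(2,3) sq c(4) that by metis
qed

text \<open>Lifts whose cone is distinguished exist by EA2, which offers no control over the component
  in degree \<open>1\<close>; this component can be corrected without changing the cone.\<close>

lemma good_lift_prescribed:
  assumes X: "dist X \<delta>" and Y: "dist Y \<rho>" and e: "Vx X 0 = Vx Y 0"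
    and v: "arr v" "dm v = Vx X 1" "cd v = Vx Y 1" "v \<cdot> Dif X 0 = Dif Y 0"
  obtains f M where "complex_mor n \<C> X Y f" "f 0 = IdM \<C> (Vx X 0)" "f 1 = v"
    "pull \<C> E (Vx Y 0) (f (Suc n)) \<rho> = \<delta>" "mapping_cone n \<C> X Y f M"
    "dist M (push \<C> E (Vx Y (Suc n)) (Dif X 0) \<rho>)"
proof -
  note X' = is_complexD[OF distD(1)[OF X]] and Y' = is_complexD[OF distD(1)[OF Y]]
  obtain f0 where f0: "complex_mor n \<C> X Y f0" "push \<C> E (Vx X (Suc n)) (IdM \<C> (Vx X 0)) \<delta> = pull \<C> E (Vx Y 0) (f0 (Suc n)) \<rho>"
    using dist_lift_prescribed[OF X Y, of "IdM \<C> (Vx X 0)" v] v X' Y' e by auto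
  note f0' = complex_morD[OF f0(1)]
  have p: "pull \<C> E (Vx Y 0) (f0 (Suc n)) \<rho> = \<delta>"
    using f0(2) X' distD(2)[OF X] by simp
  obtain g M where g: "complex_mor n \<C> X Y g" "g 0 = IdM \<C> (Vx Y 0)" "g (Suc n) = f0 (Suc n)"
    "mapping_cone n \<C> X Y g M" "dist M (push \<C> E (Vx Y (Suc n)) (Dif X 0) \<rho>)"
    using EA2[OF distD(2)[OF Y], of "f0 (Suc n)" "Vx X (Suc n)" X Y] f0' X Y e p by (auto simp: Mor_iff)
  show thesis
    using lift_adjust[OF X Y g(1) v(1-3)] g v(4) p e Y' that by (metis comp_id_arr(1) le0)
qed

end

section \<open>Suspension functors\<close>

context additive_category
begin

lemma additive_endofunctorD:
  assumes "additive_endofunctor \<C> \<Sigma>"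
  shows "A \<in> Obj \<C> \<Longrightarrow> FOb \<Sigma> A \<in> Obj \<C>" "A \<in> Obj \<C> \<Longrightarrow> FMor \<Sigma> (IdM \<C> A) = IdM \<C> (FOb \<Sigma> A)"
    "arr f \<Longrightarrow> arr (FMor \<Sigma> f)" "arr f \<Longrightarrow> dm (FMor \<Sigma> f) = FOb \<Sigma> (dm f)"
    "arr f \<Longrightarrow> cd (FMor \<Sigma> f) = FOb \<Sigma> (cd f)"
    "arr f \<Longrightarrow> arr g \<Longrightarrow> dm g = cd f \<Longrightarrow> FMor \<Sigma> (g \<cdot> f) = FMor \<Sigma> g \<cdot> FMor \<Sigma> f"
    "arr f \<Longrightarrow> arr g \<Longrightarrow> dm f = dm g \<Longrightarrow> cd f = cd g \<Longrightarrow> FMor \<Sigma> (f \<boxplus> g) = FMor \<Sigma> f \<boxplus> FMor \<Sigma> g"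
    "A \<in> Obj \<C> \<Longrightarrow> B \<in> Obj \<C> \<Longrightarrow> FMor \<Sigma> (zero_mor \<C> A B) = zero_mor \<C> (FOb \<Sigma> A) (FOb \<Sigma> B)"
    "arr f \<Longrightarrow> FMor \<Sigma> (\<boxminus> f) = \<boxminus> FMor \<Sigma> f"
proof -
  note F = assms[unfolded additive_endofunctor_def]
  show o: "A \<in> Obj \<C> \<Longrightarrow> FOb \<Sigma> A \<in> Obj \<C>" "A \<in> Obj \<C> \<Longrightarrow> FMor \<Sigma> (IdM \<C> A) = IdM \<C> (FOb \<Sigma> A)" for A
    using F by auto
  have h: "FMor \<Sigma> \<in> hom (Hom \<C> A B) (Hom \<C> (FOb \<Sigma> A) (FOb \<Sigma> B))" if "A \<in> Obj \<C>" "B \<in> Obj \<C>" for A B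
    using F that by auto
  have m: "FMor \<Sigma> f \<in> Mor \<C> (FOb \<Sigma> (dm f)) (FOb \<Sigma> (cd f))" if "arr f" for f
    using h[of "dm f" "cd f"] that by (auto simp: hom_def Mor_iff)
  show a: "arr f \<Longrightarrow> arr (FMor \<Sigma> f)" "arr f \<Longrightarrow> dm (FMor \<Sigma> f) = FOb \<Sigma> (dm f)"
    "arr f \<Longrightarrow> cd (FMor \<Sigma> f) = FOb \<Sigma> (cd f)" for f
    using m[of f] by (auto simp: Mor_iff)
  show "arr f \<Longrightarrow> arr g \<Longrightarrow> dm g = cd f \<Longrightarrow> FMor \<Sigma> (g \<cdot> f) = FMor \<Sigma> g \<cdot> FMor \<Sigma> f"
    using F arr_mor[of f] arr_mor[of g] by metis
  show add: "FMor \<Sigma> (f \<boxplus> g) = FMor \<Sigma> f \<boxplus> FMor \<Sigma> g"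
    if "arr f" "arr g" "dm f = dm g" "cd f = cd g" for f g
    using h[of "dm g" "cd g"] that a unfolding hom_def by (auto simp: Mor_iff madd_def)
  show zero: "FMor \<Sigma> (zero_mor \<C> A B) = zero_mor \<C> (FOb \<Sigma> A) (FOb \<Sigma> B)" if "A \<in> Obj \<C>" "B \<in> Obj \<C>" for A B
    using h[OF that] madd_group(2)[OF that] madd_group(2)[OF o(1)[OF that(1)] o(1)[OF that(2)]]
    by (metis hom_one)
  show "FMor \<Sigma> (\<boxminus> f) = \<boxminus> FMor \<Sigma> f" if "arr f"
    using add[of f "\<boxminus> f"] that a zero[of "dm f" "cd f"] by (intro mneg_unique) auto
qed

lemma FOb_zero_object:
  assumes "additive_endofunctor \<C> \<Sigma>" "zero_object \<C> Z"
  shows "zero_object \<C> (FOb \<Sigma> Z)"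
  using assms(2) additive_endofunctorD(1,2,8)[OF assms(1), of Z] unfolding zero_object_iff by metis

end

context additive_bifunctor
begin

text \<open>The Yoneda argument: if every functor \<open>E(-, A)\<close> is represented by an object \<open>S A\<close> with universal
  extension \<open>\<eta> A\<close>, then \<open>S\<close> extends to a functor, whose value \<open>F f\<close> is determined by
  \<open>(F f)\<^sup>*\<eta> = f\<^sub>*\<eta>\<close>. It is fully faithful as soon as \<open>\<eta> A\<close> is also universal for \<open>E(S A, -)\<close>.\<close>

lemma suspension_of_universal_extensions:
  assumes So: "\<And>A. A \<in> Obj \<C> \<Longrightarrow> S A \<in> Obj \<C>"
    and \<eta>: "\<And>A. A \<in> Obj \<C> \<Longrightarrow> \<eta> A \<in> carrier (Ext E (S A) A)"
    and pull_bij: "\<And>A T. A \<in> Obj \<C> \<Longrightarrow> T \<in> Obj \<C> \<Longrightarrow>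
      bij_betw (\<lambda>c. pull \<C> E A c (\<eta> A)) (Mor \<C> T (S A)) (carrier (Ext E T A))"
    and push_bij: "\<And>A T. A \<in> Obj \<C> \<Longrightarrow> T \<in> Obj \<C> \<Longrightarrow>
      bij_betw (\<lambda>a. push \<C> E (S A) a (\<eta> A)) (Mor \<C> A T) (carrier (Ext E (S A) T))"
  shows "\<exists>\<Sigma> \<Phi>. additive_endofunctor \<C> \<Sigma> \<and> fully_faithful \<C> \<Sigma> \<and> bifunctor_iso \<C> E \<Sigma> \<Phi>"
proof -
  have pull_inj: "c = c'"
    if "A \<in> Obj \<C>" "arr c" "arr c'" "dm c = dm c'" "cd c = S A" "cd c' = S A"
      "pull \<C> E A c (\<eta> A) = pull \<C> E A c' (\<eta> A)" for c c' A
    using bij_betw_imp_inj_on[OF pull_bij[of A "dm c"]] that by (auto simp: inj_on_def Mor_iff)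
  have push_inj: "a = a'"
    if "A \<in> Obj \<C>" "arr a" "arr a'" "cd a = cd a'" "dm a = A" "dm a' = A"
      "push \<C> E (S A) a (\<eta> A) = push \<C> E (S A) a' (\<eta> A)" for a a' A
    using bij_betw_imp_inj_on[OF push_bij[of A "cd a"]] that by (auto simp: inj_on_def Mor_iff)
  have pull_ex: "\<exists>c. arr c \<and> dm c = T \<and> cd c = S A \<and> pull \<C> E A c (\<eta> A) = \<epsilon>"
    if A: "A \<in> Obj \<C>" and T: "T \<in> Obj \<C>" and \<epsilon>: "\<epsilon> \<in> carrier (Ext E T A)" for T A \<epsilon>
  proof -
    have "\<epsilon> \<in> (\<lambda>c. pull \<C> E A c (\<eta> A)) ` Mor \<C> T (S A)"
      using bij_betw_imp_surj_on[OF pull_bij[OF A T]] \<epsilon> by simp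
    then show ?thesis by (auto simp: Mor_iff)
  qed
  have push_ex: "\<exists>a. arr a \<and> dm a = A \<and> cd a = T \<and> push \<C> E (S A) a (\<eta> A) = \<epsilon>"
    if A: "A \<in> Obj \<C>" and T: "T \<in> Obj \<C>" and \<epsilon>: "\<epsilon> \<in> carrier (Ext E (S A) T)" for T A \<epsilon>
  proof -
    have "\<epsilon> \<in> (\<lambda>a. push \<C> E (S A) a (\<eta> A)) ` Mor \<C> A T"
      using bij_betw_imp_surj_on[OF push_bij[OF A T]] \<epsilon> by simp
    then show ?thesis by (auto simp: Mor_iff)
  qed
  define \<Phi> where "\<Phi> C A \<delta> = (THE c. arr c \<and> dm c = C \<and> cd c = S A \<and> pull \<C> E A c (\<eta> A) = \<delta>)" for C A \<delta>
  define F where "F f = \<Phi> (S (dm f)) (cd f) (push \<C> E (S (dm f)) f (\<eta> (dm f)))" for f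
  have \<Phi>_eq: "\<Phi> C A \<delta> = c" if "A \<in> Obj \<C>" "arr c" "dm c = C" "cd c = S A" "pull \<C> E A c (\<eta> A) = \<delta>" for C A \<delta> c
    unfolding \<Phi>_def using that pull_inj[of A] by (intro the_equality) auto
  have \<Phi>: "arr (\<Phi> C A \<delta>)" "dm (\<Phi> C A \<delta>) = C" "cd (\<Phi> C A \<delta>) = S A" "pull \<C> E A (\<Phi> C A \<delta>) (\<eta> A) = \<delta>"
    if "C \<in> Obj \<C>" "A \<in> Obj \<C>" "\<delta> \<in> carrier (Ext E C A)" for C A \<delta>
    using pull_ex[OF that(2,1,3)] \<Phi>_eq[of A _ C \<delta>] that by auto
  have F: "arr (F f)" "dm (F f) = S (dm f)" "cd (F f) = S (cd f)"
    "pull \<C> E (cd f) (F f) (\<eta> (cd f)) = push \<C> E (S (dm f)) f (\<eta> (dm f))" if "arr f" for f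
    unfolding F_def using \<Phi>[of "S (dm f)" "cd f" "push \<C> E (S (dm f)) f (\<eta> (dm f))"] that So \<eta> by simp_all
  have F_eq: "F f = g" if "arr f" "arr g" "dm g = S (dm f)" "cd g = S (cd f)"
    "pull \<C> E (cd f) g (\<eta> (cd f)) = push \<C> E (S (dm f)) f (\<eta> (dm f))" for f g
    unfolding F_def using that by (intro \<Phi>_eq) auto
  let ?\<Sigma> = "\<lparr>FOb = S, FMor = F\<rparr>"
  have "additive_endofunctor \<C> ?\<Sigma>"
    unfolding additive_endofunctor_def
  proof (intro conjI ballI allI)
    fix A assume "A \<in> Obj \<C>"
    then show "FOb ?\<Sigma> A \<in> Obj \<C>" "FMor ?\<Sigma> (IdM \<C> A) = IdM \<C> (FOb ?\<Sigma> A)"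
      using So \<eta> by (simp_all add: F_eq)
  next
    fix A B assume "A \<in> Obj \<C>" "B \<in> Obj \<C>"
    have "F (f \<boxplus> g) = F f \<boxplus> F g" if "arr f" "arr g" "dm f = dm g" "cd f = cd g" for f g
      using that F[of f] F[of g] \<eta> So by (intro F_eq) simp_all
    then show "FMor ?\<Sigma> \<in> hom (Hom \<C> A B) (Hom \<C> (FOb ?\<Sigma> A) (FOb ?\<Sigma> B))"
      using F unfolding hom_def by (auto simp: Mor_iff add_mor_eq)
  next
    fix A B D f g assume "f \<in> Mor \<C> A B" "g \<in> Mor \<C> B D"
    then have fg: "arr f" "arr g" "dm g = cd f" by (auto simp: Mor_iff)
    have "pull \<C> E (cd g) (F g \<cdot> F f) (\<eta> (cd g)) = pull \<C> E (cd g) (F f) (push \<C> E (S (dm g)) g (\<eta> (dm g)))"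
      using fg F[of g] F[of f] \<eta> So by simp
    also have "\<dots> = push \<C> E (S (dm f)) g (pull \<C> E (dm g) (F f) (\<eta> (dm g)))"
      using fg F[of f] \<eta> So by (subst push_pull[where C = "S (dm g)" and A' = "cd g"]) simp_all
    also have "\<dots> = push \<C> E (S (dm f)) (g \<cdot> f) (\<eta> (dm f))"
      using fg F[of f] \<eta> So by simp
    finally have "F (g \<cdot> f) = F g \<cdot> F f"
      using fg F(1-3)[of g] F(1-3)[of f] by (intro F_eq) simp_all
    then show "FMor ?\<Sigma> (g \<cdot> f) = FMor ?\<Sigma> g \<cdot> FMor ?\<Sigma> f" by simp
  qed
  moreover have "fully_faithful \<C> ?\<Sigma>"
    unfolding fully_faithful_def
  proof (intro ballI bij_betw_imageI)
    fix A B assume o: "A \<in> Obj \<C>" "B \<in> Obj \<C>"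
    show "inj_on (FMor ?\<Sigma>) (Mor \<C> A B)"
    proof (rule inj_onI)
      fix f g assume "f \<in> Mor \<C> A B" "g \<in> Mor \<C> A B" "FMor ?\<Sigma> f = FMor ?\<Sigma> g"
      then show "f = g" using F(4)[of f] F(4)[of g] o by (intro push_inj[of A]) (auto simp: Mor_iff)
    qed
    show "FMor ?\<Sigma> ` Mor \<C> A B = Mor \<C> (FOb ?\<Sigma> A) (FOb ?\<Sigma> B)"
    proof
      show "FMor ?\<Sigma> ` Mor \<C> A B \<subseteq> Mor \<C> (FOb ?\<Sigma> A) (FOb ?\<Sigma> B)"
        using F by (auto simp: Mor_iff)
      show "Mor \<C> (FOb ?\<Sigma> A) (FOb ?\<Sigma> B) \<subseteq> FMor ?\<Sigma> ` Mor \<C> A B"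
      proof
        fix g assume "g \<in> Mor \<C> (FOb ?\<Sigma> A) (FOb ?\<Sigma> B)"
        then have g: "arr g" "dm g = S A" "cd g = S B" by (auto simp: Mor_iff)
        obtain a where a: "arr a" "dm a = A" "cd a = B" "push \<C> E (S A) a (\<eta> A) = pull \<C> E B g (\<eta> B)"
          using push_ex[OF o, of "pull \<C> E B g (\<eta> B)"] g \<eta> o by auto
        then have "F a = g" using g by (intro F_eq) simp_all
        then show "g \<in> FMor ?\<Sigma> ` Mor \<C> A B" using a by (auto simp: Mor_iff)
      qed
    qed
  qed
  moreover have "bifunctor_iso \<C> E ?\<Sigma> \<Phi>"
    unfolding bifunctor_iso_def
  proof (intro conjI ballI allI)
    fix C A assume o: "C \<in> Obj \<C>" "A \<in> Obj \<C>"
    have "\<Phi> C A (\<delta> \<otimes>\<^bsub>Ext E C A\<^esub> \<epsilon>) = \<Phi> C A \<delta> \<boxplus> \<Phi> C A \<epsilon>"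
      if "\<delta> \<in> carrier (Ext E C A)" "\<epsilon> \<in> carrier (Ext E C A)" for \<delta> \<epsilon>
      using o \<Phi>[OF o that(1)] \<Phi>[OF o that(2)] \<eta> by (intro \<Phi>_eq) simp_all
    then have "\<Phi> C A \<in> hom (Ext E C A) (Hom \<C> C (S A))"
      unfolding hom_def using \<Phi>[OF o] by (auto simp: Mor_iff add_mor_eq)
    moreover have "bij_betw (\<Phi> C A) (carrier (Ext E C A)) (Mor \<C> C (S A))"
    proof (rule bij_betwI[where g = "\<lambda>c. pull \<C> E A c (\<eta> A)"])
      show "\<Phi> C A \<in> carrier (Ext E C A) \<rightarrow> Mor \<C> C (S A)"
        using \<Phi>[OF o] by (auto simp: Mor_iff)
      show "(\<lambda>c. pull \<C> E A c (\<eta> A)) \<in> Mor \<C> C (S A) \<rightarrow> carrier (Ext E C A)"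
        using o \<eta> by (auto simp: Mor_iff)
      show "pull \<C> E A (\<Phi> C A \<delta>) (\<eta> A) = \<delta>" if "\<delta> \<in> carrier (Ext E C A)" for \<delta>
        using \<Phi>[OF o that] by simp
      show "\<Phi> C A (pull \<C> E A c (\<eta> A)) = c" if "c \<in> Mor \<C> C (S A)" for c
        using that o by (intro \<Phi>_eq) (auto simp: Mor_iff)
    qed
    ultimately show "\<Phi> C A \<in> iso (Ext E C A) (Hom \<C> C (FOb ?\<Sigma> A))"
      by (simp add: iso_def)
  next
    fix C C' A A' c a \<delta> assume "c \<in> Mor \<C> C' C" "a \<in> Mor \<C> A A'" and \<delta>: "\<delta> \<in> carrier (Ext E C A)"
    then have ca: "arr c" "dm c = C'" "cd c = C" "arr a" "dm a = A" "cd a = A'" by (auto simp: Mor_iff)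
    then have o: "C \<in> Obj \<C>" "A \<in> Obj \<C>" "A' \<in> Obj \<C>" "C' \<in> Obj \<C>" using arr_Obj by blast+
    note p = \<Phi>[OF o(1,2) \<delta>]
    have "pull \<C> E A' (F a \<cdot> (\<Phi> C A \<delta> \<cdot> c)) (\<eta> A') =
      pull \<C> E A' c (pull \<C> E A' (\<Phi> C A \<delta>) (push \<C> E (S A) a (\<eta> A)))"
      using F[of a] p(1-3) ca o \<eta> So by simp
    also have "pull \<C> E A' (\<Phi> C A \<delta>) (push \<C> E (S A) a (\<eta> A)) = push \<C> E C a \<delta>"
      using push_pull[of a "\<Phi> C A \<delta>" A A' C "S A" "\<eta> A"] p ca o \<eta> by simp
    also have "pull \<C> E A' c (push \<C> E C a \<delta>) = EMap E c a \<delta>"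
      using emap_eq_pull_push[of a c A' C \<delta>] ca \<delta> by simp
    finally show "\<Phi> C' A' (EMap E c a \<delta>) = FMor ?\<Sigma> a \<cdot> \<Phi> C A \<delta> \<cdot> c"
      using F[of a] p(1-3) ca o by (intro \<Phi>_eq) simp_all
  qed
  ultimately show ?thesis by blast
qed

end

context n_exangulated
begin

text \<open>If the middle terms next to the ends vanish, then both long exact sequences of the exangle break
  up into isomorphisms.\<close>

lemma bij_betw_pull:
  assumes X: "dist X \<delta>" and Z: "zero_object \<C> (Vx X 1)" "zero_object \<C> (Vx X n)" and T: "T \<in> Obj \<C>"
  shows "bij_betw (\<lambda>c. pull \<C> E (Vx X 0) c \<delta>) (Mor \<C> T (Vx X (Suc n))) (carrier (Ext E T (Vx X 0)))"
proof (rule bij_betw_imageI)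
  let ?A = "Vx X 0" and ?C = "Vx X (Suc n)"
  note X' = is_complexD[OF distD(1)[OF X]] and \<delta> = distD(2)[OF X]
  have o: "?A \<in> Obj \<C>" "?C \<in> Obj \<C>" using X' by simp_all
  show "inj_on (\<lambda>c. pull \<C> E ?A c \<delta>) (Mor \<C> T ?C)"
  proof (rule inj_onI)
    fix c c' assume "c \<in> Mor \<C> T ?C" "c' \<in> Mor \<C> T ?C" and e: "pull \<C> E ?A c \<delta> = pull \<C> E ?A c' \<delta>"
    then have c: "arr c" "dm c = T" "cd c = ?C" "arr c'" "dm c' = T" "cd c' = ?C" by (simp_all add: Mor_iff)
    have "pull \<C> E ?A (c \<boxplus> \<boxminus> c') \<delta> = pull \<C> E ?A (c' \<boxplus> \<boxminus> c') \<delta>"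
      using c e o \<delta> by (simp del: madd_neg)
    also have "\<dots> = \<one>\<^bsub>Ext E (dm (c \<boxplus> \<boxminus> c')) ?A\<^esub>" using c o \<delta> T by simp
    finally obtain y where y: "arr y" "dm y = dm (c \<boxplus> \<boxminus> c')" "cd y = Vx X n" "c \<boxplus> \<boxminus> c' = Dif X n \<cdot> y"
      using pull_eq_one_factor[OF X, of "c \<boxplus> \<boxminus> c'"] c by auto
    have "y = zero_mor \<C> T (Vx X n)"
      using zero_objectD(3)[OF Z(2) y(1,3)] y(2) c by simp
    then have "c \<boxplus> \<boxminus> c' = zero_mor \<C> T ?C"
      using y(4) X' T by simp
    then show "c = c'" using madd_eq_zero_iff[of c c'] c by simp
  qed
  show "(\<lambda>c. pull \<C> E ?A c \<delta>) ` Mor \<C> T ?C = carrier (Ext E T ?A)"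
  proof
    show "(\<lambda>c. pull \<C> E ?A c \<delta>) ` Mor \<C> T ?C \<subseteq> carrier (Ext E T ?A)"
      using o \<delta> by (auto simp: Mor_iff)
    have d: "Dif X 0 = zero_mor \<C> ?A (Vx X 1)"
      using zero_objectD(3)[OF Z(1), of "Dif X 0"] X' by simp
    show "carrier (Ext E T ?A) \<subseteq> (\<lambda>c. pull \<C> E ?A c \<delta>) ` Mor \<C> T ?C"
    proof
      fix \<epsilon> assume \<epsilon>: "\<epsilon> \<in> carrier (Ext E T ?A)"
      then have "push \<C> E T (Dif X 0) \<epsilon> = \<one>\<^bsub>Ext E T (Vx X 1)\<^esub>"
        unfolding d using o T X'(1)[of 1] by simp
      then obtain x where "arr x" "dm x = T" "cd x = ?C" "pull \<C> E ?A x \<delta> = \<epsilon>"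
        using pull_surj[OF X T \<epsilon>] by blast
      then show "\<epsilon> \<in> (\<lambda>c. pull \<C> E ?A c \<delta>) ` Mor \<C> T ?C" by (auto simp: Mor_iff)
    qed
  qed
qed

lemma bij_betw_push:
  assumes X: "dist X \<delta>" and Z: "zero_object \<C> (Vx X 1)" "zero_object \<C> (Vx X n)" and T: "T \<in> Obj \<C>"
  shows "bij_betw (\<lambda>a. push \<C> E (Vx X (Suc n)) a \<delta>) (Mor \<C> (Vx X 0) T) (carrier (Ext E (Vx X (Suc n)) T))"
proof (rule bij_betw_imageI)
  let ?A = "Vx X 0" and ?C = "Vx X (Suc n)"
  note X' = is_complexD[OF distD(1)[OF X]] and \<delta> = distD(2)[OF X]
  have o: "?A \<in> Obj \<C>" "?C \<in> Obj \<C>" using X' by simp_all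
  show "inj_on (\<lambda>a. push \<C> E ?C a \<delta>) (Mor \<C> ?A T)"
  proof (rule inj_onI)
    fix a a' assume "a \<in> Mor \<C> ?A T" "a' \<in> Mor \<C> ?A T" and e: "push \<C> E ?C a \<delta> = push \<C> E ?C a' \<delta>"
    then have a: "arr a" "dm a = ?A" "cd a = T" "arr a'" "dm a' = ?A" "cd a' = T" by (simp_all add: Mor_iff)
    have "push \<C> E ?C (a \<boxplus> \<boxminus> a') \<delta> = push \<C> E ?C (a' \<boxplus> \<boxminus> a') \<delta>"
      using a e o \<delta> by (simp del: madd_neg)
    also have "\<dots> = \<one>\<^bsub>Ext E ?C (cd (a \<boxplus> \<boxminus> a'))\<^esub>" using a o \<delta> T by simp
    finally obtain y where y: "arr y" "cd y = cd (a \<boxplus> \<boxminus> a')" "dm y = Vx X 1" "a \<boxplus> \<boxminus> a' = y \<cdot> Dif X 0"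
      using push_eq_one_factor[OF X, of "a \<boxplus> \<boxminus> a'"] a by auto
    have "y = zero_mor \<C> (Vx X 1) T"
      using zero_objectD(2)[OF Z(1) y(1,3)] y(2) a by simp
    then have "a \<boxplus> \<boxminus> a' = zero_mor \<C> ?A T"
      using y(4) X' T by simp
    then show "a = a'" using madd_eq_zero_iff[of a a'] a by simp
  qed
  show "(\<lambda>a. push \<C> E ?C a \<delta>) ` Mor \<C> ?A T = carrier (Ext E ?C T)"
  proof
    show "(\<lambda>a. push \<C> E ?C a \<delta>) ` Mor \<C> ?A T \<subseteq> carrier (Ext E ?C T)"
      using o \<delta> by (auto simp: Mor_iff)
    have d: "Dif X n = zero_mor \<C> (Vx X n) ?C"
      using zero_objectD(2)[OF Z(2), of "Dif X n"] X' by simp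
    show "carrier (Ext E ?C T) \<subseteq> (\<lambda>a. push \<C> E ?C a \<delta>) ` Mor \<C> ?A T"
    proof
      fix \<epsilon> assume \<epsilon>: "\<epsilon> \<in> carrier (Ext E ?C T)"
      then have "pull \<C> E T (Dif X n) \<epsilon> = \<one>\<^bsub>Ext E (Vx X n) T\<^esub>"
        unfolding d using o T X'(1)[of n] by simp
      then obtain x where "arr x" "dm x = ?A" "cd x = T" "push \<C> E ?C x \<delta> = \<epsilon>"
        using push_surj[OF X T \<epsilon>] by blast
      then show "\<epsilon> \<in> (\<lambda>a. push \<C> E ?C a \<delta>) ` Mor \<C> ?A T" by (auto simp: Mor_iff)
    qed
  qed
qed

lemma suspension_exists:
  assumes triv: "\<forall>C\<in>Obj \<C>. \<forall>Z. zero_object \<C> Z \<longrightarrow> trivial_inflation n \<C> E \<s> (zero_mor \<C> C Z)"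
  shows "\<exists>\<Sigma> \<Phi>. additive_endofunctor \<C> \<Sigma> \<and> fully_faithful \<C> \<Sigma> \<and> bifunctor_iso \<C> E \<Sigma> \<Phi>"
proof -
  obtain Z where Z: "zero_object \<C> Z" using has_zero_object by blast
  have "\<forall>C\<in>Obj \<C>. \<exists>p. dist (fst p) (snd p) \<and> Vx (fst p) 0 = C \<and>
      zero_object \<C> (Vx (fst p) 1) \<and> zero_object \<C> (Vx (fst p) n)"
  proof
    fix C assume C: "C \<in> Obj \<C>"
    obtain X \<delta> where X: "dist X \<delta>" "Dif X 0 = zero_mor \<C> C Z" "\<forall>i\<in>{1..n}. zero_object \<C> (Vx X i)"
      using triv[rule_format, OF C Z] unfolding trivial_inflation_def by blast
    have "Vx X 0 = C"
      using is_complexD(3)[OF distD(1)[OF X(1)], of 0] X(2) C zero_objectD(1)[OF Z] by simp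
    then show "\<exists>p. dist (fst p) (snd p) \<and> Vx (fst p) 0 = C \<and>
        zero_object \<C> (Vx (fst p) 1) \<and> zero_object \<C> (Vx (fst p) n)"
      using X n_pos by (intro exI[of _ "(X, \<delta>)"]) simp
  qed
  then obtain p where p: "\<forall>C\<in>Obj \<C>. dist (fst (p C)) (snd (p C)) \<and> Vx (fst (p C)) 0 = C \<and>
      zero_object \<C> (Vx (fst (p C)) 1) \<and> zero_object \<C> (Vx (fst (p C)) n)"
    by (rule bchoice[THEN exE])
  show ?thesis
  proof (rule suspension_of_universal_extensions[of "\<lambda>A. Vx (fst (p A)) (Suc n)" "\<lambda>A. snd (p A)"])
    fix A T assume A: "A \<in> Obj \<C>" and T: "T \<in> Obj \<C>"
    then have X: "dist (fst (p A)) (snd (p A))" "Vx (fst (p A)) 0 = A"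
      "zero_object \<C> (Vx (fst (p A)) 1)" "zero_object \<C> (Vx (fst (p A)) n)" using p by auto
    show "bij_betw (\<lambda>c. pull \<C> E A c (snd (p A))) (Mor \<C> T (Vx (fst (p A)) (Suc n))) (carrier (Ext E T A))"
      using bij_betw_pull[OF X(1,3,4) T] unfolding X(2) .
    show "bij_betw (\<lambda>a. push \<C> E (Vx (fst (p A)) (Suc n)) a (snd (p A))) (Mor \<C> A T)
      (carrier (Ext E (Vx (fst (p A)) (Suc n)) T))"
      using bij_betw_push[OF X(1,3,4) T] unfolding X(2) .
  next
    fix A assume A: "A \<in> Obj \<C>"
    then have X: "dist (fst (p A)) (snd (p A))" "Vx (fst (p A)) 0 = A" using p by auto
    show "Vx (fst (p A)) (Suc n) \<in> Obj \<C>" using is_complexD(1)[OF distD(1)[OF X(1)]] by simp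
    show "snd (p A) \<in> carrier (Ext E (Vx (fst (p A)) (Suc n)) A)" using distD(2)[OF X(1)] unfolding X(2) .
  qed
qed

lemma trivial_inflation_of_flat_chain:
  assumes "dist (flat_chain Z A B) \<delta>" "zero_object \<C> Z"
  shows "trivial_inflation n \<C> E \<s> (zero_mor \<C> A Z)"
  unfolding trivial_inflation_def
  using assms n_pos by (intro exI[of _ "flat_chain Z A B"] exI[of _ \<delta>]) simp

text \<open>Rotating \<open>0 \<rightarrow> A \<rightarrow> A \<rightarrow> 0 \<rightarrow> \<dots> \<rightarrow> 0\<close> twice gives an angle \<open>A \<rightarrow> 0 \<rightarrow> \<dots> \<rightarrow> \<Sigma>0 \<rightarrow> \<Sigma>A\<close>, and the
  given structure makes it distinguished for some extension. In degree \<open>n\<close> it has \<open>\<Sigma>0\<close> instead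
  of the chosen zero object, hence the passage to the flat chain.\<close>

lemma trivial_inflation_of_induced:
  assumes R: "right_angulated_category \<C> n \<Sigma> \<Theta>" and ind: "induced_by n \<C> E \<s> \<Sigma> \<Theta>"
    and A: "A \<in> Obj \<C>" and Z: "zero_object \<C> Z"
  shows "trivial_inflation n \<C> E \<s> (zero_mor \<C> A Z)"
proof -
  interpret R: right_angulated_category \<C> n \<Sigma> \<Theta> by (rule R)
  obtain \<Phi> where iso: "bifunctor_iso \<C> E \<Sigma> \<Phi>"
    and d: "\<And>C A \<delta> X. C \<in> Obj \<C> \<Longrightarrow> A \<in> Obj \<C> \<Longrightarrow> \<delta> \<in> carrier (Ext E C A) \<Longrightarrow> X \<in> \<Theta> \<Longrightarrow> Vx X 0 = A \<Longrightarrow>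
      Vx X (n + 1) = C \<Longrightarrow> Dif X (n + 1) = \<Phi> C A \<delta> \<Longrightarrow> dist X \<delta>"
    using ind unfolding induced_by_def by metis
  define X where "X = left_rotation n \<C> \<Sigma> (left_rotation n \<C> \<Sigma> (trivial_sigma_seq n \<C> \<Sigma> Z A))"
  have X: "X \<in> \<Theta>" unfolding X_def by (intro R.RN2 R.RN1_trivial A Z)
  have s: "is_sigma_seq n \<C> \<Sigma> X" by (rule R.angle_seq[OF X])
  have X0: "Vx X 0 = A" and Xi: "i \<in> {1..n} \<Longrightarrow> zero_object \<C> (Vx X i)" for i
    using n_pos Z FOb_zero_object[OF R.suspension Z]
    unfolding X_def left_rotation_def trivial_sigma_seq_def id_chain_def by (auto simp: Let_def)
  have o: "Vx X 0 \<in> Obj \<C>" "Vx X (Suc n) \<in> Obj \<C>"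
    and dm: "i \<le> n \<Longrightarrow> arr (Dif X i) \<and> dm (Dif X i) = Vx X i \<and> cd (Dif X i) = Vx X (Suc i)"
    and last: "Dif X (Suc n) \<in> Mor \<C> (Vx X (Suc n)) (FOb \<Sigma> (Vx X 0))" for i
    using s unfolding is_sigma_seq_def by (auto simp: Mor_iff)
  have "\<Phi> (Vx X (Suc n)) (Vx X 0) \<in> iso (Ext E (Vx X (Suc n)) (Vx X 0)) (Hom \<C> (Vx X (Suc n)) (FOb \<Sigma> (Vx X 0)))"
    using iso o unfolding bifunctor_iso_def by blast
  then obtain \<delta> where \<delta>: "\<delta> \<in> carrier (Ext E (Vx X (Suc n)) (Vx X 0))" "Dif X (Suc n) = \<Phi> (Vx X (Suc n)) (Vx X 0) \<delta>"
    using last unfolding iso_def bij_betw_def by auto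
  have "dist X \<delta>" using d[OF o(2,1) \<delta>(1) X] \<delta>(2) by simp
  then show ?thesis
    using trivial_inflation_of_flat_chain[OF dist_flat_chain[of X \<delta> Z] Z] Z dm[of 0] dm[of n] n_pos X0
      zero_objectD(3)[OF Xi[of 1], of "Dif X 0"] zero_objectD(2)[OF Xi[of n], of "Dif X n"] by simp
qed

end

section \<open>Right angles\<close>

locale suspended_n_exangulated = n_exangulated \<C> E n \<s>
  for \<C> :: "('o, 'm) category" (structure) and E :: "('o, 'm, 'e) bifunctor"
    and n :: nat and \<s> :: "('o, 'm, 'e) realization" +
  fixes \<Sigma> :: "('o, 'm) endofunctor" and \<Phi> :: "'o \<Rightarrow> 'o \<Rightarrow> 'e \<Rightarrow> 'm"
  assumes suspension: "additive_endofunctor \<C> \<Sigma>" and ff: "fully_faithful \<C> \<Sigma>"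
    and Phi_iso: "bifunctor_iso \<C> E \<Sigma> \<Phi>"
begin

lemmas suspension_simps [simp] = additive_endofunctorD[OF suspension]

lemma Phi_typing [simp]:
  assumes "C \<in> Obj \<C>" "A \<in> Obj \<C>" "\<delta> \<in> carrier (Ext E C A)"
  shows "arr (\<Phi> C A \<delta>)" "dm (\<Phi> C A \<delta>) = C" "cd (\<Phi> C A \<delta>) = FOb \<Sigma> A"
proof -
  have "\<Phi> C A \<in> iso (Ext E C A) (Hom \<C> C (FOb \<Sigma> A))" using Phi_iso assms unfolding bifunctor_iso_def by blast
  then have "\<Phi> C A \<delta> \<in> Mor \<C> C (FOb \<Sigma> A)" using assms(3) unfolding iso_def hom_def by auto
  then show "arr (\<Phi> C A \<delta>)" "dm (\<Phi> C A \<delta>) = C" "cd (\<Phi> C A \<delta>) = FOb \<Sigma> A" by (auto simp: Mor_iff)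
qed

lemma Phi_inj:
  assumes "C \<in> Obj \<C>" "A \<in> Obj \<C>" "\<delta> \<in> carrier (Ext E C A)" "\<epsilon> \<in> carrier (Ext E C A)"
  shows "\<Phi> C A \<delta> = \<Phi> C A \<epsilon> \<longleftrightarrow> \<delta> = \<epsilon>"
proof -
  have "\<Phi> C A \<in> iso (Ext E C A) (Hom \<C> C (FOb \<Sigma> A))" using Phi_iso assms unfolding bifunctor_iso_def by blast
  then have "inj_on (\<Phi> C A) (carrier (Ext E C A))" unfolding iso_def bij_betw_def by auto
  then show ?thesis using assms by (auto simp: inj_on_def)
qed

lemma Phi_surj:
  assumes "A \<in> Obj \<C>" "arr u" "cd u = FOb \<Sigma> A"
  obtains \<delta> where "\<delta> \<in> carrier (Ext E (dm u) A)" "\<Phi> (dm u) A \<delta> = u"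
proof -
  have "\<Phi> (dm u) A \<in> iso (Ext E (dm u) A) (Hom \<C> (dm u) (FOb \<Sigma> A))" using Phi_iso assms unfolding bifunctor_iso_def by simp
  then have "u \<in> \<Phi> (dm u) A ` carrier (Ext E (dm u) A)"
    using assms unfolding iso_def bij_betw_def by (auto simp: Mor_iff)
  then show thesis using that by auto
qed

lemma Phi_pull [simp]:
  assumes "arr c" "dm c = C'" "A \<in> Obj \<C>" "\<delta> \<in> carrier (Ext E (cd c) A)"
  shows "\<Phi> C' A (pull \<C> E A c \<delta>) = \<Phi> (cd c) A \<delta> \<cdot> c"
proof -
  have "\<Phi> C' A (pull \<C> E A c \<delta>) = FMor \<Sigma> (IdM \<C> A) \<cdot> (\<Phi> (cd c) A \<delta> \<cdot> c)"
    using Phi_iso assms id_mor[OF assms(3)] arr_mor[OF assms(1)] unfolding bifunctor_iso_def pull_def by blast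
  then show ?thesis using assms by simp
qed

lemma Phi_push [simp]:
  assumes "arr a" "cd a = A'" "C \<in> Obj \<C>" "\<delta> \<in> carrier (Ext E C (dm a))"
  shows "\<Phi> C A' (push \<C> E C a \<delta>) = FMor \<Sigma> a \<cdot> \<Phi> C (dm a) \<delta>"
proof -
  have "\<Phi> C A' (push \<C> E C a \<delta>) = FMor \<Sigma> a \<cdot> (\<Phi> C (dm a) \<delta> \<cdot> IdM \<C> C)"
    using Phi_iso assms id_mor[OF assms(3)] arr_mor[OF assms(1)] unfolding bifunctor_iso_def push_def by blast
  then show ?thesis using assms by simp
qed

lemma Phi_one [simp]:
  assumes "C \<in> Obj \<C>" "A \<in> Obj \<C>"
  shows "\<Phi> C A \<one>\<^bsub>Ext E C A\<^esub> = zero_mor \<C> C (FOb \<Sigma> A)"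
  using Phi_pull[of "zero_mor \<C> C C" C A "\<one>\<^bsub>Ext E C A\<^esub>"] assms by simp

lemma push_eq_pull_iff:
  assumes "arr a" "arr c" "\<delta> \<in> carrier (Ext E (dm c) (dm a))" "\<rho> \<in> carrier (Ext E (cd c) (cd a))"
  shows "push \<C> E (dm c) a \<delta> = pull \<C> E (cd a) c \<rho> \<longleftrightarrow>
    FMor \<Sigma> a \<cdot> \<Phi> (dm c) (dm a) \<delta> = \<Phi> (cd c) (cd a) \<rho> \<cdot> c"
  using assms Phi_inj[of "dm c" "cd a" "push \<C> E (dm c) a \<delta>" "pull \<C> E (cd a) c \<rho>"] by simp

definition angles :: "('o, 'm) chain set"
  where "angles = {X. is_sigma_seq n \<C> \<Sigma> X \<and>
    (\<exists>\<delta>\<in>carrier (Ext E (Vx X (Suc n)) (Vx X 0)). Dif X (Suc n) = \<Phi> (Vx X (Suc n)) (Vx X 0) \<delta> \<and> dist X \<delta>)}"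

lemma is_sigma_seqD:
  assumes "is_sigma_seq n \<C> \<Sigma> X"
  shows "i \<le> Suc n \<Longrightarrow> Vx X i \<in> Obj \<C>" "i \<le> n \<Longrightarrow> arr (Dif X i)"
    "i \<le> n \<Longrightarrow> dm (Dif X i) = Vx X i" "i \<le> n \<Longrightarrow> cd (Dif X i) = Vx X (Suc i)"
    "arr (Dif X (Suc n))" "dm (Dif X (Suc n)) = Vx X (Suc n)" "cd (Dif X (Suc n)) = FOb \<Sigma> (Vx X 0)"
  using assms unfolding is_sigma_seq_def Mor_iff by simp_all

lemma sigma_mor_iff:
  "sigma_mor n \<C> \<Sigma> X Y \<phi> \<longleftrightarrow> complex_mor n \<C> X Y \<phi> \<and>
    FMor \<Sigma> (\<phi> 0) \<cdot> Dif X (Suc n) = Dif Y (Suc n) \<cdot> \<phi> (Suc n)"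
  unfolding sigma_mor_def complex_mor_def by auto

lemma anglesE:
  assumes "X \<in> angles"
  obtains \<delta> where "dist X \<delta>" "\<delta> \<in> carrier (Ext E (Vx X (Suc n)) (Vx X 0))"
    "Dif X (Suc n) = \<Phi> (Vx X (Suc n)) (Vx X 0) \<delta>"
  using assms unfolding angles_def by blast

lemma angle_seq: "X \<in> angles \<Longrightarrow> is_sigma_seq n \<C> \<Sigma> X"
  by (simp add: angles_def)

text \<open>An \<open>n\<close>-exangle becomes a \<open>\<Sigma>\<close>-sequence by adding the last map.\<close>

definition with_last :: "('o, 'm) chain \<Rightarrow> 'm \<Rightarrow> ('o, 'm) chain"
  where "with_last X u = X\<lparr>Dif := (Dif X)(Suc n := u)\<rparr>"

lemma with_last_simps [simp]:
  "Vx (with_last X u) = Vx X" "i \<le> n \<Longrightarrow> Dif (with_last X u) i = Dif X i"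
  "Dif (with_last X u) (Suc n) = u"
  unfolding with_last_def by simp_all

text \<open>The entry \<open>n + 1\<close> of the differentials is not part of the complex.\<close>

lemma dist_with_last:
  assumes X: "dist X \<delta>" shows "dist (with_last X u) \<delta>"
proof -
  note X' = is_complexD[OF distD(1)[OF X]]
  have *: "complex_mor n \<C> X (with_last X u) (\<lambda>k. IdM \<C> (Vx X k))"
    "complex_mor n \<C> (with_last X u) X (\<lambda>k. IdM \<C> (Vx X k))"
    unfolding complex_mor_def Mor_iff using X' by simp_all
  show ?thesis
    by (rule dist_retract[OF X _ _ _ *]) (use X' distD(2)[OF X] in \<open>simp_all add: Mor_iff\<close>)
qed

lemma with_last_angle:
  assumes X: "dist X \<delta>"
  shows "with_last X (\<Phi> (Vx X (Suc n)) (Vx X 0) \<delta>) \<in> angles"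
  using is_complexD[OF distD(1)[OF X]] distD(2)[OF X] dist_with_last[OF X]
  unfolding angles_def is_sigma_seq_def Mor_iff by auto

text \<open>Under \<open>\<Phi>\<close>, compatibility of a morphism with the last maps is compatibility with the extensions.\<close>

lemma angle_split_cover:
  assumes X: "X \<in> angles" and Y: "Y \<in> angles" and S: "is_sigma_seq n \<C> \<Sigma> S"
    and i: "sigma_mor n \<C> \<Sigma> X S i" and p: "sigma_mor n \<C> \<Sigma> S X p"
    and j: "sigma_mor n \<C> \<Sigma> Y S j" and q: "sigma_mor n \<C> \<Sigma> S Y q"
    and id: "\<And>k. k \<le> Suc n \<Longrightarrow> i k \<cdot> p k \<boxplus> j k \<cdot> q k = IdM \<C> (Vx S k)"
  shows "S \<in> angles"
proof -
  obtain \<delta> where \<delta>: "dist X \<delta>" "\<delta> \<in> carrier (Ext E (Vx X (Suc n)) (Vx X 0))"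
    "Dif X (Suc n) = \<Phi> (Vx X (Suc n)) (Vx X 0) \<delta>" using anglesE[OF X] .
  obtain \<epsilon> where \<epsilon>: "dist Y \<epsilon>" "\<epsilon> \<in> carrier (Ext E (Vx Y (Suc n)) (Vx Y 0))"
    "Dif Y (Suc n) = \<Phi> (Vx Y (Suc n)) (Vx Y 0) \<epsilon>" using anglesE[OF Y] .
  note S' = is_sigma_seqD[OF S]
  obtain \<sigma> where \<sigma>: "\<sigma> \<in> carrier (Ext E (Vx S (Suc n)) (Vx S 0))" "\<Phi> (Vx S (Suc n)) (Vx S 0) \<sigma> = Dif S (Suc n)"
    using Phi_surj[of "Vx S 0" "Dif S (Suc n)"] S' by auto
  have e: "push \<C> E (Vx U (Suc n)) (f 0) \<alpha> = pull \<C> E (Vx V 0) (f (Suc n)) \<beta>"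
    if "sigma_mor n \<C> \<Sigma> U V f" "\<alpha> \<in> carrier (Ext E (Vx U (Suc n)) (Vx U 0))"
      "\<beta> \<in> carrier (Ext E (Vx V (Suc n)) (Vx V 0))" "Dif U (Suc n) = \<Phi> (Vx U (Suc n)) (Vx U 0) \<alpha>"
      "Dif V (Suc n) = \<Phi> (Vx V (Suc n)) (Vx V 0) \<beta>" for U V f \<alpha> \<beta>
    using push_eq_pull_iff[of "f 0" "f (Suc n)" \<alpha> \<beta>] complex_morD[of n U V f] that unfolding sigma_mor_iff by simp
  have "dist S \<sigma>"
  proof (rule dist_split_cover[OF \<delta>(1) \<epsilon>(1) _ _ \<sigma>(1) _ _ _ _ id])
    show "push \<C> E (Vx X (Suc n)) (i 0) \<delta> = pull \<C> E (Vx S 0) (i (Suc n)) \<sigma>"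
      by (rule e[OF i \<delta>(2) \<sigma>(1) \<delta>(3) \<sigma>(2)[symmetric]])
    show "push \<C> E (Vx Y (Suc n)) (j 0) \<epsilon> = pull \<C> E (Vx S 0) (j (Suc n)) \<sigma>"
      by (rule e[OF j \<epsilon>(2) \<sigma>(1) \<epsilon>(3) \<sigma>(2)[symmetric]])
    show "push \<C> E (Vx S (Suc n)) (p 0) \<sigma> = pull \<C> E (Vx X 0) (p (Suc n)) \<delta>"
      by (rule e[OF p \<sigma>(1) \<delta>(2) \<sigma>(2)[symmetric] \<delta>(3)])
    show "push \<C> E (Vx S (Suc n)) (q 0) \<sigma> = pull \<C> E (Vx Y 0) (q (Suc n)) \<epsilon>"
      by (rule e[OF q \<sigma>(1) \<epsilon>(2) \<sigma>(2)[symmetric] \<epsilon>(3)])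
  qed (use S' i p j q in \<open>simp_all add: Mor_iff sigma_mor_iff\<close>)
  then show ?thesis unfolding angles_def using S \<sigma> by (auto intro: bexI[of _ \<sigma>])
qed

lemma angle_retract:
  assumes X: "X \<in> angles" and S: "is_sigma_seq n \<C> \<Sigma> S"
    and i: "sigma_mor n \<C> \<Sigma> X S i" and p: "sigma_mor n \<C> \<Sigma> S X p"
    and id: "\<And>k. k \<le> Suc n \<Longrightarrow> i k \<cdot> p k = IdM \<C> (Vx S k)"
  shows "S \<in> angles"
proof (rule angle_split_cover[where j = "\<lambda>k. zero_mor \<C> (Vx X k) (Vx S k)"
      and q = "\<lambda>k. zero_mor \<C> (Vx S k) (Vx X k)", OF X X S i p])
  note X' = is_sigma_seqD[OF angle_seq[OF X]] and S' = is_sigma_seqD[OF S]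
  show "sigma_mor n \<C> \<Sigma> X S (\<lambda>k. zero_mor \<C> (Vx X k) (Vx S k))"
    "sigma_mor n \<C> \<Sigma> S X (\<lambda>k. zero_mor \<C> (Vx S k) (Vx X k))"
    unfolding sigma_mor_iff complex_mor_def Mor_iff using X' S' by simp_all
  show "i k \<cdot> p k \<boxplus> zero_mor \<C> (Vx X k) (Vx S k) \<cdot> zero_mor \<C> (Vx S k) (Vx X k) = IdM \<C> (Vx S k)"
    if "k \<le> Suc n" for k using id[OF that] X' S' that by simp
qed

text \<open>For a realization of the extension \<open>\<eta>\<close> that corresponds to the identity of \<open>\<Sigma>A\<close>, the equations
  \<open>(d\<^sub>0)\<^sub>*\<eta> = 0\<close> and \<open>(d\<^sub>n)\<^sup>*\<eta> = 0\<close> read \<open>\<Sigma>d\<^sub>0 = 0\<close> and \<open>d\<^sub>n = 0\<close>. So both outer differentials vanish,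
  the first one because \<open>\<Sigma>\<close> is faithful.\<close>

lemma dist_suspension:
  assumes A: "A \<in> Obj \<C>" and Z: "zero_object \<C> Z"
  obtains \<eta> where "\<eta> \<in> carrier (Ext E (FOb \<Sigma> A) A)" "\<Phi> (FOb \<Sigma> A) A \<eta> = IdM \<C> (FOb \<Sigma> A)"
    "dist (flat_chain Z A (FOb \<Sigma> A)) \<eta>"
proof -
  obtain \<eta> where \<eta>: "\<eta> \<in> carrier (Ext E (FOb \<Sigma> A) A)" "\<Phi> (FOb \<Sigma> A) A \<eta> = IdM \<C> (FOb \<Sigma> A)"
    using Phi_surj[of A "IdM \<C> (FOb \<Sigma> A)"] A by auto
  obtain X where X: "Vx X 0 = A" "Vx X (Suc n) = FOb \<Sigma> A" "dist X \<eta>"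
    using dist_realized[OF _ A \<eta>(1)] A by auto
  note X' = is_complexD[OF distD(1)[OF X(3)]]
  have "FMor \<Sigma> (Dif X 0) = \<Phi> (FOb \<Sigma> A) (Vx X 1) (push \<C> E (FOb \<Sigma> A) (Dif X 0) \<eta>)"
    using X' X \<eta> A by simp
  also have "\<dots> = zero_mor \<C> (FOb \<Sigma> A) (FOb \<Sigma> (Vx X 1))"
    using distD(3)[OF X(3)] X A X' by simp
  also have "\<dots> = FMor \<Sigma> (zero_mor \<C> A (Vx X 1))"
    using A X' by simp
  finally have "FMor \<Sigma> (Dif X 0) = FMor \<Sigma> (zero_mor \<C> A (Vx X 1))" .
  moreover have "inj_on (FMor \<Sigma>) (Mor \<C> A (Vx X 1))"
    using ff A X'(1)[of 1] unfolding fully_faithful_def bij_betw_def by simp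
  ultimately have 0: "Dif X 0 = zero_mor \<C> (Vx X 0) (Vx X 1)"
    using A X' X(1) by (simp add: inj_on_def Mor_iff)
  have "Dif X n = \<Phi> (Vx X n) A (pull \<C> E A (Dif X n) \<eta>)"
    using X' X \<eta> A by simp
  also have "\<dots> = zero_mor \<C> (Vx X n) (Vx X (Suc n))"
    using distD(4)[OF X(3)] X A X' by simp
  finally show thesis
    using that[OF \<eta>] dist_flat_chain[OF X(3) 0 _ Z] X by simp
qed

text \<open>For \<open>n = 1\<close> the chain \<open>0 \<rightarrow> A \<rightarrow> A\<close> is one of those in R2. For \<open>n \<ge> 2\<close> both ends are zero, and the
  chain is compared with the zero chain, which is also in R2.\<close>

lemma angles_RN1_trivial:
  assumes A: "A \<in> Obj \<C>" and Z: "zero_object \<C> Z"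
  shows "trivial_sigma_seq n \<C> \<Sigma> Z A \<in> angles"
proof -
  note Zo = zero_objectD(1)[OF Z] and ZI = zero_object_iff[THEN iffD1, OF Z, THEN conjunct2]
  define X where "X = id_chain \<C> Z A 1"
  have V: "Vx X i = (if i = 1 \<or> i = 2 then A else Z)"
    and D: "Dif X i = (if i = 1 then IdM \<C> A else zero_mor \<C> (Vx X i) (Vx X (Suc i)))" for i
    by (auto simp: X_def id_chain_def Let_def)
  have Vo: "Vx X i \<in> Obj \<C>" for i using V A Zo by simp
  have T: "trivial_sigma_seq n \<C> \<Sigma> Z A = with_last X (zero_mor \<C> (Vx X (Suc n)) (FOb \<Sigma> Z))"
    unfolding trivial_sigma_seq_def with_last_def X_def by (simp add: Let_def)
  have dX: "dist X \<one>\<^bsub>Ext E (Vx X (Suc n)) (Vx X 0)\<^esub>"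
  proof (cases "n = 1")
    case True
    then show ?thesis using R2[OF A Z] V[of 0] V[of 2] unfolding X_def by (simp add: numeral_2_eq_2)
  next
    case False
    then have n2: "2 \<le> n" using n_pos by simp
    let ?W = "id_chain \<C> Z Z 0"
    have W: "dist ?W \<one>\<^bsub>Ext E Z Z\<^esub>" using R2[OF Zo Z] by blast
    have VW: "Vx ?W i = Z" and DW: "Dif ?W i = zero_mor \<C> Z Z" for i
      using ZI by (auto simp: id_chain_def Let_def)
    have ends: "Vx X 0 = Z" "Vx X (Suc n) = Z" using V n2 by simp_all
    have "is_complex n \<C> X"
      unfolding is_complex_def Mor_iff
    proof (intro conjI allI impI)
      fix i
      show "arr (Dif X i)" "dm (Dif X i) = Vx X i" "cd (Dif X i) = Vx X (i + 1)"
        using Vo A Zo V[of 1] V[of 2] by (simp_all add: D numeral_2_eq_2)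
      show "Dif X (i + 1) \<cdot> Dif X i = zero_mor \<C> (Vx X i) (Vx X (i + 2))"
        using Vo A Zo V[of 1] V[of 2] by (cases "i = 0") (simp_all add: D numeral_2_eq_2)
    qed (rule Vo)
    moreover have "right_exact n X"
      unfolding right_exact_def
    proof (intro allI impI)
      fix i u assume u: "i < n" "arr u" "dm u = Vx X (Suc i)" "u \<cdot> Dif X i = zero_mor \<C> (Vx X i) (cd u)"
      show "\<exists>w. arr w \<and> dm w = Vx X (Suc (Suc i)) \<and> cd w = cd u \<and> u = w \<cdot> Dif X (Suc i)"
      proof (cases "i = 0")
        case True
        then show ?thesis using u V D[of 1] by (intro exI[of _ u]) simp
      next
        case False
        have "u = zero_mor \<C> (Vx X (Suc i)) (cd u)"
        proof (cases "i = 1")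
          case True
          then have "u \<cdot> IdM \<C> A = zero_mor \<C> A (cd u)" using u(4) D[of 1] V[of 1] by simp
          then show ?thesis using True u(2,3) V[of 2] by (simp add: numeral_2_eq_2)
        next
          case 2: False
          then show ?thesis using zero_objectD(2)[OF Z u(2)] u(3) V[of "Suc i"] False by simp
        qed
        moreover have "zero_mor \<C> (Vx X (Suc (Suc i))) (cd u) \<cdot> Dif X (Suc i) = zero_mor \<C> (Vx X (Suc i)) (cd u)"
          using False u(2) Vo D[of "Suc i"] by simp
        ultimately show ?thesis using u(2) Vo
          by (intro exI[of _ "zero_mor \<C> (Vx X (Suc (Suc i))) (cd u)"]) simp
      qed
    qed
    moreover have "fixed_ends_mor n \<C> ?W X (\<lambda>k. zero_mor \<C> Z (Vx X k))"
      "fixed_ends_mor n \<C> X ?W (\<lambda>k. zero_mor \<C> (Vx X k) Z)"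
      unfolding fixed_ends_mor_def complex_mor_def Mor_iff VW DW
      using Vo Zo ends ZI A V[of 1] V[of 2] by (auto simp: D numeral_2_eq_2)
    ultimately show ?thesis using dist_transfer[OF W] ends by simp
  qed
  show ?thesis unfolding T using with_last_angle[OF dX] Vo V[of 0] A Zo by simp
qed

text \<open>The cocone for \<open>\<eta>\<close> and \<open>f\<close> starts with a map \<open>A \<rightarrow> M\<^sub>1\<close> whose target is a biproduct of \<open>B\<close> and a zero
  object. It remains to replace \<open>M\<^sub>1\<close> by \<open>B\<close> itself.\<close>

lemma angles_RN1_extend:
  assumes f: "arr f"
  shows "\<exists>X\<in>angles. Vx X 0 = dm f \<and> Vx X 1 = cd f \<and> Dif X 0 = f"
proof -
  obtain Z where Z: "zero_object \<C> Z" using has_zero_object by blast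
  let ?A = "dm f" and ?B = "cd f"
  have o: "?A \<in> Obj \<C>" "?B \<in> Obj \<C>" "FOb \<Sigma> ?A \<in> Obj \<C>" using f by simp_all
  let ?P = "flat_chain Z ?A (FOb \<Sigma> ?A)"
  obtain \<eta> where \<eta>: "\<eta> \<in> carrier (Ext E (FOb \<Sigma> ?A) ?A)" "dist ?P \<eta>"
    using dist_suspension[OF o(1) Z] by blast
  have pf: "push \<C> E (FOb \<Sigma> ?A) f \<eta> \<in> carrier (Ext E (FOb \<Sigma> ?A) ?B)"
    using \<eta> o f by simp
  obtain Y where Y: "Vx Y 0 = ?B" "Vx Y (Suc n) = FOb \<Sigma> ?A" "dist Y (push \<C> E (FOb \<Sigma> ?A) f \<eta>)"
    using dist_realized[OF o(3,2) pf] by blast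
  obtain g M where g: "complex_mor n \<C> ?P Y g" "g 0 = f" and M: "mapping_cocone n \<C> ?P Y g M"
    "dist M (pull \<C> E ?A (Dif Y n) \<eta>)"
    using EA2_op[OF \<eta>(1), of f ?B ?P Y] f \<eta>(2) Y by (auto simp: Mor_iff)
  obtain inc prj :: "nat \<Rightarrow> summand \<Rightarrow> 'm" where Me: "Vx M 0 = ?A" "Vx M (Suc n) = Vx Y n"
    and bm: "biprod ?B (Vx ?P 1) (Vx M 1) (inc 1) (prj 1)"
    and dF: "prj 1 Fst \<cdot> Dif M 0 = f"
    using cocone_start[OF M(1)]
    unfolding Y(1) g(2) flat_chain_simps(1) by blast
  note bm' = biproduct_pairD[OF bm]
  note M' = is_complexD[OF distD(1)[OF M(2)]]
  have "Vx ?P 1 = Z" using n_pos by simp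
  then have "inc 1 Snd \<cdot> prj 1 Snd = zero_mor \<C> (Vx M 1) (Vx M 1)"
    using zero_objectD(2)[OF Z, of "inc 1 Snd"] bm'(1-15) by (metis zero_comp(1))
  then have ip: "inc 1 Fst \<cdot> prj 1 Fst = IdM \<C> (Vx M 1)"
    using bm'(20) bm'(1-15) by simp
  define M2 where "M2 = M\<lparr>Vx := (Vx M)(1 := ?B), Dif := (Dif M)(0 := f, 1 := Dif M 1 \<cdot> inc 1 Fst)\<rparr>"
  have M2: "Vx M2 1 = ?B" "k \<noteq> 1 \<Longrightarrow> Vx M2 k = Vx M k" "Dif M2 0 = f" "Dif M2 1 = Dif M 1 \<cdot> inc 1 Fst"
    "Dif M2 (Suc (Suc k)) = Dif M (Suc (Suc k))" for k
    unfolding M2_def by simp_all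
  let ?i = "\<lambda>k. if k = 1 then prj 1 Fst else IdM \<C> (Vx M k)"
  let ?p = "\<lambda>k. if k = 1 then inc 1 Fst else IdM \<C> (Vx M k)"
  have c3: "k = 0 \<or> k = 1 \<or> (\<exists>j. k = Suc (Suc j))" for k :: nat
    by (metis One_nat_def not0_implies_Suc)
  have "dist M2 (pull \<C> E ?A (Dif Y n) \<eta>)"
  proof (rule dist_retract[where i = ?i and p = ?p, OF M(2)])
    show "Vx M2 k \<in> Obj \<C>" if "k \<le> Suc n" for k
      using that M' o M2 by (cases "k = 1") simp_all
    show "Dif M2 k \<in> Mor \<C> (Vx M2 k) (Vx M2 (Suc k))" if "k \<le> n" for k
      using c3[of k] that M'(1-4) f M2 Me bm'(1-15) by (auto simp: Mor_iff)
    show "pull \<C> E ?A (Dif Y n) \<eta> \<in> carrier (Ext E (Vx M2 (Suc n)) (Vx M2 0))"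
      using distD(2)[OF M(2)] M2(2)[of 0] M2(2)[of "Suc n"] n_pos by simp
    have dM0: "inc 1 Fst \<cdot> f = Dif M 0"
      unfolding dF[symmetric] using comp_reassoc[OF ip, of "Dif M 0"] M' bm'(1-15) by simp
    have dM1: "(Dif M 1 \<cdot> inc 1 Fst) \<cdot> prj 1 Fst = Dif M 1"
      using ip M' bm'(1-15) n_pos by simp
    show "complex_mor n \<C> M M2 ?i"
      unfolding complex_mor_def Mor_iff
    proof (intro conjI allI impI)
      fix k assume k: "k \<le> n"
      show "?i (k + 1) \<cdot> Dif M k = Dif M2 k \<cdot> ?i k"
        using c3[of k] k M' dF dM1 f Me M2 by auto
    qed (use M' M2 bm' in \<open>simp_all split: if_splits\<close>)
    show "complex_mor n \<C> M2 M ?p"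
      unfolding complex_mor_def Mor_iff
    proof (intro conjI allI impI)
      fix k assume k: "k \<le> n"
      show "?p (k + 1) \<cdot> Dif M2 k = Dif M k \<cdot> ?p k"
        using c3[of k] k M' dM0 f Me M2 bm'(1-15) by auto
    qed (use M' M2 bm' in \<open>simp_all split: if_splits\<close>)
    show "?i k \<cdot> ?p k = IdM \<C> (Vx M2 k)" if "k \<le> Suc n" for k
      using that M' bm' M2 by simp
    show "push \<C> E (Vx M (Suc n)) (?i 0) (pull \<C> E ?A (Dif Y n) \<eta>) =
      pull \<C> E (Vx M2 0) (?i (Suc n)) (pull \<C> E ?A (Dif Y n) \<eta>)"
      "push \<C> E (Vx M2 (Suc n)) (?p 0) (pull \<C> E ?A (Dif Y n) \<eta>) =
      pull \<C> E (Vx M 0) (?p (Suc n)) (pull \<C> E ?A (Dif Y n) \<eta>)"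
      using distD(2)[OF M(2)] M2(2)[of 0] M2(2)[of "Suc n"] n_pos M' by simp_all
  qed
  from with_last_angle[OF this] show ?thesis
    using M2 Me(1) n_pos by (intro bexI) auto
qed

text \<open>Let \<open>c : X\<^sub>n\<^sub>+\<^sub>1 \<rightarrow> \<Sigma>X\<^sub>0\<close> be the last map. The extension of \<open>X\<close> is \<open>c\<^sup>*\<eta>\<close>, and the cone for \<open>c\<close> is
  \<open>X\<^sub>1 \<rightarrow> X\<^sub>2 \<oplus> 0 \<rightarrow> \<dots> \<rightarrow> X\<^sub>n\<^sub>+\<^sub>1 \<oplus> 0 \<rightarrow> \<Sigma>X\<^sub>0\<close> with differentials \<open>-d\<^sub>i\<close> and \<open>c\<close> and extension
  \<open>(d\<^sub>0)\<^sub>*\<eta>\<close>, that is, last map \<open>\<Sigma>d\<^sub>0\<close>. The isomorphism with sign \<open>(-1)\<^sup>k\<close> in the degrees \<open>k \<le> n\<close> removes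
  the signs of the differentials; the sign \<open>(-1)\<^sup>n\<close> that it needs at \<open>\<Sigma>X\<^sub>0\<close> then moves to the last map.\<close>

lemma angles_RN2:
  assumes X: "X \<in> angles"
  shows "left_rotation n \<C> \<Sigma> X \<in> angles"
proof -
  obtain Z where Z: "zero_object \<C> Z" using has_zero_object by blast
  obtain \<delta> where \<delta>: "dist X \<delta>" "\<delta> \<in> carrier (Ext E (Vx X (Suc n)) (Vx X 0))"
    "Dif X (Suc n) = \<Phi> (Vx X (Suc n)) (Vx X 0) \<delta>" using anglesE[OF X] .
  note X' = is_sigma_seqD[OF angle_seq[OF X]]
  let ?A = "Vx X 0" and ?c = "Dif X (Suc n)"
  let ?P = "flat_chain Z ?A (FOb \<Sigma> ?A)"
  have o: "?A \<in> Obj \<C>" using X' by simp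
  obtain \<eta> where \<eta>: "\<eta> \<in> carrier (Ext E (FOb \<Sigma> ?A) ?A)" "\<Phi> (FOb \<Sigma> ?A) ?A \<eta> = IdM \<C> (FOb \<Sigma> ?A)" "dist ?P \<eta>"
    using dist_suspension[OF o Z] by blast
  have pc: "pull \<C> E ?A ?c \<eta> = \<delta>"
  proof -
    have "\<Phi> (Vx X (Suc n)) ?A (pull \<C> E ?A ?c \<eta>) = ?c" using X' o \<eta> by simp
    then show ?thesis using Phi_inj[of "Vx X (Suc n)" ?A "pull \<C> E ?A ?c \<eta>" \<delta>] X' o \<eta> \<delta> by simp
  qed
  obtain f M where f: "complex_mor n \<C> X ?P f" "f (Suc n) = ?c" and M: "mapping_cone n \<C> X ?P f M"
    "dist M (push \<C> E (FOb \<Sigma> ?A) (Dif X 0) \<eta>)"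
    using EA2[OF \<eta>(1), of ?c "Vx X (Suc n)" X ?P] X' pc \<delta>(1) \<eta>(3) by (auto simp: Mor_iff)
  note f' = complex_morD[OF f(1)] and M' = is_complexD[OF distD(1)[OF M(2)]]
  obtain inc prj where cd: "cone_data n X ?P f M inc prj"
    using cone_data_exists[OF n_pos distD(1)[OF \<delta>(1)] distD(1)[OF \<eta>(3)] M(1)] .
  have ends: "Vx M 0 = Vx X 1" "inc 0 Fst = IdM \<C> (Vx X 1)" "prj 0 Fst = IdM \<C> (Vx X 1)"
    "Vx M (Suc n) = FOb \<Sigma> ?A"
    and cF: "k < n \<Longrightarrow> Dif M k \<cdot> inc k Fst = inc (Suc k) Fst \<cdot> \<boxminus> Dif X (Suc k) \<boxplus> inc (Suc k) Snd \<cdot> f (Suc k)"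
    and cn: "Dif M n \<cdot> inc n Fst = ?c" for k
    using cd f(2) unfolding cone_data_def by simp_all
  have b: "biprod (Vx X (Suc (Suc k))) Z
      (Vx M (Suc k)) (inc (Suc k)) (prj (Suc k))" if "k < n" for k
    using cd that unfolding cone_data_def by (simp cong: if_cong)
  note b' = biproduct_pairD[OF b]
  have i: "arr (inc k Fst)" "dm (inc k Fst) = Vx X (Suc k)" "cd (inc k Fst) = Vx M k"
    "arr (prj k Fst)" "dm (prj k Fst) = Vx M k" "cd (prj k Fst) = Vx X (Suc k)"
    "prj k Fst \<cdot> inc k Fst = IdM \<C> (Vx X (Suc k))" if "k \<le> n" for k
    using that b'[of "k - 1"] ends X' by (cases k; simp)+
  have ip: "inc k Fst \<cdot> prj k Fst = IdM \<C> (Vx M k)" if k: "k \<le> n" for k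
  proof (cases k)
    case 0 then show ?thesis using ends X' n_pos by simp
  next
    case (Suc m)
    then have m: "m < n" using k by simp
    have "inc k Snd \<cdot> prj k Snd = zero_mor \<C> (Vx M k) (Vx M k)"
      using zero_objectD(2)[OF Z, of "inc k Snd"] b'(1-15)[OF m] Suc by (metis zero_comp(1))
    then show ?thesis using b'(20)[OF m] b'(1-15)[OF m] Suc by simp
  qed
  have dF: "Dif M k \<cdot> inc k Fst = \<boxminus> (inc (Suc k) Fst \<cdot> Dif X (Suc k))" if k: "k < n" for k
  proof -
    have "f (Suc k) = zero_mor \<C> (Vx X (Suc k)) Z"
      using zero_objectD(3)[OF Z, of "f (Suc k)"] f'[of "Suc k"] k by simp
    then show ?thesis using cF[OF k] b'[OF k] X' k by simp
  qed
  have dP: "prj (Suc k) Fst \<cdot> Dif M k = \<boxminus> (Dif X (Suc k) \<cdot> prj k Fst)" if k: "k < n" for k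
  proof -
    have "prj (Suc k) Fst \<cdot> Dif M k = prj (Suc k) Fst \<cdot> ((Dif M k \<cdot> inc k Fst) \<cdot> prj k Fst)"
      using ip[of k] i[of k] i[of "Suc k"] k M' by simp
    also have "\<dots> = \<boxminus> (Dif X (Suc k) \<cdot> prj k Fst)"
      unfolding dF[OF k] using comp_reassoc[OF i(7)[of "Suc k"]] i[of k] i[of "Suc k"] k X' by simp
    finally show ?thesis .
  qed
  have nP: "?c \<cdot> prj n Fst = Dif M n"
    using arg_cong[OF cn, of "\<lambda>x. x \<cdot> prj n Fst"] ip[of n] i[of n] M' by simp
  let ?M = "with_last M (FMor \<Sigma> (Dif X 0))"
  have MA: "?M \<in> angles"
    using with_last_angle[OF M(2)] X' o \<eta> ends by simp
  let ?R = "left_rotation n \<C> \<Sigma> X"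
  have R: "k \<le> n \<Longrightarrow> Vx ?R k = Vx X (Suc k)" "Vx ?R (Suc n) = FOb \<Sigma> ?A" "k \<le> n \<Longrightarrow> Dif ?R k = Dif X (Suc k)"
    "Dif ?R (Suc n) = (if even n then FMor \<Sigma> (Dif X 0) else \<boxminus> FMor \<Sigma> (Dif X 0))" for k
    using X' unfolding left_rotation_def by (simp_all add: sgn_mor_eq)
  let ?s = "\<lambda>k f. if even k then f else \<boxminus> f"
  let ?i = "\<lambda>k. if k \<le> n then ?s k (prj k Fst) else ?s n (IdM \<C> (FOb \<Sigma> ?A))"
  let ?p = "\<lambda>k. if k \<le> n then ?s k (inc k Fst) else ?s n (IdM \<C> (FOb \<Sigma> ?A))"
  show ?thesis
  proof (rule angle_retract[where i = ?i and p = ?p, OF MA])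
    show "is_sigma_seq n \<C> \<Sigma> ?R"
      unfolding is_sigma_seq_def Mor_iff
    proof (intro conjI allI impI)
      fix k assume k: "k \<le> n"
      show "arr (Dif ?R k)" "dm (Dif ?R k) = Vx ?R k" "cd (Dif ?R k) = Vx ?R (k + 1)"
        using k R X' by (cases "k = n"; simp)+
    next
      fix k assume "k \<le> n + 1"
      then have "k \<le> n \<or> k = Suc n" by auto
      then show "Vx ?R k \<in> Obj \<C>" using R X'(1)[of "Suc k"] o by auto
    qed (use R X' n_pos in simp_all)
    show "sigma_mor n \<C> \<Sigma> ?M ?R ?i"
      unfolding sigma_mor_iff complex_mor_def Mor_iff
    proof (intro conjI allI impI)
      fix k assume k: "k \<le> n"
      show "?i (k + 1) \<cdot> Dif ?M k = Dif ?R k \<cdot> ?i k"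
      proof (cases "k = n")
        case True
        then show ?thesis using nP R X' i[of n] M' ends o by simp
      next
        case False
        then show ?thesis using k dP[of k] R X' i[of k] i[of "Suc k"] M' by simp
      qed
    next
      show "FMor \<Sigma> (?i 0) \<cdot> Dif ?M (Suc n) = Dif ?R (Suc n) \<cdot> ?i (Suc n)"
        using R X' ends o n_pos by simp
      fix k assume "k \<le> n + 1"
      then have "k \<le> n \<or> k = Suc n" by auto
      then show "arr (?i k)" "dm (?i k) = Vx ?M k" "cd (?i k) = Vx ?R k" using i[of k] R ends o by auto
    qed
    show "sigma_mor n \<C> \<Sigma> ?R ?M ?p"
      unfolding sigma_mor_iff complex_mor_def Mor_iff
    proof (intro conjI allI impI)
      fix k assume k: "k \<le> n"
      show "?p (k + 1) \<cdot> Dif ?R k = Dif ?M k \<cdot> ?p k"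
      proof (cases "k = n")
        case True
        then show ?thesis using cn R X' i[of n] M' ends o by simp
      next
        case False
        then show ?thesis using k dF[of k] R X' i[of k] i[of "Suc k"] M' by simp
      qed
    next
      show "FMor \<Sigma> (?p 0) \<cdot> Dif ?R (Suc n) = Dif ?M (Suc n) \<cdot> ?p (Suc n)"
        using R X' ends o n_pos by simp
      fix k assume "k \<le> n + 1"
      then have "k \<le> n \<or> k = Suc n" by auto
      then show "arr (?p k)" "dm (?p k) = Vx ?R k" "cd (?p k) = Vx ?M k" using i[of k] R ends o by auto
    qed
    show "?i k \<cdot> ?p k = IdM \<C> (Vx ?R k)" if "k \<le> Suc n" for k
    proof -
      have "k \<le> n \<or> k = Suc n" using that by auto
      then show ?thesis using i[of k] R o X'(1)[of "Suc k"] by auto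
    qed
  qed
qed

lemma angles_RN3:
  assumes X: "X \<in> angles" and Y: "Y \<in> angles"
    and u: "u \<in> Mor \<C> (Vx X 0) (Vx Y 0)" and v: "v \<in> Mor \<C> (Vx X 1) (Vx Y 1)"
    and sq: "v \<cdot> Dif X 0 = Dif Y 0 \<cdot> u"
  shows "\<exists>\<phi>. sigma_mor n \<C> \<Sigma> X Y \<phi> \<and> \<phi> 0 = u \<and> \<phi> 1 = v"
proof -
  obtain \<delta> where \<delta>: "dist X \<delta>" "\<delta> \<in> carrier (Ext E (Vx X (Suc n)) (Vx X 0))"
    "Dif X (Suc n) = \<Phi> (Vx X (Suc n)) (Vx X 0) \<delta>" using anglesE[OF X] .
  obtain \<rho> where \<rho>: "dist Y \<rho>" "\<rho> \<in> carrier (Ext E (Vx Y (Suc n)) (Vx Y 0))"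
    "Dif Y (Suc n) = \<Phi> (Vx Y (Suc n)) (Vx Y 0) \<rho>" using anglesE[OF Y] .
  have uv: "arr u" "dm u = Vx X 0" "cd u = Vx Y 0" "arr v" "dm v = Vx X 1" "cd v = Vx Y 1"
    using u v by (simp_all add: Mor_iff)
  obtain f where f: "complex_mor n \<C> X Y f" "f 0 = u" "f 1 = v"
    "push \<C> E (Vx X (Suc n)) u \<delta> = pull \<C> E (Vx Y 0) (f (Suc n)) \<rho>"
    using dist_lift_prescribed[OF \<delta>(1) \<rho>(1) uv sq] .
  have "sigma_mor n \<C> \<Sigma> X Y f"
    using push_eq_pull_iff[of u "f (Suc n)" \<delta> \<rho>] f complex_morD[OF f(1)] uv \<delta>(2,3) \<rho>(2,3)
    unfolding sigma_mor_iff by simp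
  then show ?thesis using f by blast
qed

end

section \<open>The octahedral sequence\<close>

text \<open>Two mapping cones, one on top of the other: \<open>M\<close> is the cone of a morphism \<open>\<phi> : X \<rightarrow> Y\<close> of angles
  whose component in degree \<open>1\<close> is the first map of \<open>W\<close>, and \<open>N\<close> is the cone of a morphism
  \<open>\<theta> : M \<rightarrow> W\<close> whose component in degree \<open>1\<close> is the projection \<open>M\<^sub>1 = X\<^sub>2 \<oplus> Y\<^sub>1 \<rightarrow> Y\<^sub>1 = W\<^sub>1\<close>.\<close>

locale octahedron = suspended_n_exangulated \<C> E n \<s> \<Sigma> \<Phi>
  for \<C> :: "('o, 'm) category" (structure) and E :: "('o, 'm, 'e) bifunctor"
    and n :: nat and \<s> :: "('o, 'm, 'e) realization"
    and \<Sigma> :: "('o, 'm) endofunctor" and \<Phi> :: "'o \<Rightarrow> 'o \<Rightarrow> 'e \<Rightarrow> 'm" +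
  fixes X Y W M N :: "('o, 'm) chain" and \<phi> \<theta> :: "nat \<Rightarrow> 'm"
    and inc prj inj pro :: "nat \<Rightarrow> summand \<Rightarrow> 'm"
  assumes X: "X \<in> angles" and Y: "Y \<in> angles" and W: "W \<in> angles"
    and e: "Vx Y 0 = Vx X 0" "Vx W 0 = Vx X 1" "Vx W 1 = Vx Y 1"
    and \<phi>: "complex_mor n \<C> X Y \<phi>" and \<phi>1: "\<phi> 1 = Dif W 0"
    and M: "is_complex n \<C> M" and c: "cone_data n X Y \<phi> M inc prj"
    and \<theta>: "complex_mor n \<C> M W \<theta>" and \<theta>1: "\<theta> 1 = prj 1 Snd"
    and N: "is_complex n \<C> N" and d: "cone_data n M W \<theta> N inj pro"
    and N_angle: "with_last N (FMor \<Sigma> (Dif M 0) \<cdot> Dif W (Suc n)) \<in> angles"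
begin

text \<open>The primed names collect the typing rules and equations of the unprimed objects.\<close>

lemmas X' = is_sigma_seqD[OF angle_seq[OF X]]
lemmas Y' = is_sigma_seqD[OF angle_seq[OF Y]]
lemmas W' = is_sigma_seqD[OF angle_seq[OF W]]
lemmas \<phi>' = complex_morD[OF \<phi>]
lemmas \<theta>' = complex_morD[OF \<theta>]
lemmas M' = is_complexD[OF M]
lemmas N' = is_complexD[OF N]

lemma n_gt_0: "0 < n"
  using n_pos by simp

lemma
  shows M_ends: "Vx M 0 = Vx X 1" "inc 0 Fst = IdM \<C> (Vx X 1)" "Vx M (Suc n) = Vx Y (Suc n)"
    "inc (Suc n) Snd = IdM \<C> (Vx Y (Suc n))" "prj (Suc n) Snd = IdM \<C> (Vx Y (Suc n))"
    and M_biprod: "k < n \<Longrightarrow> biprod (Vx X (Suc (Suc k))) (Vx Y (Suc k))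
      (Vx M (Suc k)) (inc (Suc k)) (prj (Suc k))"
    and M_Fst: "k < n \<Longrightarrow> Dif M k \<cdot> inc k Fst = inc (Suc k) Fst \<cdot> \<boxminus> Dif X (Suc k) \<boxplus> inc (Suc k) Snd \<cdot> \<phi> (Suc k)"
    and M_last: "Dif M n \<cdot> inc n Fst = \<phi> (Suc n)"
    and M_Snd: "k < n \<Longrightarrow> Dif M (Suc k) \<cdot> inc (Suc k) Snd = inc (Suc (Suc k)) Snd \<cdot> Dif Y (Suc k)"
  using c unfolding cone_data_def by simp_all
lemmas M_biprodD = biproduct_pairD[OF M_biprod]

lemma
  shows N_ends: "Vx N 0 = Vx M 1" "inj 0 Fst = IdM \<C> (Vx M 1)" "Vx N (Suc n) = Vx W (Suc n)"
    "inj (Suc n) Snd = IdM \<C> (Vx W (Suc n))" "pro (Suc n) Snd = IdM \<C> (Vx W (Suc n))"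
    and N_biprod: "k < n \<Longrightarrow> biprod (Vx M (Suc (Suc k))) (Vx W (Suc k))
      (Vx N (Suc k)) (inj (Suc k)) (pro (Suc k))"
    and N_Fst: "k < n \<Longrightarrow> Dif N k \<cdot> inj k Fst = inj (Suc k) Fst \<cdot> \<boxminus> Dif M (Suc k) \<boxplus> inj (Suc k) Snd \<cdot> \<theta> (Suc k)"
    and N_last: "Dif N n \<cdot> inj n Fst = \<theta> (Suc n)"
    and N_Snd: "k < n \<Longrightarrow> Dif N (Suc k) \<cdot> inj (Suc k) Snd = inj (Suc (Suc k)) Snd \<cdot> Dif W (Suc k)"
  using d unfolding cone_data_def by simp_all
lemmas N_biprodD = biproduct_pairD[OF N_biprod]

lemma M_Snd_typing:
  assumes "k \<le> n"
  shows "arr (inc (Suc k) Snd)" "dm (inc (Suc k) Snd) = Vx Y (Suc k)" "cd (inc (Suc k) Snd) = Vx M (Suc k)"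
    "arr (prj (Suc k) Snd)" "dm (prj (Suc k) Snd) = Vx M (Suc k)" "cd (prj (Suc k) Snd) = Vx Y (Suc k)"
    "prj (Suc k) Snd \<cdot> inc (Suc k) Snd = IdM \<C> (Vx Y (Suc k))"
  using assms M_biprodD[of k] M_ends Y' by (cases "k = n"; simp)+

lemma M_start: "Dif M 0 = inc 1 Fst \<cdot> \<boxminus> Dif X 1 \<boxplus> inc 1 Snd \<cdot> Dif W 0"
  using M_Fst[OF n_gt_0] M_ends M' \<phi>1 by simp

lemma N_start: "Dif N 0 = inj 1 Fst \<cdot> \<boxminus> Dif M 1 \<boxplus> inj 1 Snd \<cdot> prj 1 Snd"
  using N_Fst[OF n_gt_0] N_ends N' \<theta>1 by simp

text \<open>In the degrees \<open>k \<ge> 2\<close>, \<open>N\<^sub>k\<close> is \<open>X\<^sub>k\<^sub>+\<^sub>2 \<oplus> Y\<^sub>k\<^sub>+\<^sub>1 \<oplus> W\<^sub>k\<close>, as required of the octahedral sequence. In the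
  degrees \<open>0\<close> and \<open>1\<close>, \<open>N\<close> has an additional summand \<open>Y\<^sub>1 = W\<^sub>1\<close>, which \<open>N\<^sub>0 \<rightarrow> N\<^sub>1\<close> maps identically
  because \<open>\<theta>\<^sub>1\<close> is the projection to it; this summand is omitted here.\<close>

definition octa :: "('o, 'm) chain"
  where "octa = \<lparr>Vx = \<lambda>k. if k = 0 then Vx X 2 else if k = 1 then Vx M 2 else Vx N k,
    Dif = \<lambda>k. if k = 0 then Dif M 1 \<cdot> inc 1 Fst else if k = 1 then Dif N 1 \<cdot> inj 1 Fst
      else if k = Suc n then FMor \<Sigma> (Dif X 1) \<cdot> Dif W (Suc n) else Dif N k\<rparr>"

lemma octa_simps:
  "Vx octa 0 = Vx X 2" "Vx octa 1 = Vx M 2" "Vx octa (Suc (Suc k)) = Vx N (Suc (Suc k))"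
  "Dif octa 0 = Dif M 1 \<cdot> inc 1 Fst" "Dif octa 1 = Dif N 1 \<cdot> inj 1 Fst"
  "Suc (Suc k) \<le> n \<Longrightarrow> Dif octa (Suc (Suc k)) = Dif N (Suc (Suc k))"
  "Dif octa (Suc n) = FMor \<Sigma> (Dif X 1) \<cdot> Dif W (Suc n)"
  using n_pos unfolding octa_def by simp_all

lemma index_two: "Vx X 2 = Vx X (Suc (Suc 0))" "Vx M 2 = Vx M (Suc (Suc 0))"
  by (simp_all add: numeral_2_eq_2)

lemma zero_one_or_more: "k = 0 \<or> k = 1 \<or> (\<exists>j. k = Suc (Suc j))" for k :: nat
  by (metis One_nat_def not0_implies_Suc)

lemmas M1 = M_biprodD[OF n_gt_0]
lemmas N1 = N_biprodD[OF n_gt_0]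

lemma octa_seq: "is_sigma_seq n \<C> \<Sigma> octa"
  unfolding is_sigma_seq_def Mor_iff
proof (intro conjI allI impI)
  fix k assume k: "k \<le> n + 1"
  show "Vx octa k \<in> Obj \<C>" using zero_one_or_more[of k] octa_simps index_two X' M' N' k n_pos by auto
next
  fix k assume k: "k \<le> n"
  show "arr (Dif octa k)" "dm (Dif octa k) = Vx octa k" "cd (Dif octa k) = Vx octa (k + 1)"
    using zero_one_or_more[of k] octa_simps index_two X' M' N' k n_pos M1(1-15) N1(1-15) by auto
qed (use octa_simps(1,7) octa_simps(3)[of "n - 1"] index_two N_ends X' W' e n_gt_0 in auto)
text \<open>The contractible part of \<open>N\<close> is split off by a retraction. It is not the projection to the
  other summands: in degree \<open>1\<close> it sends the summand \<open>W\<^sub>1 = Y\<^sub>1\<close> to \<open>M\<^sub>2\<close> by the differential of \<open>M\<close>,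
  since otherwise it would not commute with \<open>N\<^sub>0 \<rightarrow> N\<^sub>1\<close>. The signs in degree \<open>0\<close> are due to the
  minus sign in front of the differential of \<open>M\<close> in the cone \<open>N\<close>; they also turn the last map
  \<open>-\<Sigma>d\<^sub>1 h\<close> of \<open>N\<close> on \<open>X\<^sub>2\<close> into the required \<open>\<Sigma>d\<^sub>1 h\<close>.\<close>

lemma octa_angle: "octa \<in> angles"
proof -
  let ?N = "with_last N (FMor \<Sigma> (Dif M 0) \<cdot> Dif W (Suc n))"
  let ?i = "\<lambda>k. if k = 0 then \<boxminus> prj 1 Fst
    else if k = 1 then pro 1 Fst \<boxplus> (Dif M 1 \<cdot> inc 1 Snd) \<cdot> pro 1 Snd else IdM \<C> (Vx N k)"
  let ?p = "\<lambda>k. if k = 0 then \<boxminus> inc 1 Fst else if k = 1 then inj 1 Fst else IdM \<C> (Vx N k)"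
  show ?thesis
  proof (rule angle_retract[where i = ?i and p = ?p, OF N_angle octa_seq])
    have i: "arr (?i k) \<and> dm (?i k) = Vx N k \<and> cd (?i k) = Vx octa k"
      and p: "arr (?p k) \<and> dm (?p k) = Vx octa k \<and> cd (?p k) = Vx N k" if k: "k \<le> Suc n" for k
      using zero_one_or_more[of k] k octa_simps(1-3) index_two e M' N' N_ends M1(1-15) N1(1-15) n_pos by auto
    have comm0: "(pro 1 Fst \<boxplus> (Dif M 1 \<cdot> inc 1 Snd) \<cdot> pro 1 Snd) \<cdot> Dif N 0 = (Dif M 1 \<cdot> inc 1 Fst) \<cdot> \<boxminus> prj 1 Fst"
    proof -
      let ?a = "(Dif M 1 \<cdot> inc 1 Fst) \<cdot> prj 1 Fst" and ?b = "(Dif M 1 \<cdot> inc 1 Snd) \<cdot> prj 1 Snd"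
      have "(pro 1 Fst \<boxplus> (Dif M 1 \<cdot> inc 1 Snd) \<cdot> pro 1 Snd) \<cdot> Dif N 0 = \<boxminus> Dif M 1 \<boxplus> ?b"
        unfolding N_start using M1(1-15) N1(1-15,16-24) M' e n_pos by simp
      also have "\<dots> = \<boxminus> (?a \<boxplus> ?b) \<boxplus> ?b"
        using M1(26)[of "Dif M 1"] M' n_pos by simp
      also have "\<dots> = \<boxminus> ?a"
        using M1(1-15) M' n_pos by (simp add: madd_assoc)
      finally show ?thesis using M1(1-15) M' n_pos by simp
    qed
    have comm1: "Dif N 1 = (Dif N 1 \<cdot> inj 1 Fst) \<cdot> (pro 1 Fst \<boxplus> (Dif M 1 \<cdot> inc 1 Snd) \<cdot> pro 1 Snd)"
    proof -
      have N0_inc: "Dif N 0 \<cdot> inc 1 Snd = inj 1 Fst \<cdot> \<boxminus> (Dif M 1 \<cdot> inc 1 Snd) \<boxplus> inj 1 Snd"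
        unfolding N_start using M1(1-19) N1(1-15) M' e n_pos by simp
      have "Dif N 1 \<cdot> (Dif N 0 \<cdot> inc 1 Snd) = zero_mor \<C> (Vx Y 1) (Vx N 2)"
        using N'(6)[of 0 "inc 1 Snd"] M1(1-15) N_ends n_pos by (simp add: numeral_2_eq_2)
      then have z: "\<boxminus> (Dif N 1 \<cdot> (inj 1 Fst \<cdot> (Dif M 1 \<cdot> inc 1 Snd))) \<boxplus> Dif N 1 \<cdot> inj 1 Snd =
          zero_mor \<C> (Vx Y 1) (Vx N 2)"
        unfolding N0_inc using M1(1-15) N1(1-15) M' N' e n_pos by simp
      have "Dif N 1 \<cdot> inj 1 Snd = \<boxminus> \<boxminus> (Dif N 1 \<cdot> (inj 1 Fst \<cdot> (Dif M 1 \<cdot> inc 1 Snd)))"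
        by (rule mneg_unique) (use z M1(1-15) N1(1-15) M' N' e n_pos in \<open>simp_all add: numeral_2_eq_2\<close>)
      then have *: "Dif N 1 \<cdot> inj 1 Snd = Dif N 1 \<cdot> (inj 1 Fst \<cdot> (Dif M 1 \<cdot> inc 1 Snd))"
        using M1(1-15) N1(1-15) M' N' e n_pos by simp
      have "Dif N 1 = (Dif N 1 \<cdot> inj 1 Fst) \<cdot> pro 1 Fst \<boxplus> (Dif N 1 \<cdot> inj 1 Snd) \<cdot> pro 1 Snd"
        using N1(26)[of "Dif N 1"] N' n_pos by simp
      then show ?thesis
        unfolding * using M1(1-15) N1(1-15) M' N' e n_pos by simp
    qed
    have comm2: "inj 1 Fst \<cdot> (Dif M 1 \<cdot> inc 1 Fst) = Dif N 0 \<cdot> \<boxminus> inc 1 Fst"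
      unfolding N_start using M1(1-19) N1(1-15) M' e n_pos by simp
    have SW: "FMor \<Sigma> (Dif W 0) \<cdot> Dif W (Suc n) = zero_mor \<C> (Vx W (Suc n)) (FOb \<Sigma> (Vx W 1))"
    proof -
      obtain \<omega> where \<omega>: "dist W \<omega>" "\<omega> \<in> carrier (Ext E (Vx W (Suc n)) (Vx W 0))"
        "Dif W (Suc n) = \<Phi> (Vx W (Suc n)) (Vx W 0) \<omega>" using anglesE[OF W] .
      have "FMor \<Sigma> (Dif W 0) \<cdot> Dif W (Suc n) =
          \<Phi> (Vx W (Suc n)) (Vx W 1) (push \<C> E (Vx W (Suc n)) (Dif W 0) \<omega>)"
        using W' \<omega>(2,3) by simp
      also have "\<dots> = zero_mor \<C> (Vx W (Suc n)) (FOb \<Sigma> (Vx W 1))"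
        using distD(3)[OF \<omega>(1)] W' n_pos by simp
      finally show ?thesis .
    qed
    have M0': "FMor \<Sigma> (Dif M 0) \<cdot> Dif W (Suc n) = \<boxminus> (FMor \<Sigma> (inc 1 Fst) \<cdot> (FMor \<Sigma> (Dif X 1) \<cdot> Dif W (Suc n)))"
      unfolding M_start using M1(1-15) X' W' SW e n_pos by simp
    show "sigma_mor n \<C> \<Sigma> ?N octa ?i"
      unfolding sigma_mor_iff complex_mor_def Mor_iff
    proof (intro conjI allI impI)
      fix k assume k: "k \<le> n"
      show "?i (k + 1) \<cdot> Dif ?N k = Dif octa k \<cdot> ?i k"
        using zero_one_or_more[of k] k comm0 comm1 octa_simps N' n_pos by auto
    next
      have "FMor \<Sigma> (prj 1 Fst) \<cdot> FMor \<Sigma> (inc 1 Fst) = IdM \<C> (FOb \<Sigma> (Vx X 2))"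
        using suspension_simps(6)[of "inc 1 Fst" "prj 1 Fst"] M1(1-16) index_two by simp
      from comp_reassoc[OF this, of "FMor \<Sigma> (Dif X 1) \<cdot> Dif W (Suc n)"]
      show "FMor \<Sigma> (?i 0) \<cdot> Dif ?N (Suc n) = Dif octa (Suc n) \<cdot> ?i (Suc n)"
        using M0' octa_simps(7) M1(1-15) index_two X' W' e N_ends n_pos by simp
    qed (use i in simp_all)
    show "sigma_mor n \<C> \<Sigma> octa ?N ?p"
      unfolding sigma_mor_iff complex_mor_def Mor_iff
    proof (intro conjI allI impI)
      fix k assume k: "k \<le> n"
      show "?p (k + 1) \<cdot> Dif octa k = Dif ?N k \<cdot> ?p k"
        using zero_one_or_more[of k] k comm2 octa_simps N' M' M1(1-15) N1(1-15) index_two n_pos by auto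
    next
      show "FMor \<Sigma> (?p 0) \<cdot> Dif octa (Suc n) = Dif ?N (Suc n) \<cdot> ?p (Suc n)"
        using M0' octa_simps(7) M1(1-15) index_two X' W' M' e N_ends n_pos by simp
    qed (use p in simp_all)
    show "?i k \<cdot> ?p k = IdM \<C> (Vx octa k)" if k: "k \<le> Suc n" for k
      using zero_one_or_more[of k] k octa_simps(1-3) index_two e M' N' N_ends M1(1-19) N1(1-19) n_pos by auto
  qed
qed

text \<open>\<open>\<psi>\<close> and \<open>\<phi>2\<close> are the components of \<open>\<theta>\<close> on the summands \<open>Y\<^sub>k\<close> and \<open>X\<^sub>k\<^sub>+\<^sub>1\<close> of \<open>M\<^sub>k\<close>. The index of \<open>\<phi>2\<close>
  is that of its source; its sign is forced by the sign of the summand \<open>X\<^sub>k\<^sub>+\<^sub>2\<close> of the octahedral sequence.\<close>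

definition \<psi> :: "nat \<Rightarrow> 'm"
  where "\<psi> k = \<theta> k \<cdot> inc k Snd"

definition \<phi>2 :: "nat \<Rightarrow> 'm"
  where "\<phi>2 k = (if even k then \<theta> (k - 1) \<cdot> inc (k - 1) Fst else \<boxminus> (\<theta> (k - 1) \<cdot> inc (k - 1) Fst))"

lemma \<psi>_mor: "j \<in> {2..n + 1} \<Longrightarrow> \<psi> j \<in> Mor \<C> (Vx Y j) (Vx W j)"
  using M_Snd_typing[of "j - 1"] \<theta>'[of j] by (auto simp: \<psi>_def Mor_iff)

lemma \<phi>2_mor: "k \<in> {3..n + 1} \<Longrightarrow> \<phi>2 k \<in> Mor \<C> (Vx X k) (Vx W (k - 1))"
proof -
  assume "k \<in> {3..n + 1}"
  then obtain j where "k = Suc (Suc j)" "j < n" by (cases k; cases "k - 1") auto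
  then show ?thesis
    using M_biprodD(1-15)[of j] \<theta>'(1-3)[of "Suc j"] by (simp add: \<phi>2_def Mor_iff)
qed

text \<open>Without signs, the block matrix of \<open>N\<close> has the entries \<open>d\<^sup>X\<close>, \<open>-\<phi>\<close>, \<open>-d\<^sup>Y\<close>, \<open>\<theta>\<close> and \<open>d\<^sup>W\<close>. The
  signs of the octahedral matrices arise by changing the sign of the inclusion and projection of
  \<open>X\<^sub>k\<^sub>+\<^sub>2\<close> for odd \<open>k\<close>. The exceptional matrix in degree \<open>0\<close> fits in because the octahedral sequence
  starts with the differential of \<open>M\<close> and not with its negative.\<close>

lemma octa_octahedral: "octahedral_seq n \<C> \<Sigma> X Y W \<phi> \<psi> \<phi>2 octa"
proof -
  obtain m where m: "n = Suc m" using n_gt_0 by (cases n) auto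
  \<comment> \<open>The decomposition of the terms without signs. In degree \<open>n + 1\<close> only the summand \<open>W\<^sub>n\<^sub>+\<^sub>1\<close> is present,
    and its inclusion \<open>inj (n + 1) Snd\<close> is the identity.\<close>
  define u where "u k i = (if k = 0 then IdM \<C> (Vx X 2) else if k = 1 then inc 2 i
    else if i = Trd then inj k Snd else inj k Fst \<cdot> inc (Suc k) i)" for k i
  define q where "q k i = (if k = 0 then IdM \<C> (Vx X 2) else if k = 1 then prj 2 i
    else if i = Trd then pro k Snd else prj (Suc k) i \<cdot> pro k Fst)" for k i
  define I where "I = (\<lambda>k. {i. i = Fst \<and> k + 2 \<le> n + 1 \<or> i = Snd \<and> 1 \<le> k \<and> k \<le> n \<or> i = Trd \<and> 2 \<le> k})"
  define G where "G = (\<lambda>k i. case i of Fst \<Rightarrow> Vx X (k + 2) | Snd \<Rightarrow> Vx Y (k + 1) | Trd \<Rightarrow> Vx W k)"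
  have TB: "biproduct \<C> (I k) (G k) (Vx octa k) (u k) (q k)" if k: "k \<le> n + 1" for k
  proof -
    have M_biprod_index: "biproduct \<C> (if k < n then {Fst, Snd} else {Snd}) (\<lambda>i. if i = Fst then Vx X (k + 2) else Vx Y (k + 1))
      (Vx M (Suc k)) (inc (Suc k)) (prj (Suc k))" if "k \<le> n" for k
    proof (cases "k < n")
      case True
      then show ?thesis using M_biprod[OF True] by (simp cong: if_cong)
    next
      case False
      then have "k = n" using that by simp
      then show ?thesis using M_ends Y' M_Snd_typing[of n] by (simp add: biproduct_singleton_iff Mor_iff)
    qed
    consider "k = 0" | "k = 1" | "2 \<le> k" "k \<le> n" | "k = Suc n" "2 \<le> k" using k n_pos by linarith
    then show ?thesis
    proof cases
      case 1
      have "I 0 = {Fst}" using n_pos by (auto simp: I_def)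
      then show ?thesis using 1 octa_simps X' index_two n_pos by (simp add: biproduct_singleton_iff Mor_iff u_def q_def G_def)
    next
      case 2
      have "I 1 = (if 1 < n then {Fst, Snd} else {Snd})" using n_pos by (auto simp: I_def)
      moreover have "biproduct \<C> (if 1 < n then {Fst, Snd} else {Snd}) (G 1) (Vx M (Suc 1)) (u 1) (q 1)"
      proof (rule biproduct_cong[OF M_biprod_index[OF n_pos]])
        fix i assume "i \<in> (if 1 < n then {Fst, Snd} else {Snd})"
        then show "(if i = Fst then Vx X (1 + 2) else Vx Y (1 + 1)) = G 1 i"
          by (auto simp: G_def numeral_3_eq_3 split: if_splits)
        show "inc (Suc 1) i = u 1 i" "prj (Suc 1) i = q 1 i"
          by (simp_all add: u_def q_def numeral_2_eq_2)
      qed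
      ultimately show ?thesis using 2 octa_simps(2) index_two by simp
    next
      case 3
      obtain l where l: "k = Suc l" "l < n" using 3 by (cases k) auto
      have "biprod (Vx M (Suc k)) (Vx W k) (Vx N k) (inj k) (pro k)"
        using N_biprod[OF l(2)] unfolding l(1) .
      from biproduct_nested[OF M_biprod_index[OF 3(2)] this, of Trd]
      have "biproduct \<C> (insert Trd (if k < n then {Fst, Snd} else {Snd}))
        ((\<lambda>i. if i = Fst then Vx X (k + 2) else Vx Y (k + 1))(Trd := Vx W k)) (Vx N k)
        (\<lambda>x. if x = Trd then inj k Snd else inj k Fst \<cdot> inc (Suc k) x)
        (\<lambda>x. if x = Trd then pro k Snd else prj (Suc k) x \<cdot> pro k Fst)"
        by (simp split: if_splits)
      moreover have "I k = insert Trd (if k < n then {Fst, Snd} else {Snd})" using 3 by (auto simp: I_def)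
      moreover have "Vx octa k = Vx N k" using octa_simps(3)[of "l - 1"] l(1) 3(1) by (cases l) simp_all
      ultimately show ?thesis
        using 3 biproduct_cong by (fastforce simp: u_def q_def G_def split: summand.splits)
    next
      case 4
      have "I (Suc n) = {Trd}" using n_pos by (auto simp: I_def)
      moreover have "Vx octa (Suc n) = Vx W (Suc n)" using octa_simps(3)[of m] N_ends m by simp
      ultimately show ?thesis
        using 4 N_ends W' n_pos by (simp add: biproduct_singleton_iff Mor_iff u_def q_def G_def)
    qed
  qed
  note TB' = biproductD[OF TB]
  note octa_typing = is_sigma_seqD[OF octa_seq]
  have iF: "arr (inc (Suc k) Fst)" "dm (inc (Suc k) Fst) = Vx X (Suc (Suc k))" "cd (inc (Suc k) Fst) = Vx M (Suc k)"
    if "k < n" for k using M_biprodD[OF that] by simp_all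
  have mFF: "prj (Suc (Suc k)) Fst \<cdot> (Dif M (Suc k) \<cdot> inc (Suc k) Fst) = \<boxminus> Dif X (Suc (Suc k))" if "Suc k < n" for k
    unfolding M_Fst[OF that] using M_biprodD[OF that] X' \<phi>' that by simp
  have mSF: "prj (Suc (Suc k)) Snd \<cdot> (Dif M (Suc k) \<cdot> inc (Suc k) Fst) = \<phi> (Suc (Suc k))" if "k < n" for k
  proof (cases "Suc k = n")
    case True
    then show ?thesis using M_last M_ends(5) \<phi>' by simp
  next
    case False
    then have k: "Suc k < n" using that by simp
    show ?thesis unfolding M_Fst[OF k] using M_biprodD[OF k] X' \<phi>' k by simp
  qed
  have mFS: "prj (Suc (Suc k)) Fst \<cdot> (Dif M (Suc k) \<cdot> inc (Suc k) Snd) = zero_mor \<C> (Vx Y (Suc k)) (Vx X (Suc (Suc (Suc k))))"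
    if "Suc k < n" for k
    using M_Snd[of k] M_biprodD[OF that] Y' that by simp
  have mSS: "prj (Suc (Suc k)) Snd \<cdot> (Dif M (Suc k) \<cdot> inc (Suc k) Snd) = Dif Y (Suc k)" if "k < n" for k
    using M_Snd[OF that] comp_reassoc[OF M_Snd_typing(7)[of "Suc k"], of "Dif Y (Suc k)"] M_Snd_typing[of "Suc k"] Y' that by simp
  have TA: "Dif octa k \<cdot> u k c = Dif N k \<cdot> (inj k Fst \<cdot> inc (Suc k) c)"
    if k: "1 \<le> k" "k \<le> n" and ck: "c \<in> I k" "c \<noteq> Trd" for k c
  proof (cases "k = 1")
    case True
    then have "arr (inc 2 c)" "cd (inc 2 c) = Vx M 2"
      using TB'(4,6)[of 1 c] ck octa_simps n_pos by (simp_all add: u_def)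
    then show ?thesis using True octa_simps N' N1(1-15) n_pos index_two by (simp add: u_def numeral_2_eq_2)
  next
    case False
    then obtain j where "k = Suc (Suc j)" using k by (metis zero_one_or_more not_one_le_zero)
    then show ?thesis using octa_simps k ck by (simp add: u_def)
  qed
  have nF: "pro (Suc k) Fst \<cdot> (Dif N k \<cdot> (inj k Fst \<cdot> x)) = \<boxminus> (Dif M (Suc k) \<cdot> x)"
    and nS: "pro (Suc k) Snd \<cdot> (Dif N k \<cdot> (inj k Fst \<cdot> x)) = \<theta> (Suc k) \<cdot> x"
    if k: "1 \<le> k" "k < n" and x: "arr x" "cd x = Vx M (Suc k)" for k x
  proof -
    obtain l where l: "k = Suc l" "l < n" using k by (cases k) auto
    have j: "arr (inj k Fst)" "dm (inj k Fst) = Vx M (Suc k)" "cd (inj k Fst) = Vx N k"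
      using N_biprodD(4-6)[OF l(2)] l by simp_all
    have eq: "Dif N k \<cdot> (inj k Fst \<cdot> x) = (inj (Suc k) Fst \<cdot> \<boxminus> Dif M (Suc k) \<boxplus> inj (Suc k) Snd \<cdot> \<theta> (Suc k)) \<cdot> x"
      by (rule comp_reassoc[OF N_Fst[OF k(2)]]) (use j k x N' in simp_all)
    show "pro (Suc k) Fst \<cdot> (Dif N k \<cdot> (inj k Fst \<cdot> x)) = \<boxminus> (Dif M (Suc k) \<cdot> x)"
      "pro (Suc k) Snd \<cdot> (Dif N k \<cdot> (inj k Fst \<cdot> x)) = \<theta> (Suc k) \<cdot> x"
      unfolding eq using N_biprodD[OF k(2)] M' \<theta>' k x by simp_all
  qed
  have nSn: "Dif N n \<cdot> (inj n Fst \<cdot> x) = \<theta> (Suc n) \<cdot> x" if "arr x" "cd x = Vx M (Suc n)" for x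
    by (rule comp_reassoc[OF N_last]) (use N_biprodD(1-15)[of m] N' that m in simp_all)
  have inX: "arr (inc (Suc k) c)" "cd (inc (Suc k) c) = Vx M (Suc k)" if "1 \<le> k" "k \<le> n" "c \<in> I k" "c \<noteq> Trd" for k c
    using that iF[of k] M_Snd_typing[of k] by (auto simp: I_def)
  have eT: "q (Suc k) Trd \<cdot> (Dif octa k \<cdot> u k c) = \<theta> (Suc k) \<cdot> inc (Suc k) c"
    if k: "1 \<le> k" "k \<le> n" and ck: "c \<in> I k" "c \<noteq> Trd" for k c
  proof -
    have "q (Suc k) Trd = pro (Suc k) Snd" using k by (simp add: q_def)
    then show ?thesis
      using TA[OF k ck] nS[of k "inc (Suc k) c"] nSn[of "inc (Suc k) c"] inX[OF k ck] \<theta>' N_ends k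
      by (cases "k = n") simp_all
  qed
  have eM: "q (Suc k) r \<cdot> (Dif octa k \<cdot> u k c) = \<boxminus> (prj (Suc (Suc k)) r \<cdot> (Dif M (Suc k) \<cdot> inc (Suc k) c))"
    if k: "1 \<le> k" "k < n" and ck: "c \<in> I k" "c \<noteq> Trd" and r: "r \<in> I (Suc k)" "r \<noteq> Trd" for k c r
  proof -
    have p: "arr (prj (Suc (Suc k)) r)" "dm (prj (Suc (Suc k)) r) = Vx M (Suc (Suc k))"
      using r M_biprodD[of "Suc k"] M_Snd_typing[of "Suc k"] k by (auto simp: I_def)
    have "q (Suc k) r = prj (Suc (Suc k)) r \<cdot> pro (Suc k) Fst" using k r by (simp add: q_def)
    moreover have "arr (Dif octa k \<cdot> u k c)" "cd (Dif octa k \<cdot> u k c) = Vx N (Suc k)"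
    proof -
      have "Vx octa (Suc k) = Vx N (Suc k)" using octa_simps(3)[of "k - 1"] k by (cases k) simp_all
      then show "arr (Dif octa k \<cdot> u k c)" "cd (Dif octa k \<cdot> u k c) = Vx N (Suc k)"
        using TB'(4-6)[of k c] octa_typing(2-4)[of k] k ck by simp_all
    qed
    ultimately have "q (Suc k) r \<cdot> (Dif octa k \<cdot> u k c) =
      prj (Suc (Suc k)) r \<cdot> (pro (Suc k) Fst \<cdot> (Dif octa k \<cdot> u k c))"
      using p N_biprodD(1-15)[OF k(2)] by simp
    also have "pro (Suc k) Fst \<cdot> (Dif octa k \<cdot> u k c) = \<boxminus> (Dif M (Suc k) \<cdot> inc (Suc k) c)"
      using TA[OF k(1) _ ck] nF[OF k, of "inc (Suc k) c"] inX[OF k(1) _ ck] k by simp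
    finally show ?thesis
      using p inX[OF k(1) _ ck] M' k by simp
  qed
  have TW: "Dif octa k \<cdot> u k Trd = inj (Suc k) Snd \<cdot> Dif W k" if "2 \<le> k" "k \<le> n" for k
  proof -
    obtain l where l: "k = Suc (Suc l)" using \<open>2 \<le> k\<close> zero_one_or_more[of k] by auto
    then show ?thesis using octa_simps(6)[of l] N_Snd[of "Suc l"] that by (simp add: u_def)
  qed
  have eTT: "q (Suc k) Trd \<cdot> (Dif octa k \<cdot> u k Trd) = Dif W k" if k: "2 \<le> k" "k \<le> n" for k
  proof (cases "k = n")
    case True
    then show ?thesis unfolding TW[OF k] using N_ends W' k by (simp add: q_def)
  next
    case False
    then have "k < n" using k by simp
    then show ?thesis unfolding TW[OF k] using N_biprodD[of k] W' k by (simp add: q_def)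
  qed
  have eMT: "q (Suc k) r \<cdot> (Dif octa k \<cdot> u k Trd) = zero_mor \<C> (Vx W k) (G (Suc k) r)"
    if k: "2 \<le> k" "k < n" and r: "r \<in> I (Suc k)" "r \<noteq> Trd" for k r
  proof -
    have p: "arr (prj (Suc (Suc k)) r)" "dm (prj (Suc (Suc k)) r) = Vx M (Suc (Suc k))"
      "cd (prj (Suc (Suc k)) r) = G (Suc k) r"
      using r M_biprodD[of "Suc k"] M_Snd_typing[of "Suc k"] k by (auto simp: I_def G_def)
    have "q (Suc k) r = prj (Suc (Suc k)) r \<cdot> pro (Suc k) Fst" using k r by (simp add: q_def)
    then show ?thesis
      using TW[of k] N_biprodD[of k] W' p k by simp
  qed
  \<comment> \<open>The decomposition with signs, for which the block matrices are those of the octahedral sequence.\<close>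
  let ?u = "\<lambda>k i. if i = Fst \<and> odd k then \<boxminus> u k i else u k i"
  let ?q = "\<lambda>k i. if i = Fst \<and> odd k then \<boxminus> q k i else q k i"
  let ?D = "\<lambda>k r c. case (r, c) of
            (Fst, Fst) \<Rightarrow>
              if k = 0 then Dif X 2 else neg_mor \<C> (Vx X (k + 2)) (Vx X (k + 3)) (Dif X (k + 2))
          | (Snd, Fst) \<Rightarrow>
              if k = 0 then \<phi> 2 else sgn_mor \<C> (Vx X (k + 2)) (Vx Y (k + 2)) (k + 3) (\<phi> (k + 2))
          | (Trd, Fst) \<Rightarrow> \<phi>2 (k + 2)
          | (Snd, Snd) \<Rightarrow> neg_mor \<C> (Vx Y (k + 1)) (Vx Y (k + 2)) (Dif Y (k + 1))
          | (Trd, Snd) \<Rightarrow> \<psi> (k + 1)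
          | (Trd, Trd) \<Rightarrow> Dif W k
          | _ \<Rightarrow> zero_mor \<C> (G k c) (G (k + 1) r)"
  have "block_chain n \<C> I G ?D octa"
    unfolding block_chain_def
  proof (rule exI[of _ ?u], rule exI[of _ ?q], intro conjI allI impI ballI)
    fix k assume "k \<le> n + 1"
    then show "biproduct \<C> (I k) (G k) (Vx octa k) (?u k) (?q k)"
      using biproduct_change_signs[OF TB, of k "\<lambda>i. i = Fst \<and> odd k"] by simp
  next
    fix k i assume "k \<in> {0, n + 1}" and i: "i \<in> I k"
    then consider "k = 0" "i = Fst" | "k = Suc n" "i = Trd"
      using n_pos by (auto simp: I_def)
    then have "Vx octa k = G k i \<and> ?u k i = IdM \<C> (G k i) \<and> ?q k i = IdM \<C> (G k i)"
      using octa_simps(1) octa_simps(3)[of m] N_ends index_two m n_pos by cases (simp_all add: G_def u_def q_def)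
    then show "Vx octa k = G k i" "?u k i = IdM \<C> (G k i)" "?q k i = IdM \<C> (G k i)" by blast+
  next
    fix k assume k: "k \<le> n"
    then show "Dif octa k \<in> Mor \<C> (Vx octa k) (Vx octa (k + 1))" using octa_typing by (simp add: Mor_iff)
    fix c r assume c: "c \<in> I k" and r: "r \<in> I (k + 1)"
    have r': "r \<in> I (Suc k)" using r by simp
    have t: "arr (q (Suc k) r)" "dm (q (Suc k) r) = Vx octa (Suc k)" "arr (u k c)" "cd (u k c) = Vx octa k"
      using TB'(4-9)[of k c] TB'(4-9)[of "Suc k" r] c r k by simp_all
    have "?q (k + 1) r \<cdot> Dif octa k \<cdot> ?u k c = ?D k r c"
    proof (cases "k = 0")
      case True
      have "c = Fst" "r = Fst \<and> 1 < n \<or> r = Snd" using c r True by (auto simp: I_def)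
      then show ?thesis
        using True mFF[of 0] mSF[of 0] octa_simps M1(1-15) M' t index_two n_pos X' n_gt_0
        by (auto simp: u_def q_def numeral_2_eq_2)
    next
      case False
      then have k1: "1 \<le> k" by simp
      let ?e = "q (Suc k) r \<cdot> (Dif octa k \<cdot> u k c)"
      have "(if P then \<boxminus> q (Suc k) r else q (Suc k) r) \<cdot> Dif octa k \<cdot> (if Q then \<boxminus> u k c else u k c) =
          (if P \<noteq> Q then \<boxminus> ?e else ?e)" for P Q
        using t octa_typing(2-4)[of k] k by simp
      from this[of "r = Fst \<and> odd (k + 1)" "c = Fst \<and> odd k"]
      have e: "?q (k + 1) r \<cdot> Dif octa k \<cdot> ?u k c =
          (if (r = Fst \<and> odd (k + 1)) \<noteq> (c = Fst \<and> odd k) then \<boxminus> ?e else ?e)"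
        unfolding Suc_eq_plus1 .
      consider "r = Fst" "c = Fst" "Suc k < n" | "r = Snd" "c = Fst" "k < n" | "r = Trd" "c = Fst" "k < n"
        | "r = Fst" "c = Snd" "Suc k < n" | "r = Snd" "c = Snd" "k < n" | "r = Trd" "c = Snd"
        | "r = Trd" "c = Trd" "2 \<le> k" | "r \<noteq> Trd" "c = Trd" "2 \<le> k" "k < n"
        using c r k by (cases r; cases c; simp add: I_def; linarith)
      then show ?thesis
      proof cases
        case 1
        then show ?thesis unfolding e using eM[OF k1 _ c _ r'] mFF[of k] X' k1 False
          by (simp add: neg_mor_eq numeral_3_eq_3)
      next
        case 2
        then show ?thesis unfolding e using eM[OF k1 _ c _ r'] mSF[of k] \<phi>' k1 False
          by (simp add: sgn_mor_eq)
      next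
        case 3
        then show ?thesis unfolding e using eT[OF k1 k c] False
          by (simp add: \<phi>2_def)
      next
        case 4
        then show ?thesis unfolding e using eM[OF k1 _ c _ r'] mFS[of k] X' Y' k1 False
          by (simp add: G_def numeral_3_eq_3)
      next
        case 5
        then show ?thesis unfolding e using eM[OF k1 _ c _ r'] mSS[of k] Y' k1 False
          by (simp add: neg_mor_eq)
      next
        case 6
        then show ?thesis unfolding e using eT[OF k1 k c] False
          by (simp add: \<psi>_def)
      next
        case 7
        then show ?thesis unfolding e using eTT[of k] k by simp
      next
        case 8
        have z: "?e = zero_mor \<C> (G k Trd) (G (Suc k) r)"
          using eMT[OF 8(3,4) r'] 8 by (simp add: G_def)
        have "G k Trd \<in> Obj \<C>" "G (Suc k) r \<in> Obj \<C>"
          using TB'(3)[of k c] TB'(3)[of "Suc k" r] c r k 8 by simp_all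
        then show ?thesis unfolding e z using 8 by (cases r) simp_all
      qed
    qed
    then show "?q (k + 1) r \<cdot> Dif octa k \<cdot> ?u k c = ?D k r c" .
  qed
  then show ?thesis
    using octa_simps(7) unfolding octahedral_seq_def Let_def I_def G_def by simp
qed

end

context suspended_n_exangulated
begin

text \<open>The projection \<open>M\<^sub>1 = X\<^sub>2 \<oplus> Y\<^sub>1 \<rightarrow> Y\<^sub>1 = W\<^sub>1\<close> and the identity of \<open>M\<^sub>0 = X\<^sub>1\<close> form a commutative square with
  the first maps of the cone \<open>M\<close> and of \<open>W\<close>, as \<open>\<phi>\<^sub>1\<close> is the first map of \<open>W\<close>. So there is a lift
  \<open>\<theta>\<close> of them with a distinguished cone \<open>N\<close>, and the equation that makes \<open>\<theta>\<close> compatible with the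
  extensions is the required condition on \<open>\<psi>\<^sub>n\<^sub>+\<^sub>1\<close>.\<close>

lemma angles_RN4:
  assumes X: "X \<in> angles" and Y: "Y \<in> angles" and W: "W \<in> angles"
    and e: "Vx Y 0 = Vx X 0" "Vx W 0 = Vx X 1" "Vx W 1 = Vx Y 1" "Dif Y 0 = Dif W 0 \<cdot> Dif X 0"
  shows "\<exists>\<phi> \<psi> \<phi>' T.
        \<phi> 0 = IdM \<C> (Vx X 0) \<and> \<phi> 1 = Dif W 0 \<and> sigma_mor n \<C> \<Sigma> X Y \<phi> \<and>
        (\<forall>j\<in>{2..n + 1}. \<psi> j \<in> Mor \<C> (Vx Y j) (Vx W j)) \<and>
        (\<forall>k\<in>{3..n + 1}. \<phi>' k \<in> Mor \<C> (Vx X k) (Vx W (k - 1))) \<and>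
        Dif W (n + 1) \<cdot> \<psi> (n + 1) = FMor \<Sigma> (Dif X 0) \<cdot> Dif Y (n + 1) \<and>
        octahedral_seq n \<C> \<Sigma> X Y W \<phi> \<psi> \<phi>' T \<and> T \<in> angles"
proof -
  obtain \<delta> where \<delta>: "dist X \<delta>" "\<delta> \<in> carrier (Ext E (Vx X (Suc n)) (Vx X 0))"
    "Dif X (Suc n) = \<Phi> (Vx X (Suc n)) (Vx X 0) \<delta>" using anglesE[OF X] .
  obtain \<rho> where \<rho>: "dist Y \<rho>" "\<rho> \<in> carrier (Ext E (Vx Y (Suc n)) (Vx Y 0))"
    "Dif Y (Suc n) = \<Phi> (Vx Y (Suc n)) (Vx Y 0) \<rho>" using anglesE[OF Y] .
  obtain \<omega> where \<omega>: "dist W \<omega>" "\<omega> \<in> carrier (Ext E (Vx W (Suc n)) (Vx W 0))"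
    "Dif W (Suc n) = \<Phi> (Vx W (Suc n)) (Vx W 0) \<omega>" using anglesE[OF W] .
  note X' = is_sigma_seqD[OF angle_seq[OF X]] and Y' = is_sigma_seqD[OF angle_seq[OF Y]]
    and W' = is_sigma_seqD[OF angle_seq[OF W]]
  have n0: "0 < n" using n_pos by simp
  obtain \<phi> M where \<phi>: "complex_mor n \<C> X Y \<phi>" "\<phi> 0 = IdM \<C> (Vx X 0)" "\<phi> 1 = Dif W 0"
    "pull \<C> E (Vx Y 0) (\<phi> (Suc n)) \<rho> = \<delta>" and M: "mapping_cone n \<C> X Y \<phi> M"
    "dist M (push \<C> E (Vx Y (Suc n)) (Dif X 0) \<rho>)"
    using good_lift_prescribed[OF \<delta>(1) \<rho>(1) e(1)[symmetric], of "Dif W 0"] W' e by auto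
  note \<phi>' = complex_morD[OF \<phi>(1)] and M' = is_complexD[OF distD(1)[OF M(2)]]
  have \<phi>_sigma: "sigma_mor n \<C> \<Sigma> X Y \<phi>"
    using push_eq_pull_iff[of "IdM \<C> (Vx X 0)" "\<phi> (Suc n)" \<delta> \<rho>] \<phi> \<phi>' X' Y' \<delta>(2,3) \<rho>(2,3) e
    unfolding sigma_mor_iff by simp
  obtain inc prj where c: "cone_data n X Y \<phi> M inc prj"
    using cone_data_exists[OF n_pos distD(1)[OF \<delta>(1)] distD(1)[OF \<rho>(1)] M(1)] .
  have Me: "Vx M 0 = Vx X 1" "inc 0 Fst = IdM \<C> (Vx X 1)" "Vx M (Suc n) = Vx Y (Suc n)"
    "inc (Suc n) Snd = IdM \<C> (Vx Y (Suc n))"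
    and MF: "Dif M 0 \<cdot> inc 0 Fst = inc (Suc 0) Fst \<cdot> \<boxminus> Dif X (Suc 0) \<boxplus> inc (Suc 0) Snd \<cdot> \<phi> (Suc 0)"
    and b1: "biprod (Vx X (Suc (Suc 0))) (Vx Y (Suc 0)) (Vx M (Suc 0)) (inc (Suc 0)) (prj (Suc 0))"
    using c n0 unfolding cone_data_def by blast+
  note b1' = biproduct_pairD[OF b1]
  have M0: "Dif M 0 = inc 1 Fst \<cdot> \<boxminus> Dif X 1 \<boxplus> inc 1 Snd \<cdot> Dif W 0"
    using MF Me M' \<phi>(3) by simp
  have v: "arr (prj 1 Snd)" "dm (prj 1 Snd) = Vx M 1" "cd (prj 1 Snd) = Vx W 1" "prj 1 Snd \<cdot> Dif M 0 = Dif W 0"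
    using b1' e M' X' W' n_pos unfolding M0 by simp_all
  have WM: "Vx M 0 = Vx W 0" using Me(1) e(2) by simp
  obtain \<theta> N where \<theta>: "complex_mor n \<C> M W \<theta>" "\<theta> 1 = prj 1 Snd"
    "pull \<C> E (Vx W 0) (\<theta> (Suc n)) \<omega> = push \<C> E (Vx Y (Suc n)) (Dif X 0) \<rho>"
    and N: "mapping_cone n \<C> M W \<theta> N" "dist N (push \<C> E (Vx W (Suc n)) (Dif M 0) \<omega>)"
    using good_lift_prescribed[OF M(2) \<omega>(1) WM v] by blast
  note \<theta>' = complex_morD[OF \<theta>(1)]
  obtain inj pro where d: "cone_data n M W \<theta> N inj pro"
    using cone_data_exists[OF n_pos distD(1)[OF M(2)] distD(1)[OF \<omega>(1)] N(1)] .
  have "Vx N 0 = Vx M 1" "Vx N (Suc n) = Vx W (Suc n)" using d unfolding cone_data_def by simp_all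
  then have N_angle: "with_last N (FMor \<Sigma> (Dif M 0) \<cdot> Dif W (Suc n)) \<in> angles"
    using with_last_angle[OF N(2)] M' W' \<omega>(2,3) Me e by simp
  have last: "Dif W (Suc n) \<cdot> (\<theta> (Suc n) \<cdot> inc (Suc n) Snd) = FMor \<Sigma> (Dif X 0) \<cdot> Dif Y (Suc n)"
    using push_eq_pull_iff[of "Dif X 0" "\<theta> (Suc n)" \<rho> \<omega>] \<theta>(3) \<theta>' Me X' Y' W' e \<rho>(2,3) \<omega>(2,3) n_pos by simp
  note ends = \<phi>(2,3)
  interpret octahedron \<C> E n \<s> \<Sigma> \<Phi> X Y W M N \<phi> \<theta> inc prj inj pro
    by unfold_locales (fact X Y W e(1-3) \<phi>(1,3) distD(1)[OF M(2)] c \<theta>(1,2) distD(1)[OF N(2)] d N_angle)+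
  show ?thesis
    using ends \<phi>_sigma \<psi>_mor \<phi>2_mor last octa_octahedral octa_angle
    by (intro exI[of _ \<phi>] exI[of _ \<psi>] exI[of _ \<phi>2] exI[of _ octa]) (simp add: \<psi>_def)
qed

lemma angles_right_angulated: "right_angulated_category \<C> n \<Sigma> angles"
proof (unfold_locales, rule suspension)
  fix X Y assume X: "X \<in> angles" and Y: "is_sigma_seq n \<C> \<Sigma> Y" and "sigma_isomorphic n \<C> \<Sigma> X Y"
  then obtain \<phi> where \<phi>: "sigma_mor n \<C> \<Sigma> X Y \<phi>" "\<And>i. i \<le> Suc n \<Longrightarrow> iso_mor \<C> (Vx X i) (Vx Y i) (\<phi> i)"
    unfolding sigma_isomorphic_def by auto
  note X' = is_sigma_seqD[OF angle_seq[OF X]] and Y' = is_sigma_seqD[OF Y]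
    and \<phi>' = complex_morD[OF \<phi>(1)[unfolded sigma_mor_iff, THEN conjunct1]]
  have "\<forall>i\<in>{..Suc n}. \<exists>g. arr g \<and> dm g = Vx Y i \<and> cd g = Vx X i \<and>
      g \<cdot> \<phi> i = IdM \<C> (Vx X i) \<and> \<phi> i \<cdot> g = IdM \<C> (Vx Y i)"
  proof
    fix i assume "i \<in> {..Suc n}"
    then have "iso_mor \<C> (Vx X i) (Vx Y i) (\<phi> i)" using \<phi>(2) by simp
    then show "\<exists>g. arr g \<and> dm g = Vx Y i \<and> cd g = Vx X i \<and>
        g \<cdot> \<phi> i = IdM \<C> (Vx X i) \<and> \<phi> i \<cdot> g = IdM \<C> (Vx Y i)"
      unfolding iso_mor_def Mor_iff Bex_def by blast
  qed
  then obtain g where "\<forall>i\<in>{..Suc n}. arr (g i) \<and> dm (g i) = Vx Y i \<and> cd (g i) = Vx X i \<and>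
      g i \<cdot> \<phi> i = IdM \<C> (Vx X i) \<and> \<phi> i \<cdot> g i = IdM \<C> (Vx Y i)"
    by (rule bchoice[THEN exE])
  then have g: "arr (g i)" "dm (g i) = Vx Y i" "cd (g i) = Vx X i"
      "g i \<cdot> \<phi> i = IdM \<C> (Vx X i)" "\<phi> i \<cdot> g i = IdM \<C> (Vx Y i)" if "i \<le> Suc n" for i
    using that by auto
  \<comment> \<open>The inverses of the components form a morphism again, so \<open>Y\<close> is a retract of \<open>X\<close>.\<close>
  have "g (Suc i) \<cdot> Dif Y i = Dif X i \<cdot> g i" if i: "i \<le> n" for i
  proof -
    have "g (Suc i) \<cdot> Dif Y i = g (Suc i) \<cdot> ((Dif Y i \<cdot> \<phi> i) \<cdot> g i)"
      using i g[of i] g[of "Suc i"] \<phi>' Y' by simp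
    also have "\<dots> = (g (Suc i) \<cdot> \<phi> (Suc i)) \<cdot> (Dif X i \<cdot> g i)"
      using i g(1-3)[of i] g(1-3)[of "Suc i"] \<phi>'(1-3) \<phi>'(4)[OF i, symmetric] X' Y' by simp
    also have "\<dots> = Dif X i \<cdot> g i"
      using i g[of i] g[of "Suc i"] X' by simp
    finally show ?thesis .
  qed
  moreover have "FMor \<Sigma> (g 0) \<cdot> Dif Y (Suc n) = Dif X (Suc n) \<cdot> g (Suc n)"
  proof -
    have "FMor \<Sigma> (g 0) \<cdot> Dif Y (Suc n) = FMor \<Sigma> (g 0) \<cdot> ((Dif Y (Suc n) \<cdot> \<phi> (Suc n)) \<cdot> g (Suc n))"
      using g[of 0] g[of "Suc n"] \<phi>' Y' by simp
    also have "Dif Y (Suc n) \<cdot> \<phi> (Suc n) = FMor \<Sigma> (\<phi> 0) \<cdot> Dif X (Suc n)"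
      using \<phi>(1) unfolding sigma_mor_iff by simp
    also have "FMor \<Sigma> (g 0) \<cdot> ((FMor \<Sigma> (\<phi> 0) \<cdot> Dif X (Suc n)) \<cdot> g (Suc n)) =
        FMor \<Sigma> (g 0 \<cdot> \<phi> 0) \<cdot> (Dif X (Suc n) \<cdot> g (Suc n))"
      using g(1-3)[of 0] g(1-3)[of "Suc n"] \<phi>' X' Y' by simp
    also have "\<dots> = Dif X (Suc n) \<cdot> g (Suc n)"
      using g[of 0] g[of "Suc n"] X' by simp
    finally show ?thesis .
  qed
  ultimately have "sigma_mor n \<C> \<Sigma> Y X g"
    unfolding sigma_mor_iff complex_mor_def Mor_iff using g(1-3) by simp
  then show "Y \<in> angles"
    using angle_retract[OF X Y \<phi>(1)] g(5) by blast
next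
  fix X Y S assume X: "X \<in> angles" and Y: "Y \<in> angles" and S: "is_sigma_seq n \<C> \<Sigma> S"
    and "sigma_direct_sum n \<C> \<Sigma> X Y S"
  then obtain inc prj where
    b: "\<And>k. k \<le> Suc n \<Longrightarrow> biprod (Vx X k) (Vx Y k) (Vx S k) (inc k) (prj k)"
    and s: "sigma_mor n \<C> \<Sigma> X S (\<lambda>k. inc k Fst)" "sigma_mor n \<C> \<Sigma> Y S (\<lambda>k. inc k Snd)"
      "sigma_mor n \<C> \<Sigma> S X (\<lambda>k. prj k Fst)" "sigma_mor n \<C> \<Sigma> S Y (\<lambda>k. prj k Snd)"
    unfolding sigma_direct_sum_def by auto
  show "S \<in> angles"
    by (rule angle_split_cover[OF X Y S s(1,3,2,4)]) (rule biproduct_pairD(20)[OF b])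
next
  fix X Y S assume S: "S \<in> angles" and X: "is_sigma_seq n \<C> \<Sigma> X" and Y: "is_sigma_seq n \<C> \<Sigma> Y"
    and "sigma_direct_sum n \<C> \<Sigma> X Y S"
  then obtain inc prj where
    b: "\<And>k. k \<le> Suc n \<Longrightarrow> biprod (Vx X k) (Vx Y k) (Vx S k) (inc k) (prj k)"
    and s: "sigma_mor n \<C> \<Sigma> X S (\<lambda>k. inc k Fst)" "sigma_mor n \<C> \<Sigma> Y S (\<lambda>k. inc k Snd)"
      "sigma_mor n \<C> \<Sigma> S X (\<lambda>k. prj k Fst)" "sigma_mor n \<C> \<Sigma> S Y (\<lambda>k. prj k Snd)"
    unfolding sigma_direct_sum_def by auto
  show "X \<in> angles \<and> Y \<in> angles"
    using angle_retract[OF S X s(3,1)] angle_retract[OF S Y s(4,2)] biproduct_pairD(16,17)[OF b] by blast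
next
  fix f A B assume "f \<in> Mor \<C> A B"
  then show "\<exists>X\<in>angles. Vx X 0 = A \<and> Vx X 1 = B \<and> Dif X 0 = f"
    using angles_RN1_extend[of f] by (simp add: Mor_iff)
qed (fact angle_seq angles_RN1_trivial angles_RN2 angles_RN3 angles_RN4)+

text \<open>As \<open>\<Phi>\<close> is injective, the last map of an angle determines the extension for which it is
  distinguished.\<close>

lemma angles_induce: "induced_by n \<C> E \<s> \<Sigma> angles"
  unfolding induced_by_def
proof (intro exI[of _ \<Phi>] conjI ballI impI Phi_iso)
  fix C A \<delta> assume C: "C \<in> Obj \<C>" and A: "A \<in> Obj \<C>" and \<delta>: "\<delta> \<in> carrier (Ext E C A)"
  obtain X where X: "Vx X 0 = A" "Vx X (Suc n) = C" "dist X \<delta>"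
    using dist_realized[OF C A \<delta>] .
  show "\<exists>X\<in>angles. Vx X 0 = A \<and> Vx X (n + 1) = C \<and> Dif X (n + 1) = \<Phi> C A \<delta>"
    using with_last_angle[OF X(3)] X by (intro bexI) auto
  fix Y assume Y: "Y \<in> angles" and e: "Vx Y 0 = A \<and> Vx Y (n + 1) = C \<and> Dif Y (n + 1) = \<Phi> C A \<delta>"
  obtain \<epsilon> where "dist Y \<epsilon>" "\<epsilon> \<in> carrier (Ext E (Vx Y (Suc n)) (Vx Y 0))"
    "Dif Y (Suc n) = \<Phi> (Vx Y (Suc n)) (Vx Y 0) \<epsilon>" using anglesE[OF Y] .
  then show "dist Y \<delta>" using e Phi_inj[OF C A _ \<delta>] by auto
qed

end

section \<open>The equivalence\<close>

theorem theorem4p3: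
  fixes \<C> :: "('o, 'm) category" and E :: "('o, 'm, 'e) bifunctor"
    and n :: nat and \<s> :: "('o, 'm, 'e) realization"
  assumes "1 \<le> n" and "n_exangulated_category \<C> E n \<s>"
  shows
    "((\<exists>\<Sigma> \<Phi>. additive_endofunctor \<C> \<Sigma> \<and> fully_faithful \<C> \<Sigma> \<and> bifunctor_iso \<C> E \<Sigma> \<Phi> \<and>
        (\<forall>U\<in>Obj \<C>. \<forall>V\<in>Obj \<C>. \<forall>u\<in>Mor \<C> U (FOb \<Sigma> V).
          \<exists>X \<delta>. distinguished n \<C> E \<s> X \<delta> \<and> Vx X 0 = V \<and> Vx X (n + 1) = U \<and> \<Phi> U V \<delta> = u))
      \<longleftrightarrow>
      (\<forall>C\<in>Obj \<C>. \<forall>Z. zero_object \<C> Z \<longrightarrow> trivial_inflation n \<C> E \<s> (zero_mor \<C> C Z)))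
    \<and>
    ((\<forall>C\<in>Obj \<C>. \<forall>Z. zero_object \<C> Z \<longrightarrow> trivial_inflation n \<C> E \<s> (zero_mor \<C> C Z))
      \<longleftrightarrow>
      (\<exists>\<Sigma> \<Theta>. right_angulated_category \<C> n \<Sigma> \<Theta> \<and> induced_by n \<C> E \<s> \<Sigma> \<Theta>))"
    (is "(?suspension \<longleftrightarrow> ?trivial) \<and> (?trivial \<longleftrightarrow> ?angulated)")
proof -
  interpret n_exangulated \<C> E n \<s>
    using assms by (simp add: n_exangulated_def n_exangulated_axioms_def)
  have "?trivial" if ?suspension
  proof -
    from that obtain \<Sigma> \<Phi> where "additive_endofunctor \<C> \<Sigma>" "fully_faithful \<C> \<Sigma>" "bifunctor_iso \<C> E \<Sigma> \<Phi>"
      by blast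
    then interpret suspended_n_exangulated \<C> E n \<s> \<Sigma> \<Phi>
      by unfold_locales
    show ?thesis
    proof (intro ballI allI impI)
      fix C Z assume C: "C \<in> Obj \<C>" and Z: "zero_object \<C> Z"
      obtain \<eta> where "dist (flat_chain Z C (FOb \<Sigma> C)) \<eta>"
        using dist_suspension[OF C Z] .
      then show "trivial_inflation n \<C> E \<s> (zero_mor \<C> C Z)"
        by (rule trivial_inflation_of_flat_chain[OF _ Z])
    qed
  qed
  moreover have "?suspension" if trivial: ?trivial
  proof -
    obtain \<Sigma> \<Phi> where S: "additive_endofunctor \<C> \<Sigma>" "fully_faithful \<C> \<Sigma>" "bifunctor_iso \<C> E \<Sigma> \<Phi>"
      using suspension_exists[OF trivial] by blast
    then interpret suspended_n_exangulated \<C> E n \<s> \<Sigma> \<Phi>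
      by unfold_locales
    have "\<exists>X \<delta>. dist X \<delta> \<and> Vx X 0 = V \<and> Vx X (n + 1) = U \<and> \<Phi> U V \<delta> = u"
      if V: "V \<in> Obj \<C>" and u: "u \<in> Mor \<C> U (FOb \<Sigma> V)" for U V u
    proof -
      have u': "arr u" "dm u = U" "cd u = FOb \<Sigma> V" using u by (simp_all add: Mor_iff)
      obtain \<delta> where \<delta>: "\<delta> \<in> carrier (Ext E U V)" "\<Phi> U V \<delta> = u"
        using Phi_surj[OF V u'(1,3)] unfolding u'(2) .
      have "U \<in> Obj \<C>" using u' by auto
      then obtain X where "Vx X 0 = V" "Vx X (Suc n) = U" "dist X \<delta>"
        using dist_realized[OF _ V \<delta>(1)] by blast
      then show ?thesis using \<delta> by auto
    qed
    then show ?thesis using S by blast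
  qed
  moreover have "?angulated" if ?suspension
  proof -
    from that obtain \<Sigma> \<Phi> where "additive_endofunctor \<C> \<Sigma>" "fully_faithful \<C> \<Sigma>" "bifunctor_iso \<C> E \<Sigma> \<Phi>"
      by blast
    then interpret suspended_n_exangulated \<C> E n \<s> \<Sigma> \<Phi>
      by unfold_locales
    show ?thesis using angles_right_angulated angles_induce by blast
  qed
  moreover have "?trivial" if ?angulated
    using that trivial_inflation_of_induced by blast
  ultimately show ?thesis by blast
qed

end
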